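(* Let $C$ be a compact tropical curve of genus $g$ with a fixed reference point $p_0\in C$, and let $d\in\mathbb{Z}$. Then the Abel-Jacobi map $\mu:\operatorname{Div}^d(C)\to J(C)$ factors through the natural map $\operatorname{Div}^d(C)\to\operatorname{Pic}^d(C)$, i.e. there is a map $\phi:\operatorname{Pic}^d(C)\to J(C)$ whose composition with $\operatorname{Div}^d(C)\to\operatorname{Pic}^d(C)$ equals $\mu$, and $\phi$ is a bijection.
   Context: Compact tropical curves. A compact tropical curve $C$ is a connected finite (1-dimensional) graph, loops and multiple edges allowed, with a metric structure: each inner edge (one not adjacent to a 1-valent vertex) has a finite positive length, and each leaf (edge adjacent to a 1-valent vertex) has infinite length, the 1-valent vertices (the endpoints) lying at infinity. 2-valent vertices may be inserted or removed freely, so an interior point of an edge has valence 2. $C^\circ$ is the complement of the endpoints. The genus is $g=b_1(C)$. Rational functions and divisors. A rational function on $C$ is a continuous function $f:C^\circ\to\mathbb{R}$ that is piecewise linear with finitely many linear pieces and integer slopes with respect to arc length. For $p\in C$, $\operatorname{ord}_p(f)$ is the sum of the slopes of $f$ at $p$ along all edge directions emanating from $p$ (at an endpoint $p$: the slope of $f$ on the leaf near $p$ in the direction pointing away from $p$). $(f)=\sum_p\operatorname{ord}_p(f)\,p$. A divisor is a finite formal sum $D=\sum a_ip_i$, $a_i\in\mathbb{Z}$, $p_i\in C$; its degree is $\sum a_i$. $\operatorname{Div}^d(C)$ is the set of divisors of degree $d$. $D_1\sim D_2$ (linearly equivalent) if $D_1-D_2=(f)$ for some rational function $f$. Line bundles.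 Let $\mathcal{O}^*$ be the sheaf on $C$ of continuous real-valued functions that are locally linear with integer slopes along edges and such that at every point (endpoints included) the sum of outgoing slopes is $0$. $\operatorname{Pic}(C)=H^1(C,\mathcal{O}^* )$ is the group of isomorphism classes of line bundles. A divisor $D$ defines a line bundle: choose an open cover and local rational functions $f_i$ with divisor $D|_{U_i}$, and take the cocycle of differences $f_i-f_j$. Every line bundle arises in this way, and its degree is the degree of any such $D$; $\operatorname{Pic}^d(C)$ is the set of classes of degree $d$, and it is canonically identified with $\operatorname{Div}^d(C)/\sim$. Jacobian. A 1-form $\omega$ on $C$ assigns a real number $\omega(\xi)$ to each unit tangent (primitive) vector $\xi$ along each edge, constant along the edge, with $\omega(-\xi)=-\omega(\xi)$, such that at each point (endpoints included) the sum of $\omega(\xi)$ over outward primitive vectors $\xi$ is $0$ (so $\omega$ vanishes on leaves). $\Omega(C)$ is the $g$-dimensional real vector space of 1-forms. 1-forms can be integrated along paths. Integration over cycles embeds $\Lambda=H_1(C,\mathbb{Z})$ as a lattice in the dual space $\Omega(C)^*$, and $J(C)=\Omega(C)^*/\Lambda$. Abel-Jacobi map. For $D=\sum a_ip_i$, $\mu(D)\in J(C)$ is the class of the functional $\omega\mapsto\sum_i a_i\int_{p_0}^{p_i}\omega$, where paths from $p_0$ to $p_i$ are chosen arbitrarily. *)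

theory Defs
  imports
    "HOL-Analysis.Analysis"
    "HOL-Library.Poly_Mapping"
    "Graph_Theory.Digraph_Component"
begin

section \<open>Compact tropical curves\<close>

text \<open>
  A curve is presented by a finite multigraph \<open>skel C\<close> (its underlying directed multigraph; the
  direction of an arc only orients its coordinate) together with, for each arc \<open>e\<close>, an arc length
  coordinate running through the open interval from \<open>lo C e\<close> (at the tail) to \<open>hi C e\<close> (at the head).
  A coordinate value of plus or minus infinity at an end of \<open>e\<close> means that this end lies at infinity.
  In particular a segment with two 1-valent vertices is presented by a single arc with coordinate
  interval from minus to plus infinity.
\<close>

record ('v, 'e) metric_graph =
  skel :: "('v, 'e) pre_digraph"
  lo :: "'e \<Rightarrow> ereal"
  hi :: "'e \<Rightarrow> ereal"

abbreviation edges :: "('v, 'e) metric_graph \<Rightarrow> 'e set" where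
  "edges C \<equiv> arcs (skel C)"

definition valence :: "('v, 'e) metric_graph \<Rightarrow> 'v \<Rightarrow> nat" where
  "valence C v = in_degree (skel C) v + out_degree (skel C) v"

text \<open>
  The last two conditions say that the ends at infinity are exactly the 1-valent vertices; so inner
  edges have finite length and leaves have infinite length. The nonemptiness of \<open>edges C\<close> expresses
  that the curve is 1-dimensional, i.e. not a single point.
\<close>

definition tropical_curve :: "('v, 'e) metric_graph \<Rightarrow> bool" where
  "tropical_curve C \<longleftrightarrow>
     fin_digraph (skel C) \<and> Digraph_Component.connected (skel C) \<and> edges C \<noteq> {} \<and>
     (\<forall>e\<in>edges C. lo C e < hi C e \<and>
        (lo C e = -\<infinity> \<longleftrightarrow> valence C (tail (skel C) e) = 1) \<and>
        (hi C e = \<infinity> \<longleftrightarrow> valence C (head (skel C) e) = 1))"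

datatype ('v, 'e) point = Vertex 'v | EdgePt 'e real

definition points :: "('v, 'e) metric_graph \<Rightarrow> ('v, 'e) point set" where
  "points C = Vertex ` verts (skel C) \<union>
     {EdgePt e x | e x. e \<in> edges C \<and> lo C e < ereal x \<and> ereal x < hi C e}"

definition finite_points :: "('v, 'e) metric_graph \<Rightarrow> ('v, 'e) point set" where
  "finite_points C = points C - {Vertex v | v. valence C v = 1}"

text \<open>
  Tangent directions: \<open>(e, True)\<close> is the primitive vector along \<open>e\<close> of increasing coordinate,
  \<open>(e, False)\<close> its negative. \<open>tangents C p\<close> are the outward directions at \<open>p\<close>; a loop contributes
  both of its directions at its base vertex. \<open>germ C p \<xi>\<close> is the filter of those coordinates on the
  edge of \<open>\<xi>\<close> that tend to \<open>p\<close> from direction \<open>\<xi>\<close> (for a point at infinity this is \<open>at_top\<close> or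
  \<open>at_bot\<close>).
\<close>

fun tangents :: "('v, 'e) metric_graph \<Rightarrow> ('v, 'e) point \<Rightarrow> ('e \<times> bool) set" where
  "tangents C (Vertex v) = out_arcs (skel C) v \<times> {True} \<union> in_arcs (skel C) v \<times> {False}"
| "tangents C (EdgePt e x) = {(e, True), (e, False)}"

fun germ :: "('v, 'e) metric_graph \<Rightarrow> ('v, 'e) point \<Rightarrow> 'e \<times> bool \<Rightarrow> real filter" where
  "germ C (Vertex v) (e, True) = filtercomap ereal (at_right (lo C e))"
| "germ C (Vertex v) (e, False) = filtercomap ereal (at_left (hi C e))"
| "germ C (EdgePt e' x) (e, True) = at_right x"
| "germ C (EdgePt e' x) (e, False) = at_left x"

text \<open>
  A set is open iff with each of its points it contains a small segment in every direction; this is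
  the topology of the compact graph, points at infinity included.
\<close>

definition open_in_curve :: "('v, 'e) metric_graph \<Rightarrow> ('v, 'e) point set \<Rightarrow> bool" where
  "open_in_curve C U \<longleftrightarrow> U \<subseteq> points C \<and>
     (\<forall>p\<in>U. \<forall>\<xi>\<in>tangents C p. \<forall>\<^sub>F x in germ C p \<xi>. EdgePt (fst \<xi>) x \<in> U)"

definition curve_top :: "('v, 'e) metric_graph \<Rightarrow> ('v, 'e) point topology" where
  "curve_top C = topology (open_in_curve C)"

lemma openin_curve_top: "openin (curve_top C) U \<longleftrightarrow> open_in_curve C U"
proof -
  have "istopology (open_in_curve C)"
    unfolding istopology_def
  proof (intro conjI allI impI)
    fix S T assume "open_in_curve C S" "open_in_curve C T"
    then show "open_in_curve C (S \<inter> T)"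
      by (auto simp: open_in_curve_def eventually_conj_iff)
  next
    fix \<K> assume K: "\<forall>K\<in>\<K>. open_in_curve C K"
    have "\<forall>\<^sub>F x in germ C p \<xi>. EdgePt (fst \<xi>) x \<in> \<Union>\<K>"
      if "K \<in> \<K>" "p \<in> K" "\<xi> \<in> tangents C p" for K p \<xi>
    proof -
      have "\<forall>\<^sub>F x in germ C p \<xi>. EdgePt (fst \<xi>) x \<in> K"
        using K that by (auto simp: open_in_curve_def)
      then show ?thesis by eventually_elim (use that in auto)
    qed
    with K show "open_in_curve C (\<Union>\<K>)"
      by (fastforce simp: open_in_curve_def)
  qed
  then show ?thesis by (simp add: curve_top_def topology_inverse')
qed


section \<open>Rational functions and divisors\<close>

definition edge_part :: "('v, 'e) metric_graph \<Rightarrow> ('v, 'e) point set \<Rightarrow> 'e \<Rightarrow> real set" where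
  "edge_part C U e = {x. EdgePt e x \<in> U \<inter> points C}"

definition int_linear_on :: "real set \<Rightarrow> (real \<Rightarrow> real) \<Rightarrow> bool" where
  "int_linear_on I h \<longleftrightarrow> (\<exists>(m::int) c. \<forall>x\<in>I. h x = of_int m * x + c)"

text \<open>
  Rational functions on an open subset \<open>U\<close>; those on the curve are the case \<open>U = points C\<close>. Functions
  are total, but their values outside \<open>U \<inter> finite_points C\<close> play no role.
\<close>

definition rational_on ::
    "('v, 'e) metric_graph \<Rightarrow> ('v, 'e) point set \<Rightarrow> (('v, 'e) point \<Rightarrow> real) \<Rightarrow> bool" where
  "rational_on C U f \<longleftrightarrow>
     continuous_map (subtopology (curve_top C) (U \<inter> finite_points C)) euclideanreal f \<and>
     (\<forall>e\<in>edges C. \<exists>B. finite B \<and>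
        (\<forall>I. is_interval I \<and> I \<subseteq> edge_part C U e - B \<longrightarrow> int_linear_on I (\<lambda>x. f (EdgePt e x))))"

definition slope ::
    "('v, 'e) metric_graph \<Rightarrow> (('v, 'e) point \<Rightarrow> real) \<Rightarrow> ('v, 'e) point \<Rightarrow> 'e \<times> bool \<Rightarrow> int" where
  "slope C f p \<xi> = (THE m. \<exists>c. \<forall>\<^sub>F x in germ C p \<xi>.
     f (EdgePt (fst \<xi>) x) = (if snd \<xi> then of_int m else - of_int m) * x + c)"

definition ord_at :: "('v, 'e) metric_graph \<Rightarrow> (('v, 'e) point \<Rightarrow> real) \<Rightarrow> ('v, 'e) point \<Rightarrow> int" where
  "ord_at C f p = (\<Sum>\<xi>\<in>tangents C p. slope C f p \<xi>)"

type_synonym ('v, 'e) divisor = "('v, 'e) point \<Rightarrow>\<^sub>0 int"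

definition degree :: "('v, 'e) divisor \<Rightarrow> int" where
  "degree D = (\<Sum>p\<in>Poly_Mapping.keys D. Poly_Mapping.lookup D p)"

definition Div :: "('v, 'e) metric_graph \<Rightarrow> int \<Rightarrow> ('v, 'e) divisor set" where
  "Div C d = {D. Poly_Mapping.keys D \<subseteq> points C \<and> degree D = d}"


section \<open>Line bundles\<close>

text \<open>\<open>unit_section C U f\<close>: \<open>f\<close> is a section over \<open>U\<close> of the sheaf \<open>O\<^sup>*\<close>.\<close>

definition unit_section ::
    "('v, 'e) metric_graph \<Rightarrow> ('v, 'e) point set \<Rightarrow> (('v, 'e) point \<Rightarrow> real) \<Rightarrow> bool" where
  "unit_section C U f \<longleftrightarrow>
     continuous_map (subtopology (curve_top C) U) euclideanreal f \<and>
     (\<forall>e\<in>edges C. \<forall>I. is_interval I \<and> I \<subseteq> edge_part C U e \<longrightarrow>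
        int_linear_on I (\<lambda>x. f (EdgePt e x))) \<and>
     (\<forall>p\<in>U. ord_at C f p = 0)"

definition open_cover :: "('v, 'e) metric_graph \<Rightarrow> ('v, 'e) point set set \<Rightarrow> bool" where
  "open_cover C \<U> \<longleftrightarrow> (\<forall>U\<in>\<U>. openin (curve_top C) U) \<and> \<Union>\<U> = points C"

text \<open>
  \<open>Pic C\<close> is the first Cech cohomology of \<open>O\<^sup>*\<close>, i.e. the direct limit over all open covers. Covers are
  indexed by their own members; this loses nothing, as every indexed cover has such a refinement.
\<close>

type_synonym ('v, 'e) cochain =
  "('v, 'e) point set set \<times>
   (('v, 'e) point set \<Rightarrow> ('v, 'e) point set \<Rightarrow> ('v, 'e) point \<Rightarrow> real)"

definition cocycles :: "('v, 'e) metric_graph \<Rightarrow> ('v, 'e) cochain set" where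
  "cocycles C = {(\<U>, g). open_cover C \<U> \<and>
     (\<forall>U\<in>\<U>. \<forall>V\<in>\<U>. unit_section C (U \<inter> V) (g U V)) \<and>
     (\<forall>U\<in>\<U>. \<forall>V\<in>\<U>. \<forall>W\<in>\<U>. \<forall>p\<in>U \<inter> V \<inter> W. g U V p + g V W p = g U W p)}"

definition cohomologous :: "('v, 'e) metric_graph \<Rightarrow> (('v, 'e) cochain \<times> ('v, 'e) cochain) set" where
  "cohomologous C = {((\<U>, g), (\<V>, h)). (\<U>, g) \<in> cocycles C \<and> (\<V>, h) \<in> cocycles C \<and>
     (\<exists>\<W> \<rho> \<sigma> s. open_cover C \<W> \<and>
        (\<forall>W\<in>\<W>. \<rho> W \<in> \<U> \<and> W \<subseteq> \<rho> W \<and> \<sigma> W \<in> \<V> \<and> W \<subseteq> \<sigma> W \<and> unit_section C W (s W)) \<and>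
        (\<forall>W\<in>\<W>. \<forall>W'\<in>\<W>. \<forall>p\<in>W \<inter> W'.
           g (\<rho> W) (\<rho> W') p - h (\<sigma> W) (\<sigma> W') p = s W p - s W' p))}"

definition Pic :: "('v, 'e) metric_graph \<Rightarrow> ('v, 'e) cochain set set" where
  "Pic C = cocycles C // cohomologous C"

text \<open>
  The difference of two local equations is prescribed only on finite points; at a point at infinity
  the cocycle takes the continuous extension, since it consists of sections of \<open>O\<^sup>*\<close>.
\<close>

definition divisor_cocycle ::
    "('v, 'e) metric_graph \<Rightarrow> ('v, 'e) divisor \<Rightarrow> ('v, 'e) cochain \<Rightarrow> bool" where
  "divisor_cocycle C D = (\<lambda>(\<U>, g). (\<U>, g) \<in> cocycles C \<and>
     (\<exists>f. (\<forall>U\<in>\<U>. rational_on C U (f U) \<and> (\<forall>p\<in>U. ord_at C (f U) p = Poly_Mapping.lookup D p)) \<and>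
          (\<forall>U\<in>\<U>. \<forall>V\<in>\<U>. \<forall>p\<in>U \<inter> V \<inter> finite_points C. g U V p = f U p - f V p)))"

definition line_bundle :: "('v, 'e) metric_graph \<Rightarrow> ('v, 'e) divisor \<Rightarrow> ('v, 'e) cochain set" where
  "line_bundle C D = cohomologous C `` {SOME c. divisor_cocycle C D c}"

definition Pic_deg :: "('v, 'e) metric_graph \<Rightarrow> int \<Rightarrow> ('v, 'e) cochain set set" where
  "Pic_deg C d = {L \<in> Pic C. \<exists>D\<in>Div C d. L = line_bundle C D}"


section \<open>The Jacobian and the Abel--Jacobi map\<close>

definition one_forms :: "('v, 'e) metric_graph \<Rightarrow> ('e \<times> bool \<Rightarrow> real) set" where
  "one_forms C = {\<omega>. (\<forall>e b. e \<notin> edges C \<longrightarrow> \<omega> (e, b) = 0) \<and>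
     (\<forall>e b. \<omega> (e, \<not> b) = - \<omega> (e, b)) \<and>
     (\<forall>p\<in>points C. (\<Sum>\<xi>\<in>tangents C p. \<omega> \<xi>) = 0)}"

definition dual_forms :: "('v, 'e) metric_graph \<Rightarrow> (('e \<times> bool \<Rightarrow> real) \<Rightarrow> real) set" where
  "dual_forms C = {F \<in> extensional (one_forms C).
     (\<forall>\<omega>\<in>one_forms C. \<forall>\<eta>\<in>one_forms C. F (\<lambda>\<xi>. \<omega> \<xi> + \<eta> \<xi>) = F \<omega> + F \<eta>) \<and>
     (\<forall>a. \<forall>\<omega>\<in>one_forms C. F (\<lambda>\<xi>. a * \<omega> \<xi>) = a * F \<omega>)}"

text \<open>
  Coordinate of a point on the closed edge \<open>e\<close>, turned into a point of the curve. A path is a list of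
  oriented segments \<open>(e, s, t)\<close>, running on the closed edge \<open>e\<close> from coordinate \<open>s\<close> to \<open>t\<close>.
\<close>

definition at_coord :: "('v, 'e) metric_graph \<Rightarrow> 'e \<Rightarrow> ereal \<Rightarrow> ('v, 'e) point" where
  "at_coord C e s = (if s = lo C e then Vertex (tail (skel C) e)
                     else if s = hi C e then Vertex (head (skel C) e)
                     else EdgePt e (real_of_ereal s))"

fun is_path ::
    "('v, 'e) metric_graph \<Rightarrow> ('v, 'e) point \<Rightarrow> ('e \<times> ereal \<times> ereal) list \<Rightarrow> ('v, 'e) point \<Rightarrow> bool" where
  "is_path C p [] q \<longleftrightarrow> p \<in> points C \<and> p = q"
| "is_path C p ((e, s, t) # \<gamma>) q \<longleftrightarrow>
     e \<in> edges C \<and> s \<in> {lo C e..hi C e} \<and> t \<in> {lo C e..hi C e} \<and>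
     p = at_coord C e s \<and> is_path C (at_coord C e t) \<gamma> q"

text \<open>
  On segments reaching infinity \<open>real_of_ereal\<close> takes the value 0, which is harmless: they lie on
  leaves, where 1-forms vanish.
\<close>

definition path_integral :: "('e \<times> bool \<Rightarrow> real) \<Rightarrow> ('e \<times> ereal \<times> ereal) list \<Rightarrow> real" where
  "path_integral \<omega> \<gamma> = (\<Sum>(e, s, t)\<leftarrow>\<gamma>. \<omega> (e, True) * real_of_ereal (t - s))"

text \<open>Integral cellular 1-cycles; as there are no 2-cells, they form the first homology group.\<close>

definition H1 :: "('v, 'e) metric_graph \<Rightarrow> ('e \<Rightarrow> int) set" where
  "H1 C = {c. (\<forall>e. e \<notin> edges C \<longrightarrow> c e = 0) \<and>
     (\<forall>v\<in>verts (skel C). (\<Sum>e\<in>in_arcs (skel C) v. c e) = (\<Sum>e\<in>out_arcs (skel C) v. c e))}"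

text \<open>The first Betti number: the maximal size of a linearly independent set of cycles.\<close>

definition genus :: "('v, 'e) metric_graph \<Rightarrow> nat" where
  "genus C = (GREATEST n. \<exists>B. finite B \<and> card B = n \<and> B \<subseteq> H1 C \<and>
     (\<forall>k :: ('e \<Rightarrow> int) \<Rightarrow> int. (\<forall>e. (\<Sum>c\<in>B. k c * c e) = 0) \<longrightarrow> (\<forall>c\<in>B. k c = 0)))"

definition cycle_integral ::
    "('v, 'e) metric_graph \<Rightarrow> ('e \<Rightarrow> int) \<Rightarrow> ('e \<times> bool \<Rightarrow> real) \<Rightarrow> real" where
  "cycle_integral C c = (\<lambda>\<omega>\<in>one_forms C.
     \<Sum>e\<in>edges C. of_int (c e) * path_integral \<omega> [(e, lo C e, hi C e)])"

definition period_lattice :: "('v, 'e) metric_graph \<Rightarrow> (('e \<times> bool \<Rightarrow> real) \<Rightarrow> real) set" where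
  "period_lattice C = cycle_integral C ` H1 C"

definition mod_periods ::
    "('v, 'e) metric_graph \<Rightarrow> ((('e \<times> bool \<Rightarrow> real) \<Rightarrow> real) \<times> (('e \<times> bool \<Rightarrow> real) \<Rightarrow> real)) set" where
  "mod_periods C = {(F, G). F \<in> dual_forms C \<and> G \<in> dual_forms C \<and>
     (\<lambda>\<omega>\<in>one_forms C. F \<omega> - G \<omega>) \<in> period_lattice C}"

definition Jac :: "('v, 'e) metric_graph \<Rightarrow> (('e \<times> bool \<Rightarrow> real) \<Rightarrow> real) set set" where
  "Jac C = dual_forms C // mod_periods C"

definition abel_jacobi ::
    "('v, 'e) metric_graph \<Rightarrow> ('v, 'e) point \<Rightarrow> ('v, 'e) divisor
     \<Rightarrow> (('e \<times> bool \<Rightarrow> real) \<Rightarrow> real) set" where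
  "abel_jacobi C p0 D = mod_periods C `` {\<lambda>\<omega>\<in>one_forms C.
     \<Sum>p\<in>Poly_Mapping.keys D. of_int (Poly_Mapping.lookup D p) * path_integral \<omega> (SOME \<gamma>. is_path C p0 \<gamma> p)}"

end

theory Submission
  imports Defs
begin

text \<open>
  Two divisors of the same degree define the same line bundle iff their difference \<open>E\<close> is the divisor of
  a rational function: the cocycles of linearly equivalent divisors literally agree, and a coboundary
  between two divisor cocycles glues the local equations to a global function.

  Let \<open>n\<close> be the integral chain of minus the slopes of a rational function at the heads of the edges. The
  orders at the vertices prescribe the boundary of \<open>n\<close>, and the increments of the function along the
  edges, which are determined by \<open>n\<close> and \<open>E\<close>, must form a coboundary, i.e. be orthogonal to all 1-forms.
  But these are exactly the conditions under which the paths defining the Abel--Jacobi images of the two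
  divisors can be corrected by an integral cycle so that the images coincide. Surjectivity follows since
  a functional on 1-forms extends to a linear combination of edge coordinates, and each multiple of an
  edge coordinate is an integral multiple of the integral from the tail to a point of that edge.
\<close>

section \<open>Germs, slopes and continuity\<close>

text \<open>Interior points of edges obstruct a purely combinatorial comparison, so both sides are
  reduced to the same vertex data: such a point is moved to the tail of its edge
  (\<open>base\<close>), and the missing segment is kept as a real correction
  (\<open>offset\<close>). The formula for piecewise linear functions follows the same convention:
  its hinges vanish towards the head, so the free slope is the one at the head and all bends are
  felt at the tail. This is why one chain satisfies literally the same two conditions on the
  analytic side and on the Abel-Jacobi side. Points at infinity are the second obstacle. Rational
  functions have orders there but no prescribed values, while sections in a cocycle are continuous
  there; the cover carrying a divisor cocycle is therefore built so that each vertex lies in exactly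
  one member. On leaves 1-forms vanish, so arithmetic with infinite lengths never contributes.
  Finally, gluing over an arbitrary cover yields a function that is piecewise linear only locally;
  finiteness of its pieces has to be recovered from compactness of the edges.\<close>

lemma filtercomap_filtermap_inj:
  assumes "inj f"
  shows "filtercomap f (filtermap f F) = F"
  unfolding filter_eq_iff eventually_filtercomap eventually_filtermap
proof (intro allI iffI)
  fix P
  assume "\<exists>Q. (\<forall>\<^sub>F x in F. Q (f x)) \<and> (\<forall>x. Q (f x) \<longrightarrow> P x)"
  then show "eventually P F"
    by (auto elim: eventually_mono)
next
  fix P
  assume "eventually P F"
  then show "\<exists>Q. (\<forall>\<^sub>F x in F. Q (f x)) \<and> (\<forall>x. Q (f x) \<longrightarrow> P x)"
    using assms by (intro exI[of _ "\<lambda>y. P (inv f y)"]) simp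
qed

text \<open>Germs at vertices pull filters on \<open>ereal\<close> back to real coordinates. Here
  they become ordinary real filters, an infinite end giving \<open>at_bot\<close> or
  \<open>at_top\<close>.\<close>

lemma filtercomap_ereal_at:
  "filtercomap ereal (at_right (ereal r)) = at_right r"
  "filtercomap ereal (at_left (ereal r)) = at_left r"
  "filtercomap ereal (at_right (-\<infinity>)) = at_bot"
  "filtercomap ereal (at_left \<infinity>) = at_top"
  by (simp_all only: at_right_ereal at_left_ereal at_right_MInf at_left_PInf
      filtercomap_filtermap_inj[OF inj_ereal])

locale compact_tropical_curve =
  fixes C :: "('v, 'e) metric_graph"
  assumes tropical: "tropical_curve C"
begin

lemma fin_digraph_skel: "fin_digraph (skel C)"
  using tropical by (simp add: tropical_curve_def)

lemma finite_edges: "finite (edges C)"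
  and finite_verts: "finite (verts (skel C))"
  and tail_in_verts: "e \<in> edges C \<Longrightarrow> tail (skel C) e \<in> verts (skel C)"
  and head_in_verts: "e \<in> edges C \<Longrightarrow> head (skel C) e \<in> verts (skel C)"
  using fin_digraph_skel
  by (auto simp: fin_digraph_def fin_digraph_axioms_def wf_digraph_def)

lemma edges_nonempty: "edges C \<noteq> {}"
  using tropical by (simp add: tropical_curve_def)

lemma lo_less_hi: "e \<in> edges C \<Longrightarrow> lo C e < hi C e"
  using tropical by (simp add: tropical_curve_def)

lemma lo_MInf_iff: "e \<in> edges C \<Longrightarrow> lo C e = -\<infinity> \<longleftrightarrow> valence C (tail (skel C) e) = 1"
  and hi_PInf_iff: "e \<in> edges C \<Longrightarrow> hi C e = \<infinity> \<longleftrightarrow> valence C (head (skel C) e) = 1"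
  using tropical by (auto simp: tropical_curve_def)

lemma lo_neq_PInf: "e \<in> edges C \<Longrightarrow> lo C e \<noteq> \<infinity>"
  and hi_neq_MInf: "e \<in> edges C \<Longrightarrow> hi C e \<noteq> -\<infinity>"
  using lo_less_hi[of e] by auto

lemma EdgePt_in_points: "EdgePt e x \<in> points C \<longleftrightarrow> e \<in> edges C \<and> lo C e < ereal x \<and> ereal x < hi C e"
  by (auto simp: points_def)

lemma Vertex_in_points: "Vertex v \<in> points C \<longleftrightarrow> v \<in> verts (skel C)"
  by (auto simp: points_def)

lemma EdgePt_in_finite_points: "EdgePt e x \<in> finite_points C \<longleftrightarrow> EdgePt e x \<in> points C"
  by (auto simp: finite_points_def)

lemma tangents_edges: "p \<in> points C \<Longrightarrow> \<xi> \<in> tangents C p \<Longrightarrow> fst \<xi> \<in> edges C"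
  by (cases p) (auto simp: EdgePt_in_points in_arcs_def out_arcs_def)

lemma germ_cases:
  assumes "p \<in> points C" "\<xi> \<in> tangents C p"
  obtains r where "germ C p \<xi> = at_right r" | r where "germ C p \<xi> = at_left r"
  | "germ C p \<xi> = at_top" | "germ C p \<xi> = at_bot"
proof -
  obtain e b where \<xi>: "\<xi> = (e, b)" by (cases \<xi>)
  have e: "e \<in> edges C" using tangents_edges[OF assms] \<xi> by simp
  show ?thesis
  proof (cases p)
    case (Vertex v)
    show ?thesis
    proof (cases b)
      case True
      then show ?thesis
        using that lo_neq_PInf[OF e] \<xi> Vertex
        by (cases "lo C e") (auto simp: filtercomap_ereal_at)
    next
      case False
      then show ?thesis
        using that hi_neq_MInf[OF e] \<xi> Vertex
        by (cases "hi C e") (auto simp: filtercomap_ereal_at)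
    qed
  next
    case (EdgePt e' x)
    then show ?thesis using that \<xi> by (cases b) auto
  qed
qed

lemma germ_neq_bot:
  assumes "p \<in> points C" "\<xi> \<in> tangents C p"
  shows "germ C p \<xi> \<noteq> bot"
  by (rule germ_cases[OF assms]) auto

lemma germ_neq_point:
  assumes "p \<in> points C" "\<xi> \<in> tangents C p"
  shows "\<forall>\<^sub>F x in germ C p \<xi>. x \<noteq> t"
  by (rule germ_cases[OF assms])
    (auto intro: eventually_neq_at_within eventually_mono[OF eventually_gt_at_top[of t]]
      eventually_mono[OF eventually_gt_at_bot[of t]])

text \<open>Linearity in \<open>rational_on\<close> is asserted on intervals, so a property holding
  along a germ has to be turned into one on an interval that belongs to the germ.\<close>

lemma germ_interval:
  assumes "p \<in> points C" "\<xi> \<in> tangents C p" "eventually P (germ C p \<xi>)"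
  obtains I where "is_interval I" "\<And>x. x \<in> I \<Longrightarrow> P x" "\<forall>\<^sub>F x in germ C p \<xi>. x \<in> I"
proof (rule germ_cases[OF assms(1,2)])
  fix r assume g: "germ C p \<xi> = at_right r"
  then obtain b where "r < b" "\<And>y. r < y \<Longrightarrow> y < b \<Longrightarrow> P y"
    using assms(3) by (auto simp: eventually_at_right[of r "r + 1"])
  then show ?thesis
    using that[of "{r<..<b}"] eventually_at_right_real[of r b] g by (auto simp: is_interval_oo)
next
  fix r assume g: "germ C p \<xi> = at_left r"
  then obtain b where "b < r" "\<And>y. b < y \<Longrightarrow> y < r \<Longrightarrow> P y"
    using assms(3) by (auto simp: eventually_at_left[of "r - 1" r])
  then show ?thesis
    using that[of "{b<..<r}"] eventually_at_left_real[of b r] g by (auto simp: is_interval_oo)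
next
  assume g: "germ C p \<xi> = at_top"
  then obtain b where "\<And>y. b < y \<Longrightarrow> P y"
    using assms(3) by (auto simp: eventually_at_top_dense)
  then show ?thesis
    using that[of "{b<..}"] eventually_gt_at_top[of b] g by (auto simp: is_interval_oi)
next
  assume g: "germ C p \<xi> = at_bot"
  then obtain b where "\<And>y. y < b \<Longrightarrow> P y"
    using assms(3) by (auto simp: eventually_at_bot_dense)
  then show ?thesis
    using that[of "{..<b}"] eventually_gt_at_bot[of b] g by (auto simp: is_interval_io)
qed

text \<open>\<open>slope\<close> is a definite description and says nothing unless a slope exists.
  This relation carries the existence; \<open>slope_eqI\<close> leads back to
  \<open>slope\<close>.\<close>

definition has_slope :: "(('v, 'e) point \<Rightarrow> real) \<Rightarrow> ('v, 'e) point \<Rightarrow> 'e \<times> bool \<Rightarrow> int \<Rightarrow> bool" where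
  "has_slope f p \<xi> m \<longleftrightarrow> (\<exists>c. \<forall>\<^sub>F x in germ C p \<xi>.
     f (EdgePt (fst \<xi>) x) = (if snd \<xi> then of_int m else - of_int m) * x + c)"

lemma has_slope_unique:
  assumes "p \<in> points C" "\<xi> \<in> tangents C p" "has_slope f p \<xi> m" "has_slope f p \<xi> n"
  shows "m = n"
proof -
  define s :: "int \<Rightarrow> real" where "s k = (if snd \<xi> then of_int k else - of_int k)" for k
  obtain c d where
    "\<forall>\<^sub>F x in germ C p \<xi>. f (EdgePt (fst \<xi>) x) = s m * x + c"
    "\<forall>\<^sub>F x in germ C p \<xi>. f (EdgePt (fst \<xi>) x) = s n * x + d"
    using assms(3,4) by (auto simp: has_slope_def s_def)
  then have ev: "\<forall>\<^sub>F x in germ C p \<xi>. s m * x + c = s n * x + d"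
    by eventually_elim simp
  then obtain x where x: "s m * x + c = s n * x + d"
    using eventually_happens'[OF germ_neq_bot[OF assms(1,2)]] by blast
  \<comment> \<open>A germ eventually avoids any given coordinate, so there is a second point of
    agreement, and two points determine the slope.\<close>
  obtain y where y: "s m * y + c = s n * y + d" "y \<noteq> x"
    using eventually_happens'[OF germ_neq_bot[OF assms(1,2)]
        eventually_conj[OF ev germ_neq_point[OF assms(1,2), of x]]] by blast
  have "(s m - s n) * (y - x) = 0" using x y by (simp add: algebra_simps)
  then have "s m = s n" using y(2) by simp
  then show ?thesis by (auto simp: s_def split: if_splits)
qed

lemma slope_eqI:
  assumes "p \<in> points C" "\<xi> \<in> tangents C p" "has_slope f p \<xi> m"
  shows "slope C f p \<xi> = m"
  unfolding slope_def
  by (rule the_equality) (use assms has_slope_unique in \<open>auto simp: has_slope_def\<close>)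

lemma has_slope_cong:
  assumes "\<forall>\<^sub>F x in germ C p \<xi>. f (EdgePt (fst \<xi>) x) = g (EdgePt (fst \<xi>) x)" "has_slope g p \<xi> m"
  shows "has_slope f p \<xi> m"
proof -
  obtain c where "\<forall>\<^sub>F x in germ C p \<xi>.
      g (EdgePt (fst \<xi>) x) = (if snd \<xi> then of_int m else - of_int m) * x + c"
    using assms(2) by (auto simp: has_slope_def)
  with assms(1) have "\<forall>\<^sub>F x in germ C p \<xi>.
      f (EdgePt (fst \<xi>) x) = (if snd \<xi> then of_int m else - of_int m) * x + c"
    by eventually_elim simp
  then show ?thesis by (auto simp: has_slope_def)
qed

lemma has_slope_diff:
  assumes "has_slope f p \<xi> m" "has_slope g p \<xi> n"
  shows "has_slope (\<lambda>q. f q - g q) p \<xi> (m - n)"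
proof -
  obtain c d where
    "\<forall>\<^sub>F x in germ C p \<xi>. f (EdgePt (fst \<xi>) x) = (if snd \<xi> then of_int m else - of_int m) * x + c"
    "\<forall>\<^sub>F x in germ C p \<xi>. g (EdgePt (fst \<xi>) x) = (if snd \<xi> then of_int n else - of_int n) * x + d"
    using assms by (auto simp: has_slope_def)
  then have "\<forall>\<^sub>F x in germ C p \<xi>. f (EdgePt (fst \<xi>) x) - g (EdgePt (fst \<xi>) x)
      = (if snd \<xi> then of_int (m - n) else - of_int (m - n)) * x + (c - d)"
    by eventually_elim (simp add: algebra_simps)
  then show ?thesis by (auto simp: has_slope_def)
qed

section \<open>Open sets and continuity in terms of germs\<close>

lemma open_in_curve_Int:
  "open_in_curve C U \<Longrightarrow> open_in_curve C V \<Longrightarrow> open_in_curve C (U \<inter> V)"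
  using openin_Int[of "curve_top C" U V] by (simp add: openin_curve_top)

lemma open_in_curveD:
  assumes "open_in_curve C U" "p \<in> U" "\<xi> \<in> tangents C p"
  shows "\<forall>\<^sub>F x in germ C p \<xi>. EdgePt (fst \<xi>) x \<in> U"
  using assms by (auto simp: open_in_curve_def)

lemma open_in_curve_subset: "open_in_curve C U \<Longrightarrow> U \<subseteq> points C"
  by (simp add: open_in_curve_def)

lemma germ_in_edge:
  assumes "p \<in> points C" "\<xi> \<in> tangents C p"
  shows "\<forall>\<^sub>F x in germ C p \<xi>. EdgePt (fst \<xi>) x \<in> points C"
proof -
  obtain e b where \<xi>: "\<xi> = (e, b)" by (cases \<xi>)
  have e: "e \<in> edges C" using tangents_edges[OF assms] \<xi> by simp
  show ?thesis
  proof (cases p)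
    case (Vertex v)
    show ?thesis
    proof (cases b)
      case True
      have "\<forall>\<^sub>F y in at_right (lo C e). lo C e < y \<and> y < hi C e"
        using lo_less_hi[OF e] by (auto simp: eventually_at_right)
      then show ?thesis
        using e True \<xi> Vertex by (auto simp: EdgePt_in_points eventually_filtercomap)
    next
      case False
      have "\<forall>\<^sub>F y in at_left (hi C e). lo C e < y \<and> y < hi C e"
        using lo_less_hi[OF e] by (auto simp: eventually_at_left)
      then show ?thesis
        using e False \<xi> Vertex by (auto simp: EdgePt_in_points eventually_filtercomap)
    qed
  next
    case (EdgePt e' x)
    then have x: "lo C e < ereal x" "ereal x < hi C e" "e' = e"
      using assms \<xi> by (auto simp: EdgePt_in_points)
    have "\<forall>\<^sub>F y in nhds (ereal x). lo C e < y \<and> y < hi C e"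
      using x eventually_nhds_in_open[of "{lo C e<..<hi C e}" "ereal x"] by simp
    then have "\<forall>\<^sub>F y in nhds x. lo C e < ereal y \<and> ereal y < hi C e"
      by (simp add: nhds_ereal eventually_filtermap)
    then have "eventually (\<lambda>y. lo C e < ereal y \<and> ereal y < hi C e) (at_left x)"
      "eventually (\<lambda>y. lo C e < ereal y \<and> ereal y < hi C e) (at_right x)"
      by (auto simp: eventually_at_filter elim: eventually_mono)
    then show ?thesis
      using e \<xi> EdgePt by (cases b) (auto simp: EdgePt_in_points)
  qed
qed

lemma open_points: "open_in_curve C (points C)"
  using germ_in_edge by (auto simp: open_in_curve_def)

text \<open>Germs consist of interior points of edges, and these are never at infinity.\<close>

lemma open_finite_points: "open_in_curve C (finite_points C)"
  using germ_in_edge by (auto simp: open_in_curve_def finite_points_def)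

text \<open>The topology is itself defined by germs, so continuity can be tested one direction at a
  time. Openness of \<open>S\<close> makes the open sets of the subspace open in the whole
  curve.\<close>

lemma continuous_map_iff_germs:
  assumes "open_in_curve C S"
  shows "continuous_map (subtopology (curve_top C) S) euclideanreal f \<longleftrightarrow>
    (\<forall>p\<in>S. \<forall>\<xi>\<in>tangents C p. ((\<lambda>x. f (EdgePt (fst \<xi>) x)) \<longlongrightarrow> f p) (germ C p \<xi>))"
    (is "?L \<longleftrightarrow> ?R")
proof -
  have top: "openin (subtopology (curve_top C) S) U \<longleftrightarrow> U \<subseteq> S \<and> open_in_curve C U" for U
    using assms by (simp add: openin_open_subtopology openin_curve_top conj_commute)
  have space: "topspace (subtopology (curve_top C) S) = S"
    using assms top[of S] openin_subset[of "subtopology (curve_top C) S" S] by auto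
  have "{p \<in> S. f p \<in> T} \<subseteq> S" for T by auto
  then have L: "?L \<longleftrightarrow> (\<forall>T. open T \<longrightarrow> open_in_curve C {p \<in> S. f p \<in> T})"
    unfolding continuous_map_def space top by simp
  show ?thesis
  proof
    assume ?L
    show ?R
    proof (intro ballI topological_tendstoI)
      fix p \<xi> T assume "p \<in> S" "\<xi> \<in> tangents C p" "open T" "f p \<in> T"
      then have "\<forall>\<^sub>F x in germ C p \<xi>. EdgePt (fst \<xi>) x \<in> {p \<in> S. f p \<in> T}"
        using \<open>?L\<close> L by (intro open_in_curveD) auto
      then show "\<forall>\<^sub>F x in germ C p \<xi>. f (EdgePt (fst \<xi>) x) \<in> T"
        by eventually_elim simp
    qed
  next
    assume R: ?R
    show ?L unfolding L
    proof (intro allI impI)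
      fix T :: "real set" assume "open T"
      show "open_in_curve C {p \<in> S. f p \<in> T}"
        unfolding open_in_curve_def
      proof (intro conjI ballI)
        show "{p \<in> S. f p \<in> T} \<subseteq> points C"
          using assms by (auto simp: open_in_curve_def)
        fix p \<xi> assume p: "p \<in> {p \<in> S. f p \<in> T}" "\<xi> \<in> tangents C p"
        have "\<forall>\<^sub>F x in germ C p \<xi>. f (EdgePt (fst \<xi>) x) \<in> T"
          using R p \<open>open T\<close> by (intro topological_tendstoD) auto
        moreover have "\<forall>\<^sub>F x in germ C p \<xi>. EdgePt (fst \<xi>) x \<in> S"
          using open_in_curveD[OF assms] p by auto
        ultimately show "\<forall>\<^sub>F x in germ C p \<xi>. EdgePt (fst \<xi>) x \<in> {p \<in> S. f p \<in> T}"
          by eventually_elim simp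
      qed
    qed
  qed
qed

lemma int_linear_on_diff:
  assumes "int_linear_on I f" "int_linear_on I g"
  shows "int_linear_on I (\<lambda>x. f x - g x)"
proof -
  obtain m n :: int and c d where
    "\<forall>x\<in>I. f x = of_int m * x + c" "\<forall>x\<in>I. g x = of_int n * x + d"
    using assms by (auto simp: int_linear_on_def)
  then show ?thesis
    unfolding int_linear_on_def
    by (intro exI[of _ "m - n"] exI[of _ "c - d"]) (simp add: algebra_simps)
qed

section \<open>Rational functions on open sets\<close>

lemma rational_on_breaks:
  assumes "rational_on C U f" "e \<in> edges C"
  obtains B where "finite B" "\<And>I. is_interval I \<Longrightarrow> I \<subseteq> edge_part C U e - B \<Longrightarrow>
      int_linear_on I (\<lambda>x. f (EdgePt e x))"
  using assms by (auto simp: rational_on_def)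

text \<open>A germ avoids the finitely many breaks and contains an interval, on which the function
  is affine; the sign turns the slope in the coordinate into the slope in the outward
  direction.\<close>

lemma rational_on_has_slope:
  assumes U: "open_in_curve C U" and f: "rational_on C U f" and p: "p \<in> U" "\<xi> \<in> tangents C p"
  shows "\<exists>m. has_slope f p \<xi> m"
proof -
  have pp: "p \<in> points C" using U p open_in_curve_subset by auto
  obtain B where B: "finite B" and
    lin: "\<And>I. is_interval I \<Longrightarrow> I \<subseteq> edge_part C U (fst \<xi>) - B \<Longrightarrow>
      int_linear_on I (\<lambda>x. f (EdgePt (fst \<xi>) x))"
    using rational_on_breaks[OF f tangents_edges[OF pp p(2)]] by blast
  have "\<forall>\<^sub>F x in germ C p \<xi>. \<forall>b\<in>B. x \<noteq> b"
    using B germ_neq_point[OF pp p(2)] by (simp add: eventually_ball_finite)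
  with open_in_curveD[OF U p] have ev: "\<forall>\<^sub>F x in germ C p \<xi>. x \<in> edge_part C U (fst \<xi>) - B"
    by eventually_elim (use open_in_curve_subset[OF U] in \<open>auto simp: edge_part_def\<close>)
  obtain I where I: "is_interval I" "\<And>x. x \<in> I \<Longrightarrow> x \<in> edge_part C U (fst \<xi>) - B"
    "\<forall>\<^sub>F x in germ C p \<xi>. x \<in> I"
    by (rule germ_interval[OF pp p(2) ev]) (rule that)
  then obtain m :: int and c where mc: "\<forall>x\<in>I. f (EdgePt (fst \<xi>) x) = of_int m * x + c"
    using lin[OF I(1) subsetI[OF I(2)]] by (auto simp: int_linear_on_def)
  show ?thesis
    unfolding has_slope_def
    by (intro exI[of _ "if snd \<xi> then m else - m"] exI[of _ c] eventually_mono[OF I(3)])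
      (use mc in auto)
qed

lemma has_slope_slope:
  assumes "open_in_curve C U" "rational_on C U f" "p \<in> U" "\<xi> \<in> tangents C p"
  shows "has_slope f p \<xi> (slope C f p \<xi>)"
  using rational_on_has_slope[OF assms] slope_eqI assms open_in_curve_subset[OF assms(1)] by fastforce

lemma rational_on_tendsto:
  assumes "open_in_curve C U" "rational_on C U f" "p \<in> U \<inter> finite_points C" "\<xi> \<in> tangents C p"
  shows "((\<lambda>x. f (EdgePt (fst \<xi>) x)) \<longlongrightarrow> f p) (germ C p \<xi>)"
  using assms continuous_map_iff_germs[OF open_in_curve_Int[OF assms(1) open_finite_points]]
  by (auto simp: rational_on_def)

lemma rational_on_subset:
  assumes "rational_on C U f" "V \<subseteq> U"
  shows "rational_on C V f"
  unfolding rational_on_def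
proof (intro conjI ballI)
  show "continuous_map (subtopology (curve_top C) (V \<inter> finite_points C)) euclideanreal f"
    using assms by (auto simp: rational_on_def intro: continuous_map_from_subtopology_mono)
  fix e assume e: "e \<in> edges C"
  obtain B where B: "finite B"
    "\<And>I. is_interval I \<Longrightarrow> I \<subseteq> edge_part C U e - B \<Longrightarrow> int_linear_on I (\<lambda>x. f (EdgePt e x))"
    by (rule rational_on_breaks[OF assms(1) e]) (rule that)
  have "edge_part C V e \<subseteq> edge_part C U e"
    using assms(2) by (auto simp: edge_part_def)
  then show "\<exists>B. finite B \<and> (\<forall>I. is_interval I \<and> I \<subseteq> edge_part C V e - B \<longrightarrow>
      int_linear_on I (\<lambda>x. f (EdgePt e x)))"
    by (intro exI[of _ B] conjI allI impI B) auto
qed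

lemma rational_on_diff:
  assumes "rational_on C U f" "rational_on C U g"
  shows "rational_on C U (\<lambda>p. f p - g p)"
  unfolding rational_on_def
proof (intro conjI ballI)
  show "continuous_map (subtopology (curve_top C) (U \<inter> finite_points C)) euclideanreal (\<lambda>p. f p - g p)"
    using assms by (intro continuous_map_diff) (auto simp: rational_on_def)
  fix e assume e: "e \<in> edges C"
  obtain A where A: "finite A"
    "\<And>I. is_interval I \<Longrightarrow> I \<subseteq> edge_part C U e - A \<Longrightarrow> int_linear_on I (\<lambda>x. f (EdgePt e x))"
    by (rule rational_on_breaks[OF assms(1) e]) (rule that)
  obtain B where B: "finite B"
    "\<And>I. is_interval I \<Longrightarrow> I \<subseteq> edge_part C U e - B \<Longrightarrow> int_linear_on I (\<lambda>x. g (EdgePt e x))"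
    by (rule rational_on_breaks[OF assms(2) e]) (rule that)
  show "\<exists>B. finite B \<and> (\<forall>I. is_interval I \<and> I \<subseteq> edge_part C U e - B \<longrightarrow>
      int_linear_on I (\<lambda>x. f (EdgePt e x) - g (EdgePt e x)))"
  proof (intro exI conjI allI impI)
    show "finite (A \<union> B)" using A B by simp
    fix I assume "is_interval I \<and> I \<subseteq> edge_part C U e - (A \<union> B)"
    then show "int_linear_on I (\<lambda>x. f (EdgePt e x) - g (EdgePt e x))"
      by (intro int_linear_on_diff A B) auto
  qed
qed

lemma ord_at_diff:
  assumes "open_in_curve C U" "rational_on C U f" "rational_on C U g" "p \<in> U"
  shows "ord_at C (\<lambda>q. f q - g q) p = ord_at C f p - ord_at C g p"
  unfolding ord_at_def sum_subtractf[symmetric]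
  by (intro sum.cong refl slope_eqI has_slope_diff has_slope_slope[of U])
    (use assms open_in_curve_subset in auto)

lemma ord_at_eqI:
  assumes "p \<in> points C" "\<And>\<xi>. \<xi> \<in> tangents C p \<Longrightarrow> has_slope f p \<xi> (m \<xi>)"
  shows "ord_at C f p = (\<Sum>\<xi>\<in>tangents C p. m \<xi>)"
  unfolding ord_at_def by (intro sum.cong refl slope_eqI) (use assms in auto)

text \<open>An affine germ at a point determines its slope and constant term, and the same affine
  germ is found at all nearby points. So the pair \<open>M x\<close> is locally constant, hence
  constant on the connected set \<open>I\<close>.\<close>

lemma locally_int_linear_imp_int_linear_on:
  assumes "is_interval I"
    and "\<And>x. x \<in> I \<Longrightarrow> \<exists>(m::int) c. \<forall>\<^sub>F y in nhds x. h y = of_int m * y + c"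
  shows "int_linear_on I h"
proof (cases "I = {}")
  case False
  then obtain x0 where x0: "x0 \<in> I" by auto
  define M where "M x = (SOME mc :: int \<times> real. \<forall>\<^sub>F y in nhds x. h y = of_int (fst mc) * y + snd mc)" for x
  have M: "\<forall>\<^sub>F y in nhds x. h y = of_int (fst (M x)) * y + snd (M x)" if "x \<in> I" for x
    unfolding M_def by (rule someI_ex) (use assms(2)[OF that] in auto)
  have uniq: "mc = mc'" if "\<forall>\<^sub>F y in nhds x. h y = of_int (fst mc) * y + snd mc"
    "\<forall>\<^sub>F y in nhds x. h y = of_int (fst mc') * y + snd mc'" for x :: real and mc mc' :: "int \<times> real"
  proof -
    have ev: "\<forall>\<^sub>F y in nhds x. of_int (fst mc) * y + snd mc = of_int (fst mc') * y + snd mc'"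
      using that by eventually_elim simp
    then have x: "of_int (fst mc) * x + snd mc = of_int (fst mc') * x + snd mc'"
      by (rule eventually_nhds_x_imp_x)
    have "\<forall>\<^sub>F y in at x. of_int (fst mc) * y + snd mc = of_int (fst mc') * y + snd mc' \<and> y \<noteq> x"
      using ev by (auto simp: eventually_at_filter elim: eventually_mono)
    then obtain y where y: "of_int (fst mc) * y + snd mc = of_int (fst mc') * y + snd mc'" "y \<noteq> x"
      using eventually_happens'[of "at x"] by auto
    have "(of_int (fst mc) - of_int (fst mc')) * (y - x) = 0"
      using x y by (simp add: algebra_simps)
    with y x show ?thesis by (auto simp: prod_eq_iff)
  qed
  have const: "M x = M y" if "x \<in> I" "y \<in> I" for x y
  proof (rule connected_local_const[OF _ that])
    show "Topological_Spaces.connected I" using assms(1) by (simp add: is_interval_connected_1)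
    show "\<forall>a\<in>I. \<forall>\<^sub>F b in at a within I. M a = M b"
    proof
      fix a assume a: "a \<in> I"
      have "\<forall>\<^sub>F b in nhds a. \<forall>\<^sub>F y in nhds b. h y = of_int (fst (M a)) * y + snd (M a)"
        using M[OF a] by (simp add: eventually_eventually)
      then show "\<forall>\<^sub>F b in at a within I. M a = M b"
        unfolding eventually_at_filter
        by eventually_elim (use M uniq in blast)
    qed
  qed
  have "h x = of_int (fst (M x0)) * x + snd (M x0)" if "x \<in> I" for x
    using eventually_nhds_x_imp_x[OF M[OF that]] const[OF that x0] by simp
  then show ?thesis by (auto simp: int_linear_on_def)
qed (auto simp: int_linear_on_def)

text \<open>Where the outgoing slopes on an edge cancel, the two affine germs have the same slope, and
  continuity matches their constant terms.\<close>
lemma rational_on_int_linear_on: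
  assumes U: "open_in_curve C U" and f: "rational_on C U f"
    and I: "is_interval I" "I \<subseteq> edge_part C U e" and ord: "\<And>x. x \<in> I \<Longrightarrow> ord_at C f (EdgePt e x) = 0"
  shows "int_linear_on I (\<lambda>x. f (EdgePt e x))"
proof (rule locally_int_linear_imp_int_linear_on[OF I(1)])
  fix x assume x: "x \<in> I"
  then have p: "EdgePt e x \<in> U" "EdgePt e x \<in> points C"
    using I by (auto simp: edge_part_def)
  let ?h = "\<lambda>x. f (EdgePt e x)"
  define m where "m = slope C f (EdgePt e x) (e, True)"
  have "slope C f (EdgePt e x) (e, False) = - m"
    using ord[OF x] by (simp add: ord_at_def m_def)
  then have sl: "has_slope f (EdgePt e x) (e, True) m" "has_slope f (EdgePt e x) (e, False) (- m)"
    using has_slope_slope[OF U f p(1), of "(e, True)"] has_slope_slope[OF U f p(1), of "(e, False)"]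
    by (simp_all add: m_def)
  obtain c where c: "\<forall>\<^sub>F y in at_right x. ?h y = of_int m * y + c"
    using sl(1) by (auto simp: has_slope_def)
  obtain d where d: "\<forall>\<^sub>F y in at_left x. ?h y = of_int m * y + d"
    using sl(2) by (auto simp: has_slope_def)
  have lim: "(?h \<longlongrightarrow> ?h x) (at_right x)" "(?h \<longlongrightarrow> ?h x) (at_left x)"
    using rational_on_tendsto[OF U f, of "EdgePt e x" "(e, True)"]
      rational_on_tendsto[OF U f, of "EdgePt e x" "(e, False)"] p
    by (auto simp: EdgePt_in_finite_points)
  have "((\<lambda>y. of_int m * y + c) \<longlongrightarrow> ?h x) (at_right x)"
    using Lim_transform_eventually[OF lim(1) c] .
  moreover have "((\<lambda>y. of_int m * y + c) \<longlongrightarrow> of_int m * x + c) (at_right x)"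
    by (intro tendsto_intros)
  ultimately have hc: "?h x = of_int m * x + c"
    using tendsto_unique[OF trivial_limit_at_right_real] by blast
  have "((\<lambda>y. of_int m * y + d) \<longlongrightarrow> ?h x) (at_left x)"
    using Lim_transform_eventually[OF lim(2) d] .
  moreover have "((\<lambda>y. of_int m * y + d) \<longlongrightarrow> of_int m * x + d) (at_left x)"
    by (intro tendsto_intros)
  ultimately have hd: "?h x = of_int m * x + d"
    using tendsto_unique[OF trivial_limit_at_left_real] by blast
  have "\<forall>\<^sub>F y in nhds x. ?h y = of_int m * y + c"
    using c d hc hd by (simp add: eventually_nhds_conv_at eventually_at_split)
  then show "\<exists>(m::int) c. \<forall>\<^sub>F y in nhds x. ?h y = of_int m * y + c" by blast
qed

text \<open>\<open>rational_on\<close> controls continuity at finite points only, whereas a section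
  of the sheaf is continuous on all of \<open>U\<close>; this is why \<open>U\<close> must avoid
  infinity.\<close>

lemma rational_on_imp_unit_section:
  assumes U: "open_in_curve C U" "U \<subseteq> finite_points C" and f: "rational_on C U f"
    and ord: "\<And>p. p \<in> U \<Longrightarrow> ord_at C f p = 0"
  shows "unit_section C U f"
  unfolding unit_section_def
proof (intro conjI ballI allI impI)
  show "continuous_map (subtopology (curve_top C) U) euclideanreal f"
    using f U(2) by (simp add: rational_on_def Int_absorb2)
  fix e I assume "is_interval I \<and> I \<subseteq> edge_part C U e"
  then show "int_linear_on I (\<lambda>x. f (EdgePt e x))"
    by (intro rational_on_int_linear_on[OF U(1) f] ord) (auto simp: edge_part_def)
qed (use ord in auto)

lemma unit_section_imp_rational_on:
  assumes "unit_section C U f"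
  shows "rational_on C U f"
  using assms unfolding unit_section_def rational_on_def
  by (auto intro: continuous_map_from_subtopology_mono intro!: exI[of _ "{}"])

end

section \<open>Piecewise linear functions and local equations of a divisor\<close>

text \<open>The hinge at \<open>q\<close> contributes order \<open>w q\<close> at \<open>q\<close>
  and vanishes to the right of it. Hence \<open>k\<close> is the slope beyond all hinges, that is,
  at the head of the edge.\<close>

definition plfun :: "real set \<Rightarrow> (real \<Rightarrow> int) \<Rightarrow> real \<Rightarrow> int \<Rightarrow> real \<Rightarrow> real" where
  "plfun Q w a k x = a + of_int k * x + (\<Sum>q\<in>Q. of_int (w q) * max 0 (q - x))"

text \<open>\<open>R\<close> collects the hinges active at \<open>x\<close>. A hinge located exactly
  at \<open>x\<close> may be counted on either side, so the lemma serves both one-sided germs at a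
  break.\<close>

lemma plfun_affine:
  assumes "finite Q" "R \<subseteq> Q" "\<And>q. q \<in> R \<Longrightarrow> x \<le> q" "\<And>q. q \<in> Q - R \<Longrightarrow> q \<le> x"
  shows "plfun Q w a k x = of_int (k - sum w R) * x + (a + (\<Sum>q\<in>R. of_int (w q) * q))"
proof -
  have "(\<Sum>q\<in>Q. of_int (w q) * max 0 (q - x)) = (\<Sum>q\<in>R. of_int (w q) * max 0 (q - x))"
    using assms by (intro sum.mono_neutral_right) auto
  also have "\<dots> = (\<Sum>q\<in>R. of_int (w q) * q - of_int (w q) * x)"
    using assms by (intro sum.cong) (auto simp: algebra_simps)
  also have "\<dots> = (\<Sum>q\<in>R. of_int (w q) * q) - of_int (sum w R) * x"
    by (simp add: sum_subtractf sum_distrib_right)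
  finally show ?thesis by (simp add: plfun_def algebra_simps)
qed

lemma plfun_int_linear_on:
  assumes "finite Q" "is_interval I" "I \<inter> Q = {}"
  shows "int_linear_on I (plfun Q w a k)"
proof (cases "I = {}")
  case False
  then obtain x0 where x0: "x0 \<in> I" by auto
  define R where "R = {q \<in> Q. x0 < q}"
  have "plfun Q w a k x = of_int (k - sum w R) * x + (a + (\<Sum>q\<in>R. of_int (w q) * q))" if x: "x \<in> I" for x
  proof (rule plfun_affine[OF assms(1)])
    show "x \<le> q" if "q \<in> R" for q
    proof (rule ccontr)
      assume "\<not> x \<le> q"
      then have "q \<in> I" using mem_is_interval_1_I[OF assms(2) x0 x, of q] that by (simp add: R_def)
      then show False using assms(3) that by (auto simp: R_def)
    qed
    show "q \<le> x" if "q \<in> Q - R" for q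
    proof (rule ccontr)
      assume "\<not> q \<le> x"
      then have "q \<in> I" using mem_is_interval_1_I[OF assms(2) x x0, of q] that by (auto simp: R_def)
      then show False using assms(3) that by (auto simp: R_def)
    qed
  qed (auto simp: R_def)
  then show ?thesis unfolding int_linear_on_def by blast
qed (auto simp: int_linear_on_def)

lemma continuous_plfun: "continuous_on UNIV (plfun Q w a k)"
  unfolding plfun_def by (intro continuous_intros)

lemma plfun_tendsto: "(plfun Q w a k \<longlongrightarrow> plfun Q w a k x) (at x within S)"
  using continuous_plfun[of Q w a k]
  by (metis continuous_on_def iso_tuple_UNIV_I tendsto_within_subset subset_UNIV)

text \<open>Vertex values and edge formulas are independent data; that they fit together is a
  separate condition, imposed only where the curve is finite.\<close>

primrec pl_function :: "('v \<Rightarrow> real) \<Rightarrow> ('e \<Rightarrow> real set) \<Rightarrow> ('e \<Rightarrow> real \<Rightarrow> int) \<Rightarrow> ('e \<Rightarrow> real) \<Rightarrow>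
    ('e \<Rightarrow> int) \<Rightarrow> ('v, 'e) point \<Rightarrow> real" where
  "pl_function u Q w a k (Vertex v) = u v"
| "pl_function u Q w a k (EdgePt e x) = plfun (Q e) (w e) (a e) (k e) x"

context compact_tropical_curve
begin

lemma has_slopeI:
  assumes "\<forall>\<^sub>F x in germ C p (e, b). f (EdgePt e x) = of_int (if b then m else - m) * x + c"
  shows "has_slope f p (e, b) m"
  using assms by (auto simp: has_slope_def split: if_splits)

lemma germ_EdgePt:
  assumes "eventually P (nhds x)" "\<xi> \<in> tangents C (EdgePt e x)"
  shows "eventually P (germ C (EdgePt e x) \<xi>)"
  using assms by (auto simp: eventually_at_filter elim: eventually_mono)

lemma germ_tail:
  assumes "lo C e < ereal a"
  shows "\<forall>\<^sub>F x in germ C (Vertex v) (e, True). x < a"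
proof -
  have "\<forall>\<^sub>F y in at_right (lo C e). y < ereal a"
    using assms by (auto simp: eventually_at_right)
  then show ?thesis by (auto simp: eventually_filtercomap)
qed

lemma germ_head:
  assumes "ereal a < hi C e"
  shows "\<forall>\<^sub>F x in germ C (Vertex v) (e, False). a < x"
proof -
  have "\<forall>\<^sub>F y in at_left (hi C e). ereal a < y"
    using assms by (auto simp: eventually_at_left)
  then show ?thesis by (auto simp: eventually_filtercomap)
qed

lemma germ_tail_finite: "lo C e = ereal r \<Longrightarrow> germ C (Vertex v) (e, True) = at_right r"
  and germ_head_finite: "hi C e = ereal r \<Longrightarrow> germ C (Vertex v) (e, False) = at_left r"
  by (simp_all add: filtercomap_ereal_at)

lemma finite_vertex_coord:
  assumes "Vertex v \<in> finite_points C" "\<xi> \<in> tangents C (Vertex v)"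
  obtains r where "snd \<xi> \<Longrightarrow> lo C (fst \<xi>) = ereal r" "\<not> snd \<xi> \<Longrightarrow> hi C (fst \<xi>) = ereal r"
proof -
  have val: "valence C v \<noteq> 1" using assms(1) by (auto simp: finite_points_def)
  show ?thesis
  proof (cases "snd \<xi>")
    case True
    then have e: "fst \<xi> \<in> edges C" "tail (skel C) (fst \<xi>) = v" using assms(2) by auto
    then obtain r where "lo C (fst \<xi>) = ereal r"
      using lo_neq_PInf lo_MInf_iff val by (cases "lo C (fst \<xi>)") auto
    with True show ?thesis using that by auto
  next
    case False
    then have e: "fst \<xi> \<in> edges C" "head (skel C) (fst \<xi>) = v" using assms(2) by auto
    then obtain r where "hi C (fst \<xi>) = ereal r"
      using hi_neq_MInf hi_PInf_iff val by (cases "hi C (fst \<xi>)") auto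
    with False show ?thesis using that by auto
  qed
qed

lemma sum_tangents_Vertex:
  "(\<Sum>\<xi>\<in>tangents C (Vertex v). g \<xi>) =
    (\<Sum>e\<in>out_arcs (skel C) v. g (e, True)) + (\<Sum>e\<in>in_arcs (skel C) v. g (e, False))"
proof -
  have fin: "finite (out_arcs (skel C) v)" "finite (in_arcs (skel C) v)"
    using finite_edges by (auto simp: out_arcs_def in_arcs_def)
  have "(\<Sum>\<xi>\<in>tangents C (Vertex v). g \<xi>) =
      sum g ((\<lambda>e. (e, True)) ` out_arcs (skel C) v) + sum g ((\<lambda>e. (e, False)) ` in_arcs (skel C) v)"
    using fin by (subst sum.union_disjoint[symmetric]) (auto intro!: sum.cong)
  then show ?thesis by (simp add: sum.reindex inj_on_def)
qed

lemma has_slope_pl_function: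
  assumes "finite (Q e)" "R \<subseteq> Q e"
    "\<forall>\<^sub>F x in germ C p (e, b). (\<forall>q\<in>R. x \<le> q) \<and> (\<forall>q\<in>Q e - R. q \<le> x)"
  shows "has_slope (pl_function u Q w a k) p (e, b)
    (if b then k e - sum (w e) R else sum (w e) R - k e)"
proof (rule has_slopeI)
  show "\<forall>\<^sub>F x in germ C p (e, b). pl_function u Q w a k (EdgePt e x) =
      of_int (if b then if b then k e - sum (w e) R else sum (w e) R - k e
        else - (if b then k e - sum (w e) R else sum (w e) R - k e)) * x
      + (a e + (\<Sum>q\<in>R. of_int (w e q) * q))"
    using assms(3)
  proof eventually_elim
    case (elim x)
    then show ?case using plfun_affine[OF assms(1,2), of x "w e" "a e" "k e"] by simp
  qed
qed

lemma ord_at_pl_function_EdgePt: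
  assumes "EdgePt e x \<in> points C" "finite (Q e)"
  shows "ord_at C (pl_function u Q w a k) (EdgePt e x) = (if x \<in> Q e then w e x else 0)"
proof -
  \<comment> \<open>Just to the right of \<open>x\<close> the hinge at \<open>x\<close> is already
    off, just to the left it is still on. The two active sets differ exactly by \<open>x\<close>,
    whose weight is the order.\<close>
  let ?p = "EdgePt e x" and ?R = "\<lambda>b. if b then {q \<in> Q e. x < q} else {q \<in> Q e. x \<le> q}"
  have T: "\<forall>\<^sub>F y in at_right x. \<forall>q\<in>{q \<in> Q e. x < q}. y \<le> q"
    using assms(2)
    by (intro eventually_ball_finite) (auto intro: eventually_mono[OF eventually_at_right_real])
  have F: "\<forall>\<^sub>F y in at_left x. \<forall>q\<in>{q \<in> Q e. q < x}. q \<le> y"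
    using assms(2)
    by (intro eventually_ball_finite) (auto intro: eventually_mono[OF eventually_at_left_real])
  have slope: "has_slope (pl_function u Q w a k) ?p (e, b)
      (if b then k e - sum (w e) (?R b) else sum (w e) (?R b) - k e)" for b
  proof (rule has_slope_pl_function)
    show "\<forall>\<^sub>F y in germ C ?p (e, b). (\<forall>q\<in>?R b. y \<le> q) \<and> (\<forall>q\<in>Q e - ?R b. q \<le> y)"
    proof (cases b)
      case True
      have "\<forall>\<^sub>F y in at_right x. (\<forall>q\<in>?R b. y \<le> q) \<and> (\<forall>q\<in>Q e - ?R b. q \<le> y)"
        using T eventually_at_right_less[of x] by eventually_elim (use True in auto)
      then show ?thesis using True by simp
    next
      case False
      have "\<forall>\<^sub>F y in at_left x. y < x" by (auto simp: eventually_at_filter)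
      with F have "\<forall>\<^sub>F y in at_left x. (\<forall>q\<in>?R b. y \<le> q) \<and> (\<forall>q\<in>Q e - ?R b. q \<le> y)"
        by eventually_elim (use False in auto)
      then show ?thesis using False by simp
    qed
  qed (use assms in auto)
  have sl: "slope C (pl_function u Q w a k) ?p (e, b) =
      (if b then k e - sum (w e) (?R b) else sum (w e) (?R b) - k e)" for b
    by (rule slope_eqI[OF assms(1) _ slope]) (cases b; simp)
  have "{q \<in> Q e. x \<le> q} = {q \<in> Q e. x < q} \<union> (if x \<in> Q e then {x} else {})"
    by (auto simp: order_less_le)
  then have "sum (w e) {q \<in> Q e. x \<le> q} = sum (w e) {q \<in> Q e. x < q} + (if x \<in> Q e then w e x else 0)"
    using assms(2) by (simp add: sum.union_disjoint)
  then show ?thesis by (simp add: ord_at_def sl)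
qed

text \<open>Near a tail all hinges of the edge are active, near a head none is; hence the asymmetry
  between outgoing and incoming arcs.\<close>

lemma ord_at_pl_function_Vertex:
  assumes v: "v \<in> verts (skel C)"
    and Q: "\<And>e. e \<in> edges C \<Longrightarrow> finite (Q e)"
      "\<And>e q. e \<in> edges C \<Longrightarrow> q \<in> Q e \<Longrightarrow> lo C e < ereal q \<and> ereal q < hi C e"
  shows "ord_at C (pl_function u Q w a k) (Vertex v) =
    (\<Sum>e\<in>out_arcs (skel C) v. k e - sum (w e) (Q e)) - (\<Sum>e\<in>in_arcs (skel C) v. k e)"
proof -
  let ?f = "pl_function u Q w a k" and ?p = "Vertex v"
  have p: "?p \<in> points C" using v by (simp add: Vertex_in_points)
  have "ord_at C ?f ?p = (\<Sum>\<xi>\<in>tangents C ?p.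
      if snd \<xi> then k (fst \<xi>) - sum (w (fst \<xi>)) (Q (fst \<xi>)) else - k (fst \<xi>))"
  proof (rule ord_at_eqI[OF p])
    fix \<xi> assume \<xi>: "\<xi> \<in> tangents C ?p"
    obtain e b where eb: "\<xi> = (e, b)" by (cases \<xi>)
    then have e: "e \<in> edges C" using tangents_edges[OF p \<xi>] by simp
    show "has_slope ?f ?p \<xi> (if snd \<xi> then k (fst \<xi>) - sum (w (fst \<xi>)) (Q (fst \<xi>)) else - k (fst \<xi>))"
    proof (cases b)
      case True
      have "\<forall>\<^sub>F x in germ C ?p (e, True). \<forall>q\<in>Q e. x < q"
        using Q[OF e] by (intro eventually_ball_finite ballI germ_tail) auto
      then have "\<forall>\<^sub>F x in germ C ?p (e, True). (\<forall>q\<in>Q e. x \<le> q) \<and> (\<forall>q\<in>Q e - Q e. q \<le> x)"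
        by eventually_elim (auto intro: less_imp_le)
      from has_slope_pl_function[where Q = Q and R = "Q e", OF Q(1)[OF e] subset_refl this] show ?thesis
        using True eb by simp
    next
      case False
      have "\<forall>\<^sub>F x in germ C ?p (e, False). \<forall>q\<in>Q e. q < x"
        using Q[OF e] by (intro eventually_ball_finite ballI germ_head) auto
      then have "\<forall>\<^sub>F x in germ C ?p (e, False). (\<forall>q\<in>{}. x \<le> q) \<and> (\<forall>q\<in>Q e - {}. q \<le> x)"
        by eventually_elim (auto intro: less_imp_le)
      from has_slope_pl_function[where Q = Q and R = "{}", OF Q(1)[OF e] empty_subsetI this] show ?thesis
        using False eb by simp
    qed
  qed
  then show ?thesis unfolding sum_tangents_Vertex by (simp add: sum_negf)
qed

text \<open>Inside edges continuity is automatic, so only the limits at finite vertices of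
  \<open>U\<close> are to be checked. For \<open>U\<close> inside a single edge there are none,
  which is how local equations on open edges arise.\<close>

lemma rational_on_pl_function:
  assumes U: "open_in_curve C U" and Q: "\<And>e. e \<in> edges C \<Longrightarrow> finite (Q e)"
    and lim: "\<And>v e b. Vertex v \<in> U \<inter> finite_points C \<Longrightarrow> (e, b) \<in> tangents C (Vertex v) \<Longrightarrow>
      (plfun (Q e) (w e) (a e) (k e) \<longlongrightarrow> u v) (germ C (Vertex v) (e, b))"
  shows "rational_on C U (pl_function u Q w a k)"
  unfolding rational_on_def
proof (intro conjI ballI)
  let ?f = "pl_function u Q w a k"
  show "continuous_map (subtopology (curve_top C) (U \<inter> finite_points C)) euclideanreal ?f"
    unfolding continuous_map_iff_germs[OF open_in_curve_Int[OF U open_finite_points]]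
  proof (intro ballI)
    fix p \<xi> assume p: "p \<in> U \<inter> finite_points C" "\<xi> \<in> tangents C p"
    obtain e b where \<xi>: "\<xi> = (e, b)" by (cases \<xi>)
    show "((\<lambda>x. ?f (EdgePt (fst \<xi>) x)) \<longlongrightarrow> ?f p) (germ C p \<xi>)"
    proof (cases p)
      case (Vertex v)
      then show ?thesis using lim[of v e b] p \<xi> by simp
    next
      case (EdgePt e' x)
      then show ?thesis using p \<xi> by (auto intro: plfun_tendsto)
    qed
  qed
  fix e assume e: "e \<in> edges C"
  show "\<exists>B. finite B \<and> (\<forall>I. is_interval I \<and> I \<subseteq> edge_part C U e - B \<longrightarrow>
      int_linear_on I (\<lambda>x. ?f (EdgePt e x)))"
    using Q[OF e] by (intro exI[of _ "Q e"]) (auto intro!: plfun_int_linear_on)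
qed

text \<open>A local equation at a vertex: the value there is 0 and the outward slopes are prescribed
  at both ends of every edge. At the cut \<open>A e\<close> the two halves need not match; the open
  sets on which the function is used leave the cut out.\<close>

definition star_function :: "('e \<Rightarrow> real) \<Rightarrow> ('e \<times> bool \<Rightarrow> int) \<Rightarrow> ('v, 'e) point \<Rightarrow> real" where
  "star_function A s p = (case p of Vertex v \<Rightarrow> 0
    | EdgePt e x \<Rightarrow> if x < A e then of_int (s (e, True)) * (x - real_of_ereal (lo C e))
        else of_int (s (e, False)) * (real_of_ereal (hi C e) - x))"

text \<open>With \<open>A e \<le> B e\<close>, cutting out the middle segment of each edge keeps the
  two halves of a loop at \<open>v\<close> apart, and all points of a divisor inside edges can be
  placed in the removed segments.\<close>

definition star :: "('e \<Rightarrow> real) \<Rightarrow> ('e \<Rightarrow> real) \<Rightarrow> 'v \<Rightarrow> ('v, 'e) point set" where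
  "star A B v = insert (Vertex v)
    {EdgePt e x | e x. EdgePt e x \<in> points C \<and>
      (tail (skel C) e = v \<and> x < A e \<or> head (skel C) e = v \<and> B e < x)}"

lemma open_star:
  assumes "v \<in> verts (skel C)" "\<And>e. e \<in> edges C \<Longrightarrow> lo C e < ereal (A e)"
    "\<And>e. e \<in> edges C \<Longrightarrow> ereal (B e) < hi C e"
  shows "open_in_curve C (star A B v)"
  unfolding open_in_curve_def
proof (intro conjI ballI)
  show "star A B v \<subseteq> points C" using assms(1) by (auto simp: star_def Vertex_in_points)
  fix p \<xi> assume p: "p \<in> star A B v" "\<xi> \<in> tangents C p"
  then have pp: "p \<in> points C" using \<open>star A B v \<subseteq> points C\<close> by auto
  note edge = germ_in_edge[OF pp p(2)]
  obtain e b where \<xi>: "\<xi> = (e, b)" by (cases \<xi>)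
  show "\<forall>\<^sub>F x in germ C p \<xi>. EdgePt (fst \<xi>) x \<in> star A B v"
  proof (cases p)
    case (Vertex v')
    then have v': "v' = v" using p(1) by (auto simp: star_def)
    have e: "e \<in> edges C" using tangents_edges[OF pp p(2)] \<xi> by simp
    show ?thesis
    proof (cases b)
      case True
      have "\<forall>\<^sub>F x in germ C p \<xi>. x < A e"
        using germ_tail[OF assms(2)[OF e]] True \<xi> Vertex by simp
      with edge show ?thesis
        by eventually_elim (use True \<xi> Vertex v' p in \<open>auto simp: star_def\<close>)
    next
      case False
      have "\<forall>\<^sub>F x in germ C p \<xi>. B e < x"
        using germ_head[OF assms(3)[OF e]] False \<xi> Vertex by simp
      with edge show ?thesis
        by eventually_elim (use False \<xi> Vertex v' p in \<open>auto simp: star_def\<close>)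
    qed
  next
    case (EdgePt e' x)
    then have e': "e' = e" using p(2) \<xi> by auto
    have "tail (skel C) e = v \<and> x < A e \<or> head (skel C) e = v \<and> B e < x"
      using p(1) EdgePt e' by (auto simp: star_def)
    then have "\<forall>\<^sub>F y in nhds x. tail (skel C) e = v \<and> y < A e \<or> head (skel C) e = v \<and> B e < y"
      using eventually_nhds_in_open[of "{..<A e}" x] eventually_nhds_in_open[of "{B e<..}" x]
      by (auto elim: eventually_mono)
    then have "\<forall>\<^sub>F y in germ C p \<xi>. tail (skel C) e = v \<and> y < A e \<or> head (skel C) e = v \<and> B e < y"
      using germ_EdgePt p(2) EdgePt by blast
    with edge show ?thesis
      by eventually_elim (use \<xi> in \<open>auto simp: star_def\<close>)
  qed
qed

lemma has_slope_star_function_tail: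
  assumes "lo C e < ereal (A e)"
  shows "has_slope (star_function A s) (Vertex v) (e, True) (s (e, True))"
  by (rule has_slopeI[where c = "- of_int (s (e, True)) * real_of_ereal (lo C e)"],
      rule eventually_mono[OF germ_tail[OF assms]])
    (simp add: star_function_def algebra_simps)

lemma has_slope_star_function_head:
  assumes "ereal (A e) < hi C e"
  shows "has_slope (star_function A s) (Vertex v) (e, False) (s (e, False))"
  by (rule has_slopeI[where c = "of_int (s (e, False)) * real_of_ereal (hi C e)"],
      rule eventually_mono[OF germ_head[OF assms]])
    (simp add: star_function_def algebra_simps)

lemma ord_at_star_function_Vertex:
  assumes "v \<in> verts (skel C)" "\<And>e. e \<in> edges C \<Longrightarrow> lo C e < ereal (A e) \<and> ereal (A e) < hi C e"
  shows "ord_at C (star_function A s) (Vertex v) = (\<Sum>\<xi>\<in>tangents C (Vertex v). s \<xi>)"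
proof (rule ord_at_eqI)
  show p: "Vertex v \<in> points C" using assms by (simp add: Vertex_in_points)
  fix \<xi> assume \<xi>: "\<xi> \<in> tangents C (Vertex v)"
  have e: "fst \<xi> \<in> edges C" using tangents_edges[OF p \<xi>] .
  show "has_slope (star_function A s) (Vertex v) \<xi> (s \<xi>)"
    using has_slope_star_function_tail[of "fst \<xi>" A] has_slope_star_function_head[of A "fst \<xi>"] assms(2)[OF e]
    by (cases \<xi>; cases "snd \<xi>") auto
qed

lemma ord_at_star_function_EdgePt:
  assumes "EdgePt e x \<in> points C" "x \<noteq> A e"
  shows "ord_at C (star_function A s) (EdgePt e x) = 0"
proof -
  define m where "m = (if x < A e then s (e, True) else - s (e, False))"
  define c where "c = (if x < A e then - of_int (s (e, True)) * real_of_ereal (lo C e)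
      else of_int (s (e, False)) * real_of_ereal (hi C e))"
  have "\<forall>\<^sub>F y in nhds x. star_function A s (EdgePt e y) = of_int m * y + c"
  proof (cases "x < A e")
    case True
    then have "\<forall>\<^sub>F y in nhds x. y < A e" using eventually_nhds_in_open[of "{..<A e}" x] by simp
    then show ?thesis
      by eventually_elim (use True in \<open>simp add: star_function_def m_def c_def algebra_simps\<close>)
  next
    case False
    then have "\<forall>\<^sub>F y in nhds x. A e < y" using eventually_nhds_in_open[of "{A e<..}" x] assms by simp
    then show ?thesis
      by eventually_elim (use False in \<open>simp add: star_function_def m_def c_def algebra_simps\<close>)
  qed
  then have ev: "\<forall>\<^sub>F y in germ C (EdgePt e x) (e, b). star_function A s (EdgePt e y) = of_int m * y + c" for b
    by (rule germ_EdgePt) (cases b; simp)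
  have "has_slope (star_function A s) (EdgePt e x) (e, True) m"
    "has_slope (star_function A s) (EdgePt e x) (e, False) (- m)"
    using ev[of True] ev[of False] by (auto intro!: has_slopeI[where c = c] simp del: germ.simps)
  then show ?thesis
    using slope_eqI[OF assms(1)] by (simp add: ord_at_def)
qed

lemma rational_on_star_function:
  assumes U: "open_in_curve C U" "\<And>e. EdgePt e (A e) \<notin> U"
    and A: "\<And>e. e \<in> edges C \<Longrightarrow> lo C e < ereal (A e) \<and> ereal (A e) < hi C e"
  shows "rational_on C U (star_function A s)"
  unfolding rational_on_def
proof (intro conjI ballI)
  let ?f = "star_function A s"
  show "continuous_map (subtopology (curve_top C) (U \<inter> finite_points C)) euclideanreal ?f"
    unfolding continuous_map_iff_germs[OF open_in_curve_Int[OF U(1) open_finite_points]]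
  proof (intro ballI)
    fix p \<xi> assume p: "p \<in> U \<inter> finite_points C" "\<xi> \<in> tangents C p"
    then have pp: "p \<in> points C" by (auto simp: finite_points_def)
    obtain e b where \<xi>: "\<xi> = (e, b)" by (cases \<xi>)
    then have e: "e \<in> edges C" using tangents_edges[OF pp p(2)] by simp
    show "((\<lambda>x. ?f (EdgePt (fst \<xi>) x)) \<longlongrightarrow> ?f p) (germ C p \<xi>)"
    proof (cases p)
      case (Vertex v)
      obtain r where r: "b \<Longrightarrow> lo C e = ereal r" "\<not> b \<Longrightarrow> hi C e = ereal r"
        by (rule finite_vertex_coord[of v \<xi>]) (use p Vertex \<xi> in auto)
      show ?thesis
      proof (cases b)
        case True
        have "\<forall>\<^sub>F x in germ C p \<xi>. x < A e"
          using germ_tail[of e "A e" v] A[OF e] True \<xi> Vertex by simp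
        then have "\<forall>\<^sub>F x in germ C p \<xi>. of_int (s (e, True)) * (x - r) = ?f (EdgePt (fst \<xi>) x)"
          by eventually_elim (use True \<xi> r in \<open>simp add: star_function_def\<close>)
        moreover have "((\<lambda>x. of_int (s (e, True)) * (x - r)) \<longlongrightarrow> of_int (s (e, True)) * (r - r)) (at_right r)"
          by (intro tendsto_intros)
        ultimately show ?thesis
          using True \<xi> Vertex r germ_tail_finite[OF r(1), of v]
          by (auto simp: star_function_def intro: Lim_transform_eventually)
      next
        case False
        have "\<forall>\<^sub>F x in germ C p \<xi>. A e < x"
          using germ_head[of "A e" e v] A[OF e] False \<xi> Vertex by simp
        then have "\<forall>\<^sub>F x in germ C p \<xi>. of_int (s (e, False)) * (r - x) = ?f (EdgePt (fst \<xi>) x)"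
          by eventually_elim (use False \<xi> r in \<open>simp add: star_function_def\<close>)
        moreover have "((\<lambda>x. of_int (s (e, False)) * (r - x)) \<longlongrightarrow> of_int (s (e, False)) * (r - r)) (at_left r)"
          by (intro tendsto_intros)
        ultimately show ?thesis
          using False \<xi> Vertex r germ_head_finite[OF r(2), of v]
          by (auto simp: star_function_def intro: Lim_transform_eventually)
      qed
    next
      case (EdgePt e' x)
      then have e': "e' = e" using p \<xi> by auto
      then have ne: "x \<noteq> A e" using U(2) EdgePt p by auto
      have "continuous (at x) (\<lambda>x. ?f (EdgePt e x))"
      proof (cases "x < A e")
        case True
        then have "\<forall>\<^sub>F y in nhds x. y < A e" using eventually_nhds_in_open[of "{..<A e}" x] by simp
        then have "\<forall>\<^sub>F y in nhds x. ?f (EdgePt e y) = of_int (s (e, True)) * (y - real_of_ereal (lo C e))"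
          by eventually_elim (simp add: star_function_def)
        then show ?thesis by (subst isCont_cong) (auto intro: continuous_intros)
      next
        case False
        then have "\<forall>\<^sub>F y in nhds x. A e < y" using eventually_nhds_in_open[of "{A e<..}" x] ne by simp
        then have "\<forall>\<^sub>F y in nhds x. ?f (EdgePt e y) = of_int (s (e, False)) * (real_of_ereal (hi C e) - y)"
          by eventually_elim (simp add: star_function_def)
        then show ?thesis by (subst isCont_cong) (auto intro: continuous_intros)
      qed
      then have "((\<lambda>x. ?f (EdgePt e x)) \<longlongrightarrow> ?f p) (at x)"
        using EdgePt e' by (simp add: continuous_at)
      then show ?thesis
        using EdgePt e' \<xi> by (cases b) (auto intro: tendsto_within_subset)
    qed
  qed
  fix e assume e: "e \<in> edges C"
  show "\<exists>B. finite B \<and> (\<forall>I. is_interval I \<and> I \<subseteq> edge_part C U e - B \<longrightarrow>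
      int_linear_on I (\<lambda>x. ?f (EdgePt e x)))"
  proof (intro exI[of _ "{A e}"] conjI allI impI)
    fix I assume I: "is_interval I \<and> I \<subseteq> edge_part C U e - {A e}"
    then have "A e \<notin> I" by auto
    then consider "\<forall>x\<in>I. x < A e" | "\<forall>x\<in>I. A e < x"
      using I mem_is_interval_1_I[of I _ _ "A e"] by (metis linorder_cases less_imp_le)
    then show "int_linear_on I (\<lambda>x. ?f (EdgePt e x))"
    proof cases
      case 1
      then show ?thesis unfolding int_linear_on_def
        by (intro exI[of _ "s (e, True)"] exI[of _ "- of_int (s (e, True)) * real_of_ereal (lo C e)"])
          (auto simp: star_function_def algebra_simps)
    next
      case 2
      then show ?thesis unfolding int_linear_on_def
        by (intro exI[of _ "- s (e, False)"] exI[of _ "of_int (s (e, False)) * real_of_ereal (hi C e)"])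
          (force simp: star_function_def algebra_simps)
    qed
  qed simp
qed

section \<open>Paths\<close>

lemma at_coord_lo [simp]: "at_coord C e (lo C e) = Vertex (tail (skel C) e)"
  by (simp add: at_coord_def)

lemma at_coord_hi [simp]: "e \<in> edges C \<Longrightarrow> at_coord C e (hi C e) = Vertex (head (skel C) e)"
  using lo_less_hi[of e] by (auto simp: at_coord_def)

lemma is_path_append:
  "is_path C p \<gamma> q \<Longrightarrow> is_path C q \<delta> r \<Longrightarrow> is_path C p (\<gamma> @ \<delta>) r"
  by (induction C p \<gamma> q rule: is_path.induct) auto

lemma is_path_along_edge:
  assumes "e \<in> edges C"
  shows "is_path C (Vertex (tail (skel C) e)) [(e, lo C e, hi C e)] (Vertex (head (skel C) e))"
    "is_path C (Vertex (head (skel C) e)) [(e, hi C e, lo C e)] (Vertex (tail (skel C) e))"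
  using assms lo_less_hi[OF assms] tail_in_verts[OF assms] head_in_verts[OF assms]
  by (auto simp: Vertex_in_points)

lemma is_path_within_edge:
  assumes "EdgePt e x \<in> points C"
  shows "is_path C (Vertex (tail (skel C) e)) [(e, lo C e, ereal x)] (EdgePt e x)"
    "is_path C (EdgePt e x) [(e, ereal x, lo C e)] (Vertex (tail (skel C) e))"
  using assms tail_in_verts[of e] by (auto simp: Vertex_in_points EdgePt_in_points at_coord_def)

text \<open>Connectedness of the digraph is reachability in its symmetric closure, and a path on the
  curve may run along an arc in either direction.\<close>

lemma ex_path_vertices:
  assumes "v \<in> verts (skel C)" "w \<in> verts (skel C)"
  shows "\<exists>\<gamma>. is_path C (Vertex v) \<gamma> (Vertex w)"
proof -
  have "Digraph_Component.connected (skel C)"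
    using tropical by (simp add: tropical_curve_def)
  then have "v \<rightarrow>\<^sup>*\<^bsub>with_proj (mk_symmetric (skel C))\<^esub> w"
    using assms by (auto simp: Digraph_Component.connected_def strongly_connected_def)
  then have "(v, w) \<in> (parcs (mk_symmetric (skel C)))\<^sup>*"
    by (auto simp: reachable_def dest: rtrancl_on_rtranclI)
  then show ?thesis
  proof (induction rule: rtrancl_induct)
    case base
    then show ?case using assms by (intro exI[of _ "[]"]) (simp add: Vertex_in_points)
  next
    case (step y z)
    then obtain \<gamma> where \<gamma>: "is_path C (Vertex v) \<gamma> (Vertex y)" by auto
    from step(2) obtain e where "e \<in> edges C"
      "(y, z) = (tail (skel C) e, head (skel C) e) \<or> (y, z) = (head (skel C) e, tail (skel C) e)"
      by (auto simp: parcs_mk_symmetric)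
    then obtain \<delta> where "is_path C (Vertex y) \<delta> (Vertex z)"
      using is_path_along_edge[of e] by blast
    then show ?case using is_path_append[OF \<gamma>] by blast
  qed
qed

lemma ex_path:
  assumes "p \<in> points C" "q \<in> points C"
  shows "\<exists>\<gamma>. is_path C p \<gamma> q"
proof -
  have "\<exists>v\<in>verts (skel C). \<exists>\<gamma> \<delta>. is_path C p \<gamma> (Vertex v) \<and> is_path C (Vertex v) \<delta> p"
    if "p \<in> points C" for p
  proof (cases p)
    case (Vertex v)
    then have "is_path C p [] (Vertex v)" "is_path C (Vertex v) [] p" using that by simp_all
    with Vertex that show ?thesis using Vertex_in_points by blast
  next
    case (EdgePt e x)
    then show ?thesis
      using is_path_within_edge[of e x] tail_in_verts[of e] that by (metis EdgePt_in_points)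
  qed
  from this[OF assms(1)] this[OF assms(2)] show ?thesis
    using ex_path_vertices is_path_append by metis
qed

lemma ex_edge_point:
  assumes "e \<in> edges C"
  obtains x where "EdgePt e x \<in> points C"
  using ereal_dense2[OF lo_less_hi[OF assms]] assms that by (auto simp: EdgePt_in_points)

text \<open>A path from \<open>v\<close> into the interior of some edge must begin with a segment at
  \<open>v\<close>, so no vertex is isolated. The order of a divisor at \<open>v\<close> can
  therefore be realised by a slope in some direction.\<close>

lemma tangents_Vertex_nonempty:
  assumes "v \<in> verts (skel C)"
  shows "tangents C (Vertex v) \<noteq> {}"
proof -
  obtain e where "e \<in> edges C" using edges_nonempty by auto
  then obtain x where "EdgePt e x \<in> points C" by (rule ex_edge_point)
  then obtain \<gamma> where "is_path C (Vertex v) \<gamma> (EdgePt e x)"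
    using ex_path assms by (metis Vertex_in_points)
  then obtain e' s where "e' \<in> edges C" "Vertex v = at_coord C e' s"
    by (cases \<gamma>) auto
  then have "(e', True) \<in> tangents C (Vertex v) \<or> (e', False) \<in> tangents C (Vertex v)"
    by (auto simp: at_coord_def split: if_splits)
  then show ?thesis by blast
qed


section \<open>Divisors and their line bundles\<close>

lemma finite_edge_support: "finite {x. EdgePt e x \<in> Poly_Mapping.keys D}"
  using finite_vimageI[OF finite_keys[of D], of "EdgePt e"] by (simp add: inj_on_def vimage_def)

lemma edge_cut:
  assumes "e \<in> edges C" "finite S" "\<And>q. q \<in> S \<Longrightarrow> EdgePt e q \<in> points C"
  shows "\<exists>a b. EdgePt e a \<in> points C \<and> EdgePt e b \<in> points C \<and> a \<le> b \<and> S \<subseteq> {a..b}"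
proof -
  obtain x where x: "EdgePt e x \<in> points C" using ex_edge_point[OF assms(1)] .
  \<comment> \<open>The extra point keeps minimum and maximum meaningful when \<open>S\<close> is
    empty.\<close>
  let ?S = "insert x S"
  have fin: "finite ?S" "?S \<noteq> {}" using assms by auto
  have "\<And>q. q \<in> ?S \<Longrightarrow> EdgePt e q \<in> points C" using assms x by auto
  then have "EdgePt e (Min ?S) \<in> points C" "EdgePt e (Max ?S) \<in> points C"
    using Min_in[OF fin] Max_in[OF fin] by blast+
  moreover have "Min ?S \<le> Max ?S" "S \<subseteq> {Min ?S..Max ?S}"
    using fin by (auto intro: Min_le Max_ge order_trans[OF Min_le[of ?S x] Max_ge[of ?S x]])
  ultimately show ?thesis by blast
qed

lemma unit_section_zero: "U \<subseteq> points C \<Longrightarrow> unit_section C U (\<lambda>p. 0)"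
proof -
  assume U: "U \<subseteq> points C"
  have "int_linear_on I (\<lambda>x. 0)" for I
    unfolding int_linear_on_def by (intro exI[of _ 0] exI[of _ 0]) simp
  moreover have "has_slope (\<lambda>p. 0) p \<xi> 0" for p \<xi>
    unfolding has_slope_def by (rule exI[of _ 0]) simp
  then have "ord_at C (\<lambda>p. 0) p = 0" if "p \<in> U" for p
    using ord_at_eqI[of p "\<lambda>p. 0" "\<lambda>_. 0"] that U by auto
  ultimately show ?thesis by (simp add: unit_section_def)
qed

text \<open>The cover consists of open stars of the vertices and open edges. Distinct members
  overlap only inside edges, so no continuous extension to infinity ever has to be constructed.
  Stars avoid the points of \<open>D\<close> inside edges; these are handled by hinges on the open
  edges.\<close>

lemma ex_divisor_cocycle:
  assumes D: "Poly_Mapping.keys D \<subseteq> points C"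
  shows "\<exists>c. divisor_cocycle C D c"
proof -
  define Q where "Q e = {x. EdgePt e x \<in> Poly_Mapping.keys D}" for e
  have finQ: "finite (Q e)" for e unfolding Q_def by (rule finite_edge_support)
  have "\<forall>e\<in>edges C. \<exists>a b. EdgePt e a \<in> points C \<and> EdgePt e b \<in> points C \<and> a \<le> b \<and> Q e \<subseteq> {a..b}"
    using edge_cut[OF _ finQ] D by (force simp: Q_def)
  then obtain A where A: "\<forall>e\<in>edges C. \<exists>b. EdgePt e (A e) \<in> points C \<and> EdgePt e b \<in> points C
      \<and> A e \<le> b \<and> Q e \<subseteq> {A e..b}"
    unfolding bchoice_iff by blast
  then obtain B where "\<forall>e\<in>edges C. EdgePt e (A e) \<in> points C \<and> EdgePt e (B e) \<in> points C
      \<and> A e \<le> B e \<and> Q e \<subseteq> {A e..B e}"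
    unfolding bchoice_iff by blast
  then have AB: "\<And>e. e \<in> edges C \<Longrightarrow> EdgePt e (A e) \<in> points C"
    "\<And>e. e \<in> edges C \<Longrightarrow> EdgePt e (B e) \<in> points C"
    "\<And>e. e \<in> edges C \<Longrightarrow> A e \<le> B e" "\<And>e. e \<in> edges C \<Longrightarrow> Q e \<subseteq> {A e..B e}"
    by auto
  define t where "t v = (SOME \<xi>. \<xi> \<in> tangents C (Vertex v))" for v
  have t: "t v \<in> tangents C (Vertex v)" if "v \<in> verts (skel C)" for v
    unfolding t_def using tangents_Vertex_nonempty[OF that] by (rule some_in_eq[THEN iffD2])
  \<comment> \<open>Only the sum of the outward slopes at the vertex matters, so the whole order is
    put on one chosen direction.\<close>
  define s where "s v \<xi> = (if \<xi> = t v then Poly_Mapping.lookup D (Vertex v) else 0)" for v \<xi>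
  define fE :: "('v, 'e) point \<Rightarrow> real" where "fE = pl_function (\<lambda>_. 0) Q (\<lambda>e x. Poly_Mapping.lookup D (EdgePt e x)) (\<lambda>_. 0) (\<lambda>_. 0)"
  \<comment> \<open>Cochains are indexed by the open sets themselves, so the local equation has to
    be recovered from the set: a star contains exactly one vertex, an open edge contains
    none.\<close>
  define F :: "('v, 'e) point set \<Rightarrow> ('v, 'e) point \<Rightarrow> real" where "F U = (if \<exists>v. Vertex v \<in> U then star_function A (s (THE v. Vertex v \<in> U)) else fE)" for U
  define E :: "'e \<Rightarrow> ('v, 'e) point set" where "E e = {EdgePt e x | x. EdgePt e x \<in> points C}" for e
  define \<U> where "\<U> = star A B ` verts (skel C) \<union> E ` edges C"
  have "(THE v'. Vertex v' \<in> star A B v) = v" for v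
    by (rule the_equality) (auto simp: star_def)
  then have F_star: "F (star A B v) = star_function A (s v)" for v
    by (auto simp: F_def star_def)
  have F_E: "F (E e) = fE" for e
    by (auto simp: F_def E_def)
  have open_U: "open_in_curve C U" if "U \<in> \<U>" for U
    using that unfolding \<U>_def
  proof
    assume "U \<in> star A B ` verts (skel C)"
    then show ?thesis using AB by (auto simp: EdgePt_in_points intro!: open_star)
  next
    assume "U \<in> E ` edges C"
    then show ?thesis using germ_in_edge by (fastforce simp: open_in_curve_def E_def)
  qed
  have cover: "open_cover C \<U>"
    unfolding open_cover_def
  proof
    show "\<forall>U\<in>\<U>. openin (curve_top C) U" using open_U by (simp add: openin_curve_top)
    have "p \<in> \<Union>\<U>" if "p \<in> points C" for p
    proof (cases p)
      case (Vertex v)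
      then show ?thesis using that by (auto simp: \<U>_def star_def Vertex_in_points)
    next
      case (EdgePt e x)
      then have "p \<in> E e" "e \<in> edges C" using that by (auto simp: E_def EdgePt_in_points)
      then show ?thesis by (auto simp: \<U>_def)
    qed
    then show "\<Union>\<U> = points C" using open_U open_in_curve_subset by blast
  qed
  have rat: "rational_on C U (F U)" if "U \<in> \<U>" for U
    using that unfolding \<U>_def
  proof
    assume "U \<in> star A B ` verts (skel C)"
    then obtain v where v: "v \<in> verts (skel C)" "U = star A B v" by auto
    have "EdgePt e (A e) \<notin> star A B v" for e
      using AB(3)[of e] by (auto simp: star_def EdgePt_in_points)
    then show ?thesis
      using open_U[OF that] AB(1) v
      by (auto simp: F_star EdgePt_in_points intro!: rational_on_star_function)
  next
    assume "U \<in> E ` edges C"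
    then obtain e where e: "e \<in> edges C" "U = E e" by auto
    then show ?thesis
      unfolding e(2) F_E fE_def using open_U[OF that, unfolded e(2)] finQ
      by (intro rational_on_pl_function) (auto simp: E_def)
  qed
  have ord: "ord_at C (F U) p = Poly_Mapping.lookup D p" if U: "U \<in> \<U>" and p: "p \<in> U" for U p
    using U unfolding \<U>_def
  proof
    assume "U \<in> star A B ` verts (skel C)"
    then obtain v where v: "v \<in> verts (skel C)" "U = star A B v" by auto
    show ?thesis
    proof (cases p)
      case (Vertex v')
      then have v': "v' = v" using p v by (auto simp: star_def)
      have fin: "finite (tangents C (Vertex v))"
        using finite_edges by (auto simp: out_arcs_def in_arcs_def)
      have "ord_at C (F U) p = (\<Sum>\<xi>\<in>tangents C (Vertex v). s v \<xi>)"
        unfolding v(2) F_star Vertex v'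
        using AB(1) by (intro ord_at_star_function_Vertex v(1)) (auto simp: EdgePt_in_points)
      also have "\<dots> = Poly_Mapping.lookup D p"
        using t[OF v(1)] fin unfolding s_def Vertex v' by (subst sum.delta[OF fin]) simp
      finally show ?thesis .
    next
      case (EdgePt e x)
      then have x: "EdgePt e x \<in> points C" "x < A e \<or> B e < x"
        using p v by (auto simp: star_def)
      have e: "e \<in> edges C" using x by (simp add: EdgePt_in_points)
      have "x \<noteq> A e" "x \<notin> Q e" using x AB(3,4)[OF e] by auto
      then show ?thesis
        using ord_at_star_function_EdgePt[OF x(1), of A "s v"] v EdgePt
        by (simp add: F_star Q_def in_keys_iff)
    qed
  next
    assume "U \<in> E ` edges C"
    then obtain e where e: "e \<in> edges C" "U = E e" by auto
    then obtain x where x: "p = EdgePt e x" "EdgePt e x \<in> points C" using p by (auto simp: E_def)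
    show ?thesis
      unfolding e(2) F_E fE_def x(1) ord_at_pl_function_EdgePt[of _ _ Q, OF x(2) finQ]
      by (simp add: Q_def in_keys_iff)
  qed
  define g :: "('v, 'e) point set \<Rightarrow> _" where "g U V p = F U p - F V p" for U V p
  \<comment> \<open>A vertex lies in its own star and in no other member, so a common point of two
    different members is interior to an edge.\<close>
  have inter: "U \<inter> V \<subseteq> finite_points C" if "U \<in> \<U>" "V \<in> \<U>" "U \<noteq> V" for U V
  proof
    fix p assume p: "p \<in> U \<inter> V"
    show "p \<in> finite_points C"
    proof (cases p)
      case (Vertex v)
      then have "U = star A B v" "V = star A B v"
        using p that(1,2) by (auto simp: \<U>_def E_def star_def)
      with that(3) show ?thesis by simp
    next
      case (EdgePt e x)
      then show ?thesis
        using p open_in_curve_subset[OF open_U[OF that(1)]] by (auto simp: EdgePt_in_finite_points)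
    qed
  qed
  have unit: "unit_section C (U \<inter> V) (g U V)" if UV: "U \<in> \<U>" "V \<in> \<U>" for U V
  proof (cases "U = V")
    \<comment> \<open>A star may contain a point at infinity, where rationality gives no continuity;
      on the diagonal the difference is identically 0.\<close>
    case True
    then show ?thesis
      using unit_section_zero[OF open_in_curve_subset[OF open_U[OF UV(1)]]] by (simp add: g_def[abs_def])
  next
    case False
    have o: "open_in_curve C (U \<inter> V)" using open_U UV by (intro open_in_curve_Int)
    have r: "rational_on C (U \<inter> V) (F U)" "rational_on C (U \<inter> V) (F V)"
      using rat[OF UV(1)] rat[OF UV(2)] by (auto intro: rational_on_subset)
    show ?thesis unfolding g_def[abs_def]
    proof (rule rational_on_imp_unit_section[OF o inter[OF UV False] rational_on_diff[OF r]])
      fix p assume p: "p \<in> U \<inter> V"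
      then show "ord_at C (\<lambda>q. F U q - F V q) p = 0"
        using ord_at_diff[OF o r p] ord UV by simp
    qed
  qed
  have "(\<U>, g) \<in> cocycles C"
    using cover unit by (auto simp: cocycles_def g_def)
  then have "divisor_cocycle C D (\<U>, g)"
    unfolding divisor_cocycle_def using rat ord by (auto simp: g_def intro!: exI[of _ F])
  then show ?thesis by blast
qed

lemma divisor_cocycleE:
  assumes "divisor_cocycle C D (\<U>, g)"
  obtains f where "(\<U>, g) \<in> cocycles C" "\<And>U. U \<in> \<U> \<Longrightarrow> rational_on C U (f U)"
    "\<And>U p. U \<in> \<U> \<Longrightarrow> p \<in> U \<Longrightarrow> ord_at C (f U) p = Poly_Mapping.lookup D p"
    "\<And>U V p. U \<in> \<U> \<Longrightarrow> V \<in> \<U> \<Longrightarrow> p \<in> U \<inter> V \<inter> finite_points C \<Longrightarrow> g U V p = f U p - f V p"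
proof -
  have co: "(\<U>, g) \<in> cocycles C" and "\<exists>f. (\<forall>U\<in>\<U>. rational_on C U (f U)
      \<and> (\<forall>p\<in>U. ord_at C (f U) p = Poly_Mapping.lookup D p))
      \<and> (\<forall>U\<in>\<U>. \<forall>V\<in>\<U>. \<forall>p\<in>U \<inter> V \<inter> finite_points C. g U V p = f U p - f V p)"
    using assms unfolding divisor_cocycle_def prod.case by simp_all
  then obtain f where f: "\<forall>U\<in>\<U>. rational_on C U (f U)
      \<and> (\<forall>p\<in>U. ord_at C (f U) p = Poly_Mapping.lookup D p)"
    "\<forall>U\<in>\<U>. \<forall>V\<in>\<U>. \<forall>p\<in>U \<inter> V \<inter> finite_points C. g U V p = f U p - f V p"
    by (elim exE conjE)
  show ?thesis by (rule that[of f]) (use co f in auto)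
qed

text \<open>Subtracting the global function \<open>F\<close> from every local equation changes the
  divisor by that of \<open>F\<close> and leaves all differences of local equations
  unchanged.\<close>

lemma divisor_cocycle_linear_equivalent:
  assumes F: "rational_on C (points C) F"
    "\<And>p. p \<in> points C \<Longrightarrow> ord_at C F p = Poly_Mapping.lookup D p - Poly_Mapping.lookup D' p"
    and c: "divisor_cocycle C D c"
  shows "divisor_cocycle C D' c"
proof -
  obtain \<U> g where Ug: "c = (\<U>, g)" by (cases c)
  obtain f where co: "(\<U>, g) \<in> cocycles C" and
    f: "\<And>U. U \<in> \<U> \<Longrightarrow> rational_on C U (f U)"
    "\<And>U p. U \<in> \<U> \<Longrightarrow> p \<in> U \<Longrightarrow> ord_at C (f U) p = Poly_Mapping.lookup D p"
    "\<And>U V p. U \<in> \<U> \<Longrightarrow> V \<in> \<U> \<Longrightarrow> p \<in> U \<inter> V \<inter> finite_points C \<Longrightarrow> g U V p = f U p - f V p"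
    by (rule divisor_cocycleE[OF c[unfolded Ug]]) (rule that)
  have "rational_on C U (\<lambda>p. f U p - F p)
      \<and> (\<forall>p\<in>U. ord_at C (\<lambda>p. f U p - F p) p = Poly_Mapping.lookup D' p)" if U: "U \<in> \<U>" for U
  proof -
    have o: "open_in_curve C U"
      using co U by (auto simp: cocycles_def open_cover_def openin_curve_top)
    note sub = open_in_curve_subset[OF o]
    have r: "rational_on C U F" using F(1) sub by (rule rational_on_subset)
    show ?thesis
      using rational_on_diff[OF f(1)[OF U] r] ord_at_diff[OF o f(1)[OF U] r] f(2)[OF U] F(2) sub by auto
  qed
  then show ?thesis
    using co f(3) unfolding divisor_cocycle_def Ug
    by (auto intro!: exI[of _ "\<lambda>U p. f U p - F p"])
qed

text \<open>\<open>line_bundle\<close> depends on a choice of cocycle. Using \<open>F\<close> and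
  its negative, the predicates \<open>divisor_cocycle C D\<close> and
  \<open>divisor_cocycle C D'\<close> are equal, so the two choices coincide.\<close>

lemma line_bundle_linear_equivalent:
  assumes F: "rational_on C (points C) F"
    "\<And>p. p \<in> points C \<Longrightarrow> ord_at C F p = Poly_Mapping.lookup D p - Poly_Mapping.lookup D' p"
  shows "line_bundle C D = line_bundle C D'"
proof -
  have z: "rational_on C (points C) (\<lambda>p. 0 :: real)"
    by (intro unit_section_imp_rational_on unit_section_zero order_refl)
  have F': "rational_on C (points C) (\<lambda>p. 0 - F p)" by (rule rational_on_diff[OF z F(1)])
  have "ord_at C (\<lambda>p. 0 - F p) p = Poly_Mapping.lookup D' p - Poly_Mapping.lookup D p" if p: "p \<in> points C" for p
    using ord_at_diff[OF open_points z F(1) p] F(2)[OF p] unit_section_zero[OF order_refl] p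
    by (simp add: unit_section_def)
  then have "divisor_cocycle C D = divisor_cocycle C D'"
    using divisor_cocycle_linear_equivalent[OF F] divisor_cocycle_linear_equivalent[OF F'] by blast
  then show ?thesis by (simp add: line_bundle_def)
qed

end

section \<open>Finiteness of breaks and gluing of local equations\<close>

lemma eventually_nhds_ereal:
  assumes "open S" "ereal x \<in> S"
  shows "\<forall>\<^sub>F y in nhds x. ereal y \<in> S"
  using eventually_nhds_in_open[OF assms] by (simp add: nhds_ereal eventually_filtermap)

text \<open>An affine one-sided germ makes the function locally affine at every nearby point on that
  side. The base point lives in \<open>ereal\<close>, so that an infinite end of an edge is covered
  as well.\<close>

lemma affine_germ_at_right:
  assumes "\<forall>\<^sub>F x in filtercomap ereal (at_right z). h x = of_int (m::int) * x + c" "z < \<infinity>"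
  shows "\<exists>b>z. \<forall>x. z < ereal x \<and> ereal x < b \<longrightarrow> (\<exists>(m::int) c. \<forall>\<^sub>F y in nhds x. h y = of_int m * y + c)"
proof -
  obtain P where P: "eventually P (at_right z)" "\<And>x. P (ereal x) \<Longrightarrow> h x = of_int m * x + c"
    using assms(1) by (auto simp: eventually_filtercomap)
  obtain b where b: "z < b" "\<And>y. z < y \<Longrightarrow> y < b \<Longrightarrow> P y"
    using P(1) assms(2) by (auto simp: eventually_at_right)
  have "\<forall>\<^sub>F y in nhds x. h y = of_int m * y + c" if "z < ereal x" "ereal x < b" for x
    using eventually_nhds_ereal[of "{z<..<b}" x] that b(2) P(2) by (auto elim!: eventually_mono)
  with b(1) show ?thesis by blast
qed

lemma affine_germ_at_left:
  assumes "\<forall>\<^sub>F x in filtercomap ereal (at_left z). h x = of_int (m::int) * x + c" "- \<infinity> < z"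
  shows "\<exists>b<z. \<forall>x. b < ereal x \<and> ereal x < z \<longrightarrow> (\<exists>(m::int) c. \<forall>\<^sub>F y in nhds x. h y = of_int m * y + c)"
proof -
  obtain P where P: "eventually P (at_left z)" "\<And>x. P (ereal x) \<Longrightarrow> h x = of_int m * x + c"
    using assms(1) by (auto simp: eventually_filtercomap)
  obtain b where b: "b < z" "\<And>y. b < y \<Longrightarrow> y < z \<Longrightarrow> P y"
    using P(1) assms(2) by (auto simp: eventually_at_left)
  have "\<forall>\<^sub>F y in nhds x. h y = of_int m * y + c" if "b < ereal x" "ereal x < z" for x
    using eventually_nhds_ereal[of "{b<..<z}" x] that b(2) P(2) by (auto elim!: eventually_mono)
  with b(1) show ?thesis by blast
qed

context compact_tropical_curve
begin

lemma has_slope_affine: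
  assumes "has_slope f p (e, b) m"
  obtains n :: int and c where "\<forall>\<^sub>F x in germ C p (e, b). f (EdgePt e x) = of_int n * x + c"
proof -
  obtain c where "\<forall>\<^sub>F x in germ C p (e, b).
      f (EdgePt e x) = (if b then of_int m else - of_int m) * x + c"
    using assms by (auto simp: has_slope_def)
  then show ?thesis by (intro that[of "if b then m else - m" c]) (auto elim!: eventually_mono)
qed

text \<open>Only finitely many breaks are possible because the edge, with its ends at infinity, is compact.\<close>
lemma finite_breaks:
  assumes sl: "\<And>p \<xi>. p \<in> points C \<Longrightarrow> \<xi> \<in> tangents C p \<Longrightarrow> \<exists>m. has_slope f p \<xi> m"
    and e: "e \<in> edges C"
  shows "finite {x. EdgePt e x \<in> points C \<and>
    \<not> (\<exists>(m::int) c. \<forall>\<^sub>F y in nhds x. f (EdgePt e y) = of_int m * y + c)}" (is "finite ?B")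
proof (rule ccontr)
  let ?h = "\<lambda>x. f (EdgePt e x)"
  let ?good = "\<lambda>x. \<exists>(m::int) c. \<forall>\<^sub>F y in nhds x. ?h y = of_int m * y + c"
  assume "infinite ?B"
  then have "infinite (ereal ` ?B)"
    by (simp add: finite_image_iff inj_on_def)
  moreover have "compact {lo C e..hi C e}"
    by (simp add: compact_eq_closed)
  moreover have "ereal ` ?B \<subseteq> {lo C e..hi C e}"
    by (auto simp: EdgePt_in_points)
  ultimately obtain z where z: "z \<in> {lo C e..hi C e}" "z islimpt (ereal ` ?B)"
    using Heine_Borel_imp_Bolzano_Weierstrass by blast
  have right: "\<exists>b>z. \<forall>x. z < ereal x \<and> ereal x < b \<longrightarrow> ?good x" if "z < hi C e"
  proof -
    \<comment> \<open>Whether \<open>z\<close> is the tail end of the edge or an interior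
      coordinate, the germ at \<open>p\<close> is the right-hand filter at \<open>z\<close>.\<close>
    define p where "p = (if z = lo C e then Vertex (tail (skel C) e) else EdgePt e (real_of_ereal z))"
    have "\<bar>z\<bar> \<noteq> \<infinity>" if "z \<noteq> lo C e"
      using that z(1) \<open>z < hi C e\<close> by auto
    then have p: "p \<in> points C" "(e, True) \<in> tangents C p"
      "germ C p (e, True) = filtercomap ereal (at_right z)"
      using z(1) that e tail_in_verts[OF e]
      by (auto simp: p_def Vertex_in_points EdgePt_in_points ereal_real filtercomap_ereal_at(1)[symmetric]
          simp del: filtercomap_ereal_at)
    obtain m where "has_slope f p (e, True) m" using sl[OF p(1,2)] by auto
    then obtain n :: int and c where "\<forall>\<^sub>F x in filtercomap ereal (at_right z). ?h x = of_int n * x + c"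
      unfolding p(3)[symmetric] by (rule has_slope_affine)
    then show ?thesis using that by (intro affine_germ_at_right) (auto simp: less_top[symmetric])
  qed
  have left: "\<exists>b<z. \<forall>x. b < ereal x \<and> ereal x < z \<longrightarrow> ?good x" if "lo C e < z"
  proof -
    define p where "p = (if z = hi C e then Vertex (head (skel C) e) else EdgePt e (real_of_ereal z))"
    have "\<bar>z\<bar> \<noteq> \<infinity>" if "z \<noteq> hi C e"
      using that z(1) \<open>lo C e < z\<close> by auto
    then have p: "p \<in> points C" "(e, False) \<in> tangents C p"
      "germ C p (e, False) = filtercomap ereal (at_left z)"
      using z(1) that e head_in_verts[OF e]
      by (auto simp: p_def Vertex_in_points EdgePt_in_points ereal_real filtercomap_ereal_at(2)[symmetric]
          simp del: filtercomap_ereal_at)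
    obtain m where "has_slope f p (e, False) m" using sl[OF p(1,2)] by auto
    then obtain n :: int and c where "\<forall>\<^sub>F x in filtercomap ereal (at_left z). ?h x = of_int n * x + c"
      unfolding p(3)[symmetric] by (rule has_slope_affine)
    then show ?thesis using that by (intro affine_germ_at_left) (auto simp: order_le_less_trans)
  qed
  obtain b where b: "z < hi C e \<Longrightarrow> z < b" "\<And>x. z < hi C e \<Longrightarrow> z < ereal x \<Longrightarrow> ereal x < b \<Longrightarrow> ?good x"
    using right by blast
  obtain b' where b': "lo C e < z \<Longrightarrow> b' < z" "\<And>x. lo C e < z \<Longrightarrow> b' < ereal x \<Longrightarrow> ereal x < z \<Longrightarrow> ?good x"
    using left by blast
  \<comment> \<open>The one-sided statements combine to a neighbourhood of \<open>z\<close> whose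
    coordinates on the edge are good except possibly \<open>z\<close> itself, against
    \<open>z\<close> being a limit of bad ones.\<close>
  define T where "T = (if z < hi C e then {..<b} else UNIV) \<inter> (if lo C e < z then {b'<..} else UNIV)"
  have "open T" "z \<in> T" using b(1) b'(1) by (auto simp: T_def)
  then obtain y where y: "y \<in> ereal ` ?B" "y \<in> T" "y \<noteq> z"
    using z(2) unfolding islimpt_def by blast
  then obtain x where x: "y = ereal x" "lo C e < ereal x" "ereal x < hi C e" "\<not> ?good x"
    by (auto simp: EdgePt_in_points)
  show False
  proof (cases "z < y")
    case True
    then have "z < hi C e" using x by (auto intro: less_trans)
    then show False using b(2) True x y by (auto simp: T_def)
  next
    case False
    then have "y < z" using y by auto
    then have "lo C e < z" using x by (auto intro: less_trans)
    then show False using b'(2) \<open>y < z\<close> x y by (auto simp: T_def)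
  qed
qed

text \<open>Rationality becomes a local condition, which is the form that gluing over an arbitrary,
  possibly infinite cover can deliver.\<close>

lemma rational_onI_germs:
  assumes sl: "\<And>p \<xi>. p \<in> points C \<Longrightarrow> \<xi> \<in> tangents C p \<Longrightarrow> \<exists>m. has_slope f p \<xi> m"
    and lim: "\<And>p \<xi>. p \<in> finite_points C \<Longrightarrow> \<xi> \<in> tangents C p \<Longrightarrow>
      ((\<lambda>x. f (EdgePt (fst \<xi>) x)) \<longlongrightarrow> f p) (germ C p \<xi>)"
  shows "rational_on C (points C) f"
  unfolding rational_on_def
proof (intro conjI ballI)
  show "continuous_map (subtopology (curve_top C) (points C \<inter> finite_points C)) euclideanreal f"
    unfolding continuous_map_iff_germs[OF open_in_curve_Int[OF open_points open_finite_points]]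
    using lim by blast
  fix e assume e: "e \<in> edges C"
  let ?B = "{x. EdgePt e x \<in> points C \<and>
    \<not> (\<exists>(m::int) c. \<forall>\<^sub>F y in nhds x. f (EdgePt e y) = of_int m * y + c)}"
  have "int_linear_on I (\<lambda>x. f (EdgePt e x))" if "is_interval I" "I \<subseteq> edge_part C (points C) e - ?B" for I
    by (rule locally_int_linear_imp_int_linear_on[OF that(1)])
      (use that(2) in \<open>auto simp: edge_part_def\<close>)
  then show "\<exists>B. finite B \<and> (\<forall>I. is_interval I \<and> I \<subseteq> edge_part C (points C) e - B \<longrightarrow>
      int_linear_on I (\<lambda>x. f (EdgePt e x)))"
    using finite_breaks[OF sl e] by blast
qed

lemma cohomologous_imp_linear_equivalent:
  assumes "((\<U>, g), (\<V>, h)) \<in> cohomologous C"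
    and "divisor_cocycle C D (\<U>, g)" "divisor_cocycle C D' (\<V>, h)"
  shows "\<exists>F. rational_on C (points C) F \<and>
    (\<forall>p\<in>points C. ord_at C F p = Poly_Mapping.lookup D p - Poly_Mapping.lookup D' p)"
proof -
  obtain f where co: "(\<U>, g) \<in> cocycles C" and
    f: "\<And>U. U \<in> \<U> \<Longrightarrow> rational_on C U (f U)"
    "\<And>U p. U \<in> \<U> \<Longrightarrow> p \<in> U \<Longrightarrow> ord_at C (f U) p = Poly_Mapping.lookup D p"
    "\<And>U V p. U \<in> \<U> \<Longrightarrow> V \<in> \<U> \<Longrightarrow> p \<in> U \<inter> V \<inter> finite_points C \<Longrightarrow> g U V p = f U p - f V p"
    by (rule divisor_cocycleE[OF assms(2)]) (rule that)
  obtain k where co': "(\<V>, h) \<in> cocycles C" and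
    k: "\<And>V. V \<in> \<V> \<Longrightarrow> rational_on C V (k V)"
    "\<And>V p. V \<in> \<V> \<Longrightarrow> p \<in> V \<Longrightarrow> ord_at C (k V) p = Poly_Mapping.lookup D' p"
    "\<And>U V p. U \<in> \<V> \<Longrightarrow> V \<in> \<V> \<Longrightarrow> p \<in> U \<inter> V \<inter> finite_points C \<Longrightarrow> h U V p = k U p - k V p"
    by (rule divisor_cocycleE[OF assms(3)]) (rule that)
  obtain \<W> \<rho> \<sigma> s where W: "open_cover C \<W>"
    and ref: "\<forall>W\<in>\<W>. \<rho> W \<in> \<U> \<and> W \<subseteq> \<rho> W \<and> \<sigma> W \<in> \<V> \<and> W \<subseteq> \<sigma> W \<and> unit_section C W (s W)"
    and cob: "\<forall>W\<in>\<W>. \<forall>W'\<in>\<W>. \<forall>p\<in>W \<inter> W'. g (\<rho> W) (\<rho> W') p - h (\<sigma> W) (\<sigma> W') p = s W p - s W' p"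
    using assms(1) unfolding cohomologous_def by fast
  \<comment> \<open>Once \<open>g\<close> and \<open>h\<close> are replaced by differences of local
    equations, the coboundary equation says exactly that these functions agree on overlaps, at
    finite points. Subtracting \<open>s W\<close> leaves the orders alone.\<close>
  define G where "G W p = f (\<rho> W) p - k (\<sigma> W) p - s W p" for W p
  have open_W: "open_in_curve C W" if "W \<in> \<W>" for W
    using W that by (auto simp: open_cover_def openin_curve_top)
  have G_rat: "rational_on C W (G W)"
    and G_ord: "\<And>p. p \<in> W \<Longrightarrow> ord_at C (G W) p = Poly_Mapping.lookup D p - Poly_Mapping.lookup D' p"
    if "W \<in> \<W>" for W
  proof -
    note w = bspec[OF ref that]
    have r: "rational_on C W (f (\<rho> W))" "rational_on C W (k (\<sigma> W))" "rational_on C W (s W)"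
      using w f(1) k(1) by (auto intro: rational_on_subset unit_section_imp_rational_on)
    note r2 = rational_on_diff[OF r(1,2)]
    show "rational_on C W (G W)"
      using rational_on_diff[OF r2 r(3)] by (simp add: G_def[abs_def])
    fix p assume p: "p \<in> W"
    have "ord_at C (s W) p = 0" using w p by (simp add: unit_section_def)
    moreover have "p \<in> \<rho> W" "p \<in> \<sigma> W" using w p by auto
    ultimately show "ord_at C (G W) p = Poly_Mapping.lookup D p - Poly_Mapping.lookup D' p"
      unfolding G_def[abs_def]
      using ord_at_diff[OF open_W[OF that] r2 r(3) p] ord_at_diff[OF open_W[OF that] r(1,2) p]
        f(2)[of "\<rho> W" p] k(2)[of "\<sigma> W" p] w p by auto
  qed
  have glue: "G W p = G W' p" if "W \<in> \<W>" "W' \<in> \<W>" "p \<in> W" "p \<in> W'" "p \<in> finite_points C" for W W' p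
  proof -
    have "g (\<rho> W) (\<rho> W') p = f (\<rho> W) p - f (\<rho> W') p"
      using that ref by (intro f(3)) auto
    moreover have "h (\<sigma> W) (\<sigma> W') p = k (\<sigma> W) p - k (\<sigma> W') p"
      using that ref by (intro k(3)) auto
    moreover have "g (\<rho> W) (\<rho> W') p - h (\<sigma> W) (\<sigma> W') p = s W p - s W' p"
      using cob that by blast
    ultimately show ?thesis by (simp add: G_def)
  qed
  \<comment> \<open>At a point at infinity the value may depend on the chosen member, but neither
    germs nor continuity on finite points see it.\<close>
  define F where "F p = G (SOME W. W \<in> \<W> \<and> p \<in> W) p" for p
  have F_G: "F p = G W p" if "W \<in> \<W>" "p \<in> W" "p \<in> finite_points C" for W p
  proof -
    have "\<exists>W. W \<in> \<W> \<and> p \<in> W" using that by auto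
    from someI_ex[OF this] show ?thesis unfolding F_def using glue that by blast
  qed
  have ex_W: "\<exists>W\<in>\<W>. p \<in> W" if "p \<in> points C" for p
    using W that by (auto simp: open_cover_def)
  have F_germ: "\<forall>\<^sub>F x in germ C p \<xi>. F (EdgePt (fst \<xi>) x) = G W (EdgePt (fst \<xi>) x)"
    if "W \<in> \<W>" "p \<in> W" "\<xi> \<in> tangents C p" for W p \<xi>
    using open_in_curveD[OF open_W[OF that(1)] that(2,3)]
  proof eventually_elim
    case (elim x)
    then show ?case
      using that(1) open_in_curve_subset[OF open_W[OF that(1)]]
      by (intro F_G) (auto simp: EdgePt_in_finite_points)
  qed
  have F_slope: "has_slope F p \<xi> (slope C (G W) p \<xi>)"
    if "W \<in> \<W>" "p \<in> W" "\<xi> \<in> tangents C p" for W p \<xi>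
    using has_slope_cong[OF F_germ[OF that] has_slope_slope[OF open_W[OF that(1)] G_rat[OF that(1)] that(2,3)]] .
  have "rational_on C (points C) F"
  proof (rule rational_onI_germs)
    fix p \<xi> assume "p \<in> points C" "\<xi> \<in> tangents C p"
    then show "\<exists>m. has_slope F p \<xi> m" using F_slope ex_W by blast
  next
    fix p \<xi> assume p: "p \<in> finite_points C" "\<xi> \<in> tangents C p"
    then obtain W where w: "W \<in> \<W>" "p \<in> W" using ex_W[of p] by (auto simp: finite_points_def)
    have "((\<lambda>x. G W (EdgePt (fst \<xi>) x)) \<longlongrightarrow> G W p) (germ C p \<xi>)"
      using rational_on_tendsto[OF open_W[OF w(1)] G_rat[OF w(1)]] w p by auto
    then show "((\<lambda>x. F (EdgePt (fst \<xi>) x)) \<longlongrightarrow> F p) (germ C p \<xi>)"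
      unfolding F_G[OF w p(1)] by (rule tendsto_cong[THEN iffD2, OF F_germ[OF w p(2)]])
  qed
  moreover have "ord_at C F p = Poly_Mapping.lookup D p - Poly_Mapping.lookup D' p" if p: "p \<in> points C" for p
  proof -
    obtain W where w: "W \<in> \<W>" "p \<in> W" using ex_W[OF p] by auto
    have "ord_at C F p = ord_at C (G W) p"
      using ord_at_eqI[OF p F_slope[OF w]] by (simp add: ord_at_def)
    then show ?thesis using G_ord[OF w] by simp
  qed
  ultimately show ?thesis by blast
qed

section \<open>Equality of line bundles as linear equivalence\<close>

lemma cohomologous_refl:
  assumes "c \<in> cocycles C"
  shows "(c, c) \<in> cohomologous C"
proof -
  obtain \<U> g where c: "c = (\<U>, g)" by (cases c)
  have U: "open_cover C \<U>" using assms c by (simp add: cocycles_def)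
  have "unit_section C U (\<lambda>p. 0)" if "U \<in> \<U>" for U
    using U that by (intro unit_section_zero open_in_curve_subset) (auto simp: open_cover_def openin_curve_top)
  then show ?thesis
    using assms U unfolding cohomologous_def c
    by (auto intro!: exI[of _ \<U>] exI[of _ "\<lambda>U. U"] exI[of _ "\<lambda>U p. 0"])
qed

lemma divisor_cocycle_some:
  assumes "Poly_Mapping.keys D \<subseteq> points C"
  shows "divisor_cocycle C D (SOME c. divisor_cocycle C D c)"
  using someI_ex[OF ex_divisor_cocycle[OF assms]] .

lemma line_bundle_in_Pic:
  assumes "Poly_Mapping.keys D \<subseteq> points C"
  shows "line_bundle C D \<in> Pic C"
  unfolding line_bundle_def Pic_def
  using divisor_cocycle_some[OF assms] by (intro quotientI) (auto simp: divisor_cocycle_def)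

lemma line_bundle_eq_iff:
  assumes D: "Poly_Mapping.keys D \<subseteq> points C" and D': "Poly_Mapping.keys D' \<subseteq> points C"
  shows "line_bundle C D = line_bundle C D' \<longleftrightarrow> (\<exists>F. rational_on C (points C) F \<and>
    (\<forall>p\<in>points C. ord_at C F p = Poly_Mapping.lookup D p - Poly_Mapping.lookup D' p))"
proof
  assume eq: "line_bundle C D = line_bundle C D'"
  define c c' where "c = (SOME c. divisor_cocycle C D c)" "c' = (SOME c. divisor_cocycle C D' c)"
  have dc: "divisor_cocycle C D c" "divisor_cocycle C D' c'"
    unfolding c_c'_def using D D' by (auto intro: divisor_cocycle_some)
  then have "c' \<in> cocycles C" by (auto simp: divisor_cocycle_def)
  \<comment> \<open>By reflexivity \<open>c'\<close> lies in its own class, hence in that of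
    \<open>c\<close>.\<close>
  then have "(c, c') \<in> cohomologous C"
    using eq cohomologous_refl[of c'] unfolding line_bundle_def c_c'_def[symmetric] by auto
  then show "\<exists>F. rational_on C (points C) F \<and>
    (\<forall>p\<in>points C. ord_at C F p = Poly_Mapping.lookup D p - Poly_Mapping.lookup D' p)"
    using cohomologous_imp_linear_equivalent dc by (metis prod.collapse)
qed (use line_bundle_linear_equivalent in blast)

end

lemma card_add_eq_1:
  assumes "finite A" "finite B" "card A + card B = 1" "x \<in> B"
  shows "A = {}" "B = {x}"
proof -
  have "card B \<noteq> 0" using assms by auto
  then have "card A = 0" "card B = 1" using assms(3) by auto
  then show "A = {}" "B = {x}" using assms by (auto simp: card_1_singleton_iff)
qed

context compact_tropical_curve
begin

section \<open>Chains and the Jacobian\<close>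

definition edge_length :: "'e \<Rightarrow> real" where
  "edge_length e = real_of_ereal (hi C e - lo C e)"

text \<open>The vertex to which a point is retracted along its edge; choosing the tail for all
  interior points makes path integrals comparable with cellular chains.\<close>

definition base :: "('v, 'e) point \<Rightarrow> 'v" where
  "base p = (case p of Vertex v \<Rightarrow> v | EdgePt e x \<Rightarrow> tail (skel C) e)"

text \<open>The integral along the segment from \<open>base p\<close> to \<open>p\<close>. On a leaf
  whose tail is at infinity the coordinate difference is a default value, multiplied by a vanishing
  form.\<close>

definition offset :: "('e \<times> bool \<Rightarrow> real) \<Rightarrow> ('v, 'e) point \<Rightarrow> real" where
  "offset \<omega> p = (case p of Vertex v \<Rightarrow> 0
    | EdgePt e x \<Rightarrow> \<omega> (e, True) * (x - real_of_ereal (lo C e)))"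

definition chains :: "('e \<Rightarrow> int) set" where
  "chains = {c. \<forall>e. e \<notin> edges C \<longrightarrow> c e = 0}"

definition boundary :: "('e \<Rightarrow> int) \<Rightarrow> 'v \<Rightarrow> int" where
  "boundary c v = (\<Sum>e\<in>in_arcs (skel C) v. c e) - (\<Sum>e\<in>out_arcs (skel C) v. c e)"

definition chain_integral :: "('e \<Rightarrow> int) \<Rightarrow> ('e \<times> bool \<Rightarrow> real) \<Rightarrow> real" where
  "chain_integral c \<omega> = (\<Sum>e\<in>edges C. of_int (c e) * (\<omega> (e, True) * edge_length e))"

lemma finite_arcs: "finite (in_arcs (skel C) v)" "finite (out_arcs (skel C) v)"
  using finite_edges by (auto simp: out_arcs_def in_arcs_def)

lemma H1_iff: "c \<in> H1 C \<longleftrightarrow> c \<in> chains \<and> (\<forall>v\<in>verts (skel C). boundary c v = 0)"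
  by (auto simp: H1_def chains_def boundary_def)

lemma chains_add: "c \<in> chains \<Longrightarrow> d \<in> chains \<Longrightarrow> (\<lambda>e. c e + d e) \<in> chains"
  and chains_diff: "c \<in> chains \<Longrightarrow> d \<in> chains \<Longrightarrow> (\<lambda>e. c e - d e) \<in> chains"
  and chains_zero: "(\<lambda>e. 0) \<in> chains"
  by (auto simp: chains_def)

lemma boundary_add: "boundary (\<lambda>e. c e + d e) v = boundary c v + boundary d v"
  and boundary_diff: "boundary (\<lambda>e. c e - d e) v = boundary c v - boundary d v"
  and boundary_zero: "boundary (\<lambda>e. 0) v = 0"
  by (simp_all add: boundary_def sum.distrib sum_subtractf)

lemma chain_integral_add:
    "chain_integral (\<lambda>e. c e + d e) \<omega> = chain_integral c \<omega> + chain_integral d \<omega>"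
  and chain_integral_diff:
    "chain_integral (\<lambda>e. c e - d e) \<omega> = chain_integral c \<omega> - chain_integral d \<omega>"
  and chain_integral_zero: "chain_integral (\<lambda>e. 0) \<omega> = 0"
  by (simp_all add: chain_integral_def sum.distrib sum_subtractf algebra_simps)

lemma chains_scaled_sum:
  assumes "\<And>p. p \<in> S \<Longrightarrow> c p \<in> chains"
  shows "(\<lambda>e. \<Sum>p\<in>S. k p * c p e) \<in> chains"
  using assms by (auto simp: chains_def intro!: sum.neutral)

lemma boundary_scaled_sum: "boundary (\<lambda>e. \<Sum>p\<in>S. k p * c p e) v = (\<Sum>p\<in>S. k p * boundary (c p) v)"
  unfolding boundary_def
  by (simp add: sum_subtractf right_diff_distrib sum_distrib_left sum.swap[of _ S])

lemma chain_integral_scaled_sum: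
  "chain_integral (\<lambda>e. \<Sum>p\<in>S. k p * c p e) \<omega> = (\<Sum>p\<in>S. of_int (k p) * chain_integral (c p) \<omega>)"
  unfolding chain_integral_def sum_distrib_left
  by (subst sum.swap) (simp add: sum_distrib_right mult.assoc)

lemma single_chain: "e \<in> edges C \<Longrightarrow> (\<lambda>e'. if e' = e then a else 0) \<in> chains"
  by (auto simp: chains_def)

lemma boundary_single:
  assumes "e \<in> edges C"
  shows "boundary (\<lambda>e'. if e' = e then a else 0) v =
    (if v = head (skel C) e then a else 0) - (if v = tail (skel C) e then a else 0)"
  using assms by (auto simp: boundary_def sum.delta finite_arcs)

lemma chain_integral_single:
  assumes "e \<in> edges C"
  shows "chain_integral (\<lambda>e'. if e' = e then a else 0) \<omega> = of_int a * (\<omega> (e, True) * edge_length e)"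
proof -
  have "chain_integral (\<lambda>e'. if e' = e then a else 0) \<omega> =
      (\<Sum>e'\<in>edges C. if e' = e then of_int a * (\<omega> (e, True) * edge_length e) else 0)"
    unfolding chain_integral_def by (intro sum.cong) auto
  then show ?thesis using assms finite_edges by simp
qed

section \<open>1-forms at vertices and on leaves\<close>

lemma one_form_opposite:
  assumes "\<omega> \<in> one_forms C"
  shows "\<omega> (e, False) = - \<omega> (e, True)"
proof -
  have "\<forall>e b. \<omega> (e, \<not> b) = - \<omega> (e, b)" using assms unfolding one_forms_def by blast
  from this[rule_format, of e True] show ?thesis by simp
qed

lemma one_form_vertex:
  assumes "\<omega> \<in> one_forms C" "v \<in> verts (skel C)"
  shows "(\<Sum>e\<in>in_arcs (skel C) v. \<omega> (e, True)) = (\<Sum>e\<in>out_arcs (skel C) v. \<omega> (e, True))"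
proof -
  have neg: "\<omega> (e, False) = - \<omega> (e, True)" for e
    by (rule one_form_opposite[OF assms(1)])
  have "(\<Sum>\<xi>\<in>tangents C (Vertex v). \<omega> \<xi>) = 0"
    using assms Vertex_in_points unfolding one_forms_def by blast
  then show ?thesis unfolding sum_tangents_Vertex by (simp add: neg sum_negf)
qed

lemma one_formI:
  assumes "\<And>e. e \<notin> edges C \<Longrightarrow> w e = 0"
    "\<And>v. v \<in> verts (skel C) \<Longrightarrow> (\<Sum>e\<in>in_arcs (skel C) v. w e) = (\<Sum>e\<in>out_arcs (skel C) v. w e)"
  shows "(\<lambda>(e, b). if b then w e else - w e) \<in> one_forms C"
proof -
  have "(\<Sum>\<xi>\<in>tangents C p. case \<xi> of (e, b) \<Rightarrow> if b then w e else - w e) = 0" if "p \<in> points C" for p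
  proof (cases p)
    case (Vertex v)
    then show ?thesis
      using assms(2)[of v] that unfolding Vertex sum_tangents_Vertex
      by (simp add: Vertex_in_points sum_negf)
  qed simp
  then show ?thesis using assms(1) by (auto simp: one_forms_def)
qed

text \<open>At a 1-valent vertex the vertex condition has a single term. This neutralises every
  default value of \<open>real_of_ereal\<close> at infinite ends.\<close>

lemma one_form_leaf:
  assumes \<omega>: "\<omega> \<in> one_forms C" and e: "e \<in> edges C" and inf: "lo C e = - \<infinity> \<or> hi C e = \<infinity>"
  shows "\<omega> (e, True) = 0"
  using inf
proof
  let ?v = "tail (skel C) e"
  assume "lo C e = - \<infinity>"
  then have "card (in_arcs (skel C) ?v) + card (out_arcs (skel C) ?v) = 1"
    using lo_MInf_iff[OF e] by (simp add: valence_def in_degree_def out_degree_def)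
  from card_add_eq_1[OF finite_arcs this, of e] show ?thesis
    using one_form_vertex[OF \<omega> tail_in_verts[OF e]] e by simp
next
  let ?v = "head (skel C) e"
  assume "hi C e = \<infinity>"
  then have "card (out_arcs (skel C) ?v) + card (in_arcs (skel C) ?v) = 1"
    using hi_PInf_iff[OF e] by (simp add: valence_def in_degree_def out_degree_def)
  from card_add_eq_1[OF finite_arcs(2,1) this, of e] show ?thesis
    using one_form_vertex[OF \<omega> head_in_verts[OF e]] e by simp
qed

lemma finite_edge_ends:
  assumes "e \<in> edges C" "\<not> (lo C e = - \<infinity> \<or> hi C e = \<infinity>)"
  obtains a b where "lo C e = ereal a" "hi C e = ereal b" "a < b" "edge_length e = b - a"
proof -
  obtain a b where "lo C e = ereal a" "hi C e = ereal b"
    using assms lo_neq_PInf[OF assms(1)] hi_neq_MInf[OF assms(1)]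
    by (cases "lo C e"; cases "hi C e") auto
  with lo_less_hi[OF assms(1)] that show ?thesis by (simp add: edge_length_def)
qed

text \<open>A segment ending at the head of its edge is counted as traversing the whole edge.\<close>
lemma segment_integral:
  assumes e: "e \<in> edges C" and st: "s \<in> {lo C e..hi C e}" "t \<in> {lo C e..hi C e}"
    and \<omega>: "\<omega> \<in> one_forms C"
  shows "\<omega> (e, True) * real_of_ereal (t - s) =
    of_int ((if t = hi C e then 1 else 0) - (if s = hi C e then 1 else 0)) * (\<omega> (e, True) * edge_length e)
    + offset \<omega> (at_coord C e t) - offset \<omega> (at_coord C e s)"
proof (cases "lo C e = - \<infinity> \<or> hi C e = \<infinity>")
  case True
  then have "\<omega> (e, True) = 0" using one_form_leaf[OF \<omega> e] by simp
  then show ?thesis by (simp add: offset_def at_coord_def)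
next
  case False
  obtain a b where ab: "lo C e = ereal a" "hi C e = ereal b" "a < b" "edge_length e = b - a"
    by (rule finite_edge_ends[OF e False])
  have *: "offset \<omega> (at_coord C e (ereal x)) = \<omega> (e, True) * (x - a) -
      (if x = b then \<omega> (e, True) * (b - a) else 0)" for x
    using ab by (auto simp: offset_def at_coord_def)
  obtain s' t' where "s = ereal s'" "t = ereal t'"
    using st ab by (cases s; cases t) auto
  then show ?thesis using ab by (auto simp: * algebra_simps)
qed

lemma base_at_coord:
  assumes "e \<in> edges C" "s \<in> {lo C e..hi C e}"
  shows "base (at_coord C e s) = (if s = hi C e then head (skel C) e else tail (skel C) e)"
  using lo_less_hi[OF assms(1)] by (auto simp: base_def at_coord_def)

text \<open>Retracting the ends of each segment to \<open>base\<close> turns a path into an integral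
  chain between the bases of its endpoints. The offsets at intermediate points telescope, leaving
  those at the two ends.\<close>

lemma path_chain:
  assumes "is_path C p \<gamma> q"
  shows "\<exists>c\<in>chains. (\<forall>v. boundary c v = (if v = base q then 1 else 0) - (if v = base p then 1 else 0)) \<and>
    (\<forall>\<omega>\<in>one_forms C. path_integral \<omega> \<gamma> = chain_integral c \<omega> + offset \<omega> q - offset \<omega> p)"
  using assms
proof (induction C\<equiv>C p \<gamma> q rule: is_path.induct)
  case (1 p q)
  then show ?case
    by (intro bexI[OF _ chains_zero])
      (auto simp: boundary_zero chain_integral_zero path_integral_def)
next
  case (2 p e s t \<gamma> q)
  then have e: "e \<in> edges C" and st: "s \<in> {lo C e..hi C e}" "t \<in> {lo C e..hi C e}"
    and p: "p = at_coord C e s" and path: "is_path C (at_coord C e t) \<gamma> q" by auto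
  from 2(1)[OF path] obtain c where c: "c \<in> chains"
    "\<And>v. boundary c v = (if v = base q then 1 else 0) - (if v = base (at_coord C e t) then 1 else 0)"
    "\<And>\<omega>. \<omega> \<in> one_forms C \<Longrightarrow>
      path_integral \<omega> \<gamma> = chain_integral c \<omega> + offset \<omega> q - offset \<omega> (at_coord C e t)"
    by auto
  let ?a = "(if t = hi C e then 1 else 0) - (if s = hi C e then 1 else 0) :: int"
  let ?d = "\<lambda>e'. if e' = e then ?a else 0"
  show ?case
  proof (intro bexI[of _ "\<lambda>e'. c e' + ?d e'"] conjI allI ballI)
    show "(\<lambda>e'. c e' + ?d e') \<in> chains" using c(1) single_chain[OF e] by (rule chains_add)
    fix v
    show "boundary (\<lambda>e'. c e' + ?d e') v = (if v = base q then 1 else 0) - (if v = base p then 1 else 0)"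
      unfolding boundary_add c(2) boundary_single[OF e] p base_at_coord[OF e st(1)] base_at_coord[OF e st(2)]
      by auto
  next
    fix \<omega> assume \<omega>: "\<omega> \<in> one_forms C"
    have "path_integral \<omega> ((e, s, t) # \<gamma>) = \<omega> (e, True) * real_of_ereal (t - s) + path_integral \<omega> \<gamma>"
      by (simp add: path_integral_def)
    then show "path_integral \<omega> ((e, s, t) # \<gamma>) =
        chain_integral (\<lambda>e'. c e' + ?d e') \<omega> + offset \<omega> q - offset \<omega> p"
      unfolding segment_integral[OF e st \<omega>] c(3)[OF \<omega>] chain_integral_add chain_integral_single[OF e] p
      by simp
  qed
qed

section \<open>The quotient by periods\<close>

lemma one_forms_add: "\<omega> \<in> one_forms C \<Longrightarrow> \<eta> \<in> one_forms C \<Longrightarrow> (\<lambda>\<xi>. \<omega> \<xi> + \<eta> \<xi>) \<in> one_forms C"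
  by (auto simp: one_forms_def sum.distrib)

lemma one_forms_scale: "\<omega> \<in> one_forms C \<Longrightarrow> (\<lambda>\<xi>. a * \<omega> \<xi>) \<in> one_forms C"
  by (auto simp: one_forms_def sum_distrib_left[symmetric])

lemma cycle_integral_eq: "\<omega> \<in> one_forms C \<Longrightarrow> cycle_integral C c \<omega> = chain_integral c \<omega>"
  by (simp add: cycle_integral_def chain_integral_def path_integral_def edge_length_def)

lemma mod_periods_iff:
  "(F, G) \<in> mod_periods C \<longleftrightarrow> F \<in> dual_forms C \<and> G \<in> dual_forms C \<and>
    (\<exists>c\<in>H1 C. \<forall>\<omega>\<in>one_forms C. F \<omega> - G \<omega> = chain_integral c \<omega>)"
proof -
  have "(\<lambda>\<omega>\<in>one_forms C. F \<omega> - G \<omega>) = cycle_integral C c \<longleftrightarrow>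
      (\<forall>\<omega>\<in>one_forms C. F \<omega> - G \<omega> = chain_integral c \<omega>)" for c
    by (auto simp: fun_eq_iff cycle_integral_eq[symmetric] restrict_def cycle_integral_def)
  then show ?thesis by (auto simp: mod_periods_def period_lattice_def image_iff)
qed

lemma equiv_mod_periods: "equiv (dual_forms C) (mod_periods C)"
proof (rule equivI)
  show "mod_periods C \<subseteq> dual_forms C \<times> dual_forms C" by (auto simp: mod_periods_def)
  show "refl_on (dual_forms C) (mod_periods C)"
    by (auto simp: refl_on_def mod_periods_iff H1_iff chains_zero boundary_zero chain_integral_zero
        intro!: bexI[of _ "\<lambda>e. 0"])
  show "sym (mod_periods C)"
  proof (rule symI)
    fix F G assume "(F, G) \<in> mod_periods C"
    then obtain c where c: "F \<in> dual_forms C" "G \<in> dual_forms C" "c \<in> H1 C"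
      "\<And>\<omega>. \<omega> \<in> one_forms C \<Longrightarrow> F \<omega> - G \<omega> = chain_integral c \<omega>"
      by (auto simp: mod_periods_iff)
    \<comment> \<open>The negative is written as a difference from 0 so that the rules for
      differences of chains apply.\<close>
    have "(\<lambda>e. 0 - c e) \<in> H1 C"
      using c(3) chains_diff[OF chains_zero] by (auto simp: H1_iff boundary_diff boundary_zero simp del: diff_0)
    moreover have "G \<omega> - F \<omega> = chain_integral (\<lambda>e. 0 - c e) \<omega>" if "\<omega> \<in> one_forms C" for \<omega>
      using c(4)[OF that] by (simp add: chain_integral_diff chain_integral_zero del: diff_0)
    ultimately show "(G, F) \<in> mod_periods C" using c(1,2) mod_periods_iff by blast
  qed
  show "trans (mod_periods C)"
  proof (rule transI)
    fix F G K assume "(F, G) \<in> mod_periods C" "(G, K) \<in> mod_periods C"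
    then obtain c d where c: "F \<in> dual_forms C" "K \<in> dual_forms C" "c \<in> H1 C" "d \<in> H1 C"
      "\<And>\<omega>. \<omega> \<in> one_forms C \<Longrightarrow> F \<omega> - G \<omega> = chain_integral c \<omega>"
      "\<And>\<omega>. \<omega> \<in> one_forms C \<Longrightarrow> G \<omega> - K \<omega> = chain_integral d \<omega>"
      by (auto simp: mod_periods_iff)
    have "(\<lambda>e. c e + d e) \<in> H1 C" using c(3,4) by (simp add: H1_iff chains_add boundary_add)
    moreover have "F \<omega> - K \<omega> = chain_integral (\<lambda>e. c e + d e) \<omega>" if "\<omega> \<in> one_forms C" for \<omega>
      using c(5)[OF that] c(6)[OF that] by (simp add: chain_integral_add)
    ultimately show "(F, K) \<in> mod_periods C" using c(1,2) mod_periods_iff by blast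
  qed
qed

text \<open>The ring is left general so that the same additivity rules serve the integer-valued
  degrees and the real-valued offsets.\<close>

definition divisor_sum :: "(('v, 'e) point \<Rightarrow> 'a::comm_ring_1) \<Rightarrow> ('v, 'e) divisor \<Rightarrow> 'a" where
  "divisor_sum \<phi> D = (\<Sum>p\<in>Poly_Mapping.keys D. of_int (Poly_Mapping.lookup D p) * \<phi> p)"

text \<open>The integral 0-chain obtained by pushing the divisor forward along
  \<open>base\<close>.\<close>

definition base_degree :: "('v, 'e) divisor \<Rightarrow> 'v \<Rightarrow> int" where
  "base_degree D v = divisor_sum (\<lambda>p. if v = base p then 1 else 0) D"

lemma divisor_sum_superset:
  assumes "finite S" "Poly_Mapping.keys D \<subseteq> S"
  shows "divisor_sum \<phi> D = (\<Sum>p\<in>S. of_int (Poly_Mapping.lookup D p) * \<phi> p)"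
  unfolding divisor_sum_def by (rule sum.mono_neutral_left) (use assms in \<open>auto simp: in_keys_iff\<close>)

lemma divisor_sum_add: "divisor_sum \<phi> (D + D') = divisor_sum \<phi> D + divisor_sum \<phi> D'"
proof -
  let ?S = "Poly_Mapping.keys D \<union> Poly_Mapping.keys D'"
  have "divisor_sum \<phi> (D + D') = (\<Sum>p\<in>?S. of_int (Poly_Mapping.lookup (D + D') p) * \<phi> p)"
    by (rule divisor_sum_superset) (use Poly_Mapping.keys_add[of D D'] in auto)
  also have "\<dots> = divisor_sum \<phi> D + divisor_sum \<phi> D'"
    by (simp add: lookup_add distrib_right sum.distrib divisor_sum_superset[of ?S])
  finally show ?thesis .
qed

lemma degree_eq_divisor_sum: "degree D = divisor_sum (\<lambda>p. 1) D"
  by (simp add: degree_def divisor_sum_def)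

definition abel_jacobi_functional :: "('v, 'e) point \<Rightarrow> ('v, 'e) divisor \<Rightarrow> ('e \<times> bool \<Rightarrow> real) \<Rightarrow> real" where
  "abel_jacobi_functional p0 D = (\<lambda>\<omega>\<in>one_forms C.
     \<Sum>p\<in>Poly_Mapping.keys D. of_int (Poly_Mapping.lookup D p) * path_integral \<omega> (SOME \<gamma>. is_path C p0 \<gamma> p))"

lemma path_integral_add: "path_integral (\<lambda>\<xi>. \<omega> \<xi> + \<eta> \<xi>) \<gamma> = path_integral \<omega> \<gamma> + path_integral \<eta> \<gamma>"
  by (induction \<gamma>) (auto simp: path_integral_def algebra_simps)

lemma path_integral_scale: "path_integral (\<lambda>\<xi>. a * \<omega> \<xi>) \<gamma> = a * path_integral \<omega> \<gamma>"
  by (induction \<gamma>) (auto simp: path_integral_def algebra_simps)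

lemma abel_jacobi_functional_dual: "abel_jacobi_functional p0 D \<in> dual_forms C"
  unfolding dual_forms_def abel_jacobi_functional_def
  by (auto simp: one_forms_add one_forms_scale path_integral_add path_integral_scale
      distrib_left sum.distrib sum_distrib_left mult.left_commute)

lemma abel_jacobi_eq: "abel_jacobi C p0 D = mod_periods C `` {abel_jacobi_functional p0 D}"
  by (simp add: abel_jacobi_def abel_jacobi_functional_def)

lemma abel_jacobi_in_Jac: "abel_jacobi C p0 D \<in> Jac C"
  unfolding Jac_def abel_jacobi_eq by (intro quotientI abel_jacobi_functional_dual)

text \<open>The chosen paths depend on the points only and not on the form, so one weighted sum of
  their chains describes the functional on all 1-forms at once.\<close>

lemma abel_jacobi_functional_chain:
  assumes p0: "p0 \<in> points C" and D: "Poly_Mapping.keys D \<subseteq> points C"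
  shows "\<exists>c\<in>chains.
    (\<forall>v. boundary c v = base_degree D v - degree D * (if v = base p0 then 1 else 0)) \<and>
    (\<forall>\<omega>\<in>one_forms C. abel_jacobi_functional p0 D \<omega> =
      chain_integral c \<omega> + divisor_sum (offset \<omega>) D - of_int (degree D) * offset \<omega> p0)"
proof -
  define \<gamma> where "\<gamma> p = (SOME \<gamma>. is_path C p0 \<gamma> p)" for p
  have "is_path C p0 (\<gamma> p) p" if "p \<in> points C" for p
    unfolding \<gamma>_def using ex_path[OF p0 that] by (rule someI_ex)
  then have "\<forall>p\<in>points C. \<exists>c. c \<in> chains \<and>
      (\<forall>v. boundary c v = (if v = base p then 1 else 0) - (if v = base p0 then 1 else 0)) \<and>
      (\<forall>\<omega>\<in>one_forms C. path_integral \<omega> (\<gamma> p) = chain_integral c \<omega> + offset \<omega> p - offset \<omega> p0)"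
    using path_chain by blast
  then obtain c where "\<forall>p\<in>points C. c p \<in> chains \<and>
      (\<forall>v. boundary (c p) v = (if v = base p then 1 else 0) - (if v = base p0 then 1 else 0)) \<and>
      (\<forall>\<omega>\<in>one_forms C. path_integral \<omega> (\<gamma> p) = chain_integral (c p) \<omega> + offset \<omega> p - offset \<omega> p0)"
    unfolding bchoice_iff by blast
  then have c: "c p \<in> chains"
    "boundary (c p) v = (if v = base p then 1 else 0) - (if v = base p0 then 1 else 0)"
    "\<omega> \<in> one_forms C \<Longrightarrow> path_integral \<omega> (\<gamma> p) = chain_integral (c p) \<omega> + offset \<omega> p - offset \<omega> p0"
    if "p \<in> Poly_Mapping.keys D" for p v \<omega>
    using that D by auto
  let ?c = "\<lambda>e. \<Sum>p\<in>Poly_Mapping.keys D. Poly_Mapping.lookup D p * c p e"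
  show ?thesis
  proof (intro bexI[of _ ?c] conjI allI ballI)
    show "?c \<in> chains" using c(1) by (rule chains_scaled_sum)
    show "boundary ?c v = base_degree D v - degree D * (if v = base p0 then 1 else 0)" for v
      unfolding boundary_scaled_sum base_degree_def degree_def divisor_sum_def sum_distrib_right
        sum_subtractf[symmetric]
      by (intro sum.cong refl) (simp add: c(2) algebra_simps)
    show "abel_jacobi_functional p0 D \<omega> =
        chain_integral ?c \<omega> + divisor_sum (offset \<omega>) D - of_int (degree D) * offset \<omega> p0"
      if \<omega>: "\<omega> \<in> one_forms C" for \<omega>
      using \<omega>
      unfolding abel_jacobi_functional_def \<gamma>_def[symmetric] restrict_apply chain_integral_scaled_sum
        degree_def divisor_sum_def of_int_sum sum_distrib_right
      by (simp add: sum.distrib[symmetric] sum_subtractf[symmetric] c(3)[OF _ \<omega>] algebra_simps)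
  qed
qed

text \<open>The integer chain compares the chosen paths to the points of the two divisors; it is unique up
  to an integral cycle, that is, up to a period.\<close>
lemma abel_jacobi_eq_iff:
  assumes p0: "p0 \<in> points C" and D: "D \<in> Div C d" "D' \<in> Div C d"
  shows "abel_jacobi C p0 D = abel_jacobi C p0 D' \<longleftrightarrow>
    (\<exists>n\<in>chains. (\<forall>v\<in>verts (skel C). boundary n v = base_degree D v - base_degree D' v) \<and>
      (\<forall>\<omega>\<in>one_forms C. chain_integral n \<omega> + divisor_sum (offset \<omega>) D - divisor_sum (offset \<omega>) D' = 0))"
    (is "_ \<longleftrightarrow> ?R")
proof -
  have K: "Poly_Mapping.keys D \<subseteq> points C" "Poly_Mapping.keys D' \<subseteq> points C"
    and deg: "degree D = d" "degree D' = d"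
    using D by (auto simp: Div_def)
  obtain c where c: "c \<in> chains"
    "\<And>v. boundary c v = base_degree D v - d * (if v = base p0 then 1 else 0)"
    "\<And>\<omega>. \<omega> \<in> one_forms C \<Longrightarrow> abel_jacobi_functional p0 D \<omega> =
      chain_integral c \<omega> + divisor_sum (offset \<omega>) D - of_int d * offset \<omega> p0"
    using abel_jacobi_functional_chain[OF p0 K(1)] deg by auto
  obtain c' where c': "c' \<in> chains"
    "\<And>v. boundary c' v = base_degree D' v - d * (if v = base p0 then 1 else 0)"
    "\<And>\<omega>. \<omega> \<in> one_forms C \<Longrightarrow> abel_jacobi_functional p0 D' \<omega> =
      chain_integral c' \<omega> + divisor_sum (offset \<omega>) D' - of_int d * offset \<omega> p0"
    using abel_jacobi_functional_chain[OF p0 K(2)] deg by auto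
  let ?c = "\<lambda>e. c e - c' e"
  have "abel_jacobi C p0 D = abel_jacobi C p0 D' \<longleftrightarrow>
      (abel_jacobi_functional p0 D, abel_jacobi_functional p0 D') \<in> mod_periods C"
    unfolding abel_jacobi_eq
    by (rule eq_equiv_class_iff[OF equiv_mod_periods]) (rule abel_jacobi_functional_dual)+
  also have "\<dots> \<longleftrightarrow> (\<exists>z\<in>H1 C. \<forall>\<omega>\<in>one_forms C. chain_integral ?c \<omega> +
      divisor_sum (offset \<omega>) D - divisor_sum (offset \<omega>) D' = chain_integral z \<omega>)"
    by (simp add: mod_periods_iff abel_jacobi_functional_dual c(3) c'(3) chain_integral_diff algebra_simps
        cong: ball_cong)
  also have "\<dots> \<longleftrightarrow> ?R"
  proof
    assume "\<exists>z\<in>H1 C. \<forall>\<omega>\<in>one_forms C. chain_integral ?c \<omega> +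
      divisor_sum (offset \<omega>) D - divisor_sum (offset \<omega>) D' = chain_integral z \<omega>"
    then obtain z where z: "z \<in> H1 C" "\<forall>\<omega>\<in>one_forms C. chain_integral ?c \<omega> +
      divisor_sum (offset \<omega>) D - divisor_sum (offset \<omega>) D' = chain_integral z \<omega>" by auto
    \<comment> \<open>The period \<open>z\<close> and the chain sought determine each other:
      together they add up to the difference of the chains of the two divisors.\<close>
    show ?R
      by (rule bexI[of _ "\<lambda>e. ?c e - z e"])
        (use z c(1) c'(1) in \<open>auto simp: boundary_diff chain_integral_diff c(2) c'(2) H1_iff intro!: chains_diff\<close>)
  next
    assume ?R
    then obtain n where n: "n \<in> chains"
      "\<forall>v\<in>verts (skel C). boundary n v = base_degree D v - base_degree D' v"
      "\<forall>\<omega>\<in>one_forms C. chain_integral n \<omega> + divisor_sum (offset \<omega>) D - divisor_sum (offset \<omega>) D' = 0"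
      by auto
    show "\<exists>z\<in>H1 C. \<forall>\<omega>\<in>one_forms C. chain_integral ?c \<omega> +
      divisor_sum (offset \<omega>) D - divisor_sum (offset \<omega>) D' = chain_integral z \<omega>"
      by (rule bexI[of _ "\<lambda>e. ?c e - n e"])
        (use n c(1) c'(1) in \<open>auto simp: boundary_diff chain_integral_diff c(2) c'(2) H1_iff intro!: chains_diff\<close>)
  qed
  finally show ?thesis .
qed

end

text \<open>The coordinates in \<open>S\<close> separate the points of \<open>V\<close>, so a
  functional on \<open>V\<close> is a combination of them. Induction on \<open>S\<close>: the
  subspace where the new coordinate vanishes is separated by the remaining ones.\<close>

lemma linear_functional_coordinates:
  fixes V :: "('x \<Rightarrow> real) set"
  assumes "finite S"
    and "\<And>v w. v \<in> V \<Longrightarrow> w \<in> V \<Longrightarrow> (\<lambda>i. v i + w i) \<in> V" "\<And>v a. v \<in> V \<Longrightarrow> (\<lambda>i. a * v i) \<in> V"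
    and "\<And>v. v \<in> V \<Longrightarrow> (\<And>s. s \<in> S \<Longrightarrow> v s = 0) \<Longrightarrow> v = (\<lambda>i. 0)"
    and "\<And>v w. v \<in> V \<Longrightarrow> w \<in> V \<Longrightarrow> G (\<lambda>i. v i + w i) = G v + G w"
    and "\<And>v a. v \<in> V \<Longrightarrow> G (\<lambda>i. a * v i) = a * G v"
  shows "\<exists>a. \<forall>v\<in>V. G v = (\<Sum>s\<in>S. a s * v s)"
  using assms
proof (induction S arbitrary: V rule: finite_induct)
  case empty
  have "G v = 0" if "v \<in> V" for v
    using empty(3)[OF that] empty(5)[OF that, of 0] by simp
  then show ?case by simp
next
  case (insert s S)
  let ?V = "{v \<in> V. v s = 0}"
  have "\<exists>a. \<forall>v\<in>?V. G v = (\<Sum>s\<in>S. a s * v s)"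
  proof (rule insert.IH)
    show "v = (\<lambda>i. 0)" if "v \<in> ?V" "\<And>i. i \<in> S \<Longrightarrow> v i = 0" for v
      using insert.prems(3)[of v] that by auto
  qed (use insert.prems(1,2,4,5) in auto)
  then obtain a where a: "\<And>v. v \<in> V \<Longrightarrow> v s = 0 \<Longrightarrow> G v = (\<Sum>s\<in>S. a s * v s)" by auto
  have sum: "(\<Sum>i\<in>insert s S. (a(s := b)) i * v i) = b * v s + (\<Sum>i\<in>S. a i * v i)" for b v
    using insert.hyps by (auto intro!: sum.cong)
  show ?case
  proof (cases "\<exists>w\<in>V. w s \<noteq> 0")
    case True
    then obtain w where w: "w \<in> V" "w s \<noteq> 0" by auto
    \<comment> \<open>The coefficient is fitted to make the formula true at \<open>w\<close>; every
      \<open>v\<close> differs from a multiple of \<open>w\<close> by a vector whose coordinate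
      \<open>s\<close> is 0.\<close>
    define b where "b = (G w - (\<Sum>i\<in>S. a i * w i)) / w s"
    have "G v = b * v s + (\<Sum>i\<in>S. a i * v i)" if v: "v \<in> V" for v
    proof -
      define t where "t = v s / w s"
      have "G (\<lambda>i. v i + (- t) * w i) = G v + (- t) * G w"
        using v w insert.prems(2) by (simp only: insert.prems(4,5))
      moreover have "G (\<lambda>i. v i + (- t) * w i) = (\<Sum>i\<in>S. a i * (v i + (- t) * w i))"
        using insert.prems(1)[OF v insert.prems(2)[OF w(1), of "- t"]] w(2)
        by (intro a) (auto simp: t_def)
      ultimately have "G v = t * (G w - (\<Sum>i\<in>S. a i * w i)) + (\<Sum>i\<in>S. a i * v i)"
        by (simp add: algebra_simps sum.distrib sum_subtractf sum_distrib_left sum_negf)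
      then show ?thesis using w by (simp add: b_def t_def)
    qed
    then show ?thesis using sum[of b] by (intro exI[of _ "a(s := b)"]) simp
  next
    \<comment> \<open>Here the new coordinate vanishes on all of \<open>V\<close>, so the induction
      hypothesis already covers every vector.\<close>
    case False
    then show ?thesis using a sum[of 0] by (intro exI[of _ "a(s := 0)"]) auto
  qed
qed

context compact_tropical_curve
begin

section \<open>Abel's theorem\<close>

lemma divisor_sum_edges:
  assumes "Poly_Mapping.keys E \<subseteq> points C"
  shows "divisor_sum \<phi> E = (\<Sum>v\<in>verts (skel C). of_int (Poly_Mapping.lookup E (Vertex v)) * \<phi> (Vertex v)) +
    (\<Sum>e\<in>edges C. \<Sum>x | EdgePt e x \<in> Poly_Mapping.keys E.
      of_int (Poly_Mapping.lookup E (EdgePt e x)) * \<phi> (EdgePt e x))"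
proof -
  let ?V = "Vertex ` verts (skel C) :: ('v, 'e) point set"
  let ?Q = "\<lambda>e. {x. EdgePt e x \<in> Poly_Mapping.keys E}"
  let ?E = "\<Union>e\<in>edges C. EdgePt e ` ?Q e :: ('v, 'e) point set"
  let ?f = "\<lambda>p. of_int (Poly_Mapping.lookup E p) * \<phi> p"
  have fin: "finite ?V" "finite ?E"
    using finite_verts finite_edges by (auto simp: finite_edge_support)
  have "Poly_Mapping.keys E \<subseteq> ?V \<union> ?E"
  proof
    fix p assume p: "p \<in> Poly_Mapping.keys E"
    then have "p \<in> points C" using assms by auto
    then show "p \<in> ?V \<union> ?E" using p by (cases p) (auto simp: Vertex_in_points EdgePt_in_points)
  qed
  then have "divisor_sum \<phi> E = sum ?f (?V \<union> ?E)"
    using fin by (intro divisor_sum_superset) auto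
  also have "\<dots> = sum ?f ?V + sum ?f ?E"
    using fin by (intro sum.union_disjoint) auto
  also have "sum ?f ?V = (\<Sum>v\<in>verts (skel C). ?f (Vertex v))"
    by (subst sum.reindex) (auto simp: inj_on_def)
  also have "sum ?f ?E = (\<Sum>e\<in>edges C. sum ?f (EdgePt e ` ?Q e))"
    using finite_edges by (intro sum.UNION_disjoint) (auto simp: finite_edge_support)
  also have "\<dots> = (\<Sum>e\<in>edges C. \<Sum>x\<in>?Q e. ?f (EdgePt e x))"
    by (intro sum.cong refl) (subst sum.reindex, auto simp: inj_on_def)
  finally show ?thesis .
qed

lemma base_degree_edges:
  assumes "Poly_Mapping.keys E \<subseteq> points C" "v \<in> verts (skel C)"
  shows "base_degree E v = Poly_Mapping.lookup E (Vertex v) +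
    (\<Sum>e\<in>out_arcs (skel C) v. \<Sum>x | EdgePt e x \<in> Poly_Mapping.keys E. Poly_Mapping.lookup E (EdgePt e x))"
proof -
  let ?S = "\<lambda>e. \<Sum>x | EdgePt e x \<in> Poly_Mapping.keys E. Poly_Mapping.lookup E (EdgePt e x)"
  have "base_degree E v = (\<Sum>v'\<in>verts (skel C). if v = v' then Poly_Mapping.lookup E (Vertex v') else 0)
      + (\<Sum>e\<in>edges C. if tail (skel C) e = v then ?S e else 0)"
    unfolding base_degree_def divisor_sum_edges[OF assms(1)]
    by (intro arg_cong2[where f = "(+)"] sum.cong refl) (auto simp: base_def)
  also have "(\<Sum>e\<in>edges C. if tail (skel C) e = v then ?S e else 0) = (\<Sum>e\<in>out_arcs (skel C) v. ?S e)"
    using finite_edges by (simp add: out_arcs_def sum.inter_filter)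
  finally show ?thesis using assms(2) finite_verts by simp
qed

lemma divisor_sum_offset_edges:
  assumes "Poly_Mapping.keys E \<subseteq> points C"
  shows "divisor_sum (offset \<omega>) E = (\<Sum>e\<in>edges C. \<omega> (e, True) *
    (\<Sum>x | EdgePt e x \<in> Poly_Mapping.keys E.
      of_int (Poly_Mapping.lookup E (EdgePt e x)) * (x - real_of_ereal (lo C e))))"
  unfolding divisor_sum_edges[OF assms]
  by (simp add: offset_def sum_distrib_left mult.left_commute)

text \<open>Summation by parts: grouped by vertices, each value of \<open>u\<close> is multiplied by
  the net inflow of the form, which is 0.\<close>

lemma one_form_coboundary:
  assumes "\<omega> \<in> one_forms C"
  shows "(\<Sum>e\<in>edges C. \<omega> (e, True) * (u (head (skel C) e) - u (tail (skel C) e))) = 0"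
proof -
  let ?V = "verts (skel C)"
  have "(\<Sum>e\<in>edges C. \<omega> (e, True) * u (head (skel C) e)) =
      (\<Sum>v\<in>?V. \<Sum>e\<in>{e \<in> edges C. head (skel C) e = v}. \<omega> (e, True) * u (head (skel C) e))"
    using finite_edges finite_verts head_in_verts by (intro sum.group[symmetric]) auto
  also have "\<dots> = (\<Sum>v\<in>?V. (\<Sum>e\<in>in_arcs (skel C) v. \<omega> (e, True)) * u v)"
    by (auto simp: in_arcs_def sum_distrib_right intro!: sum.cong)
  also have "\<dots> = (\<Sum>v\<in>?V. (\<Sum>e\<in>out_arcs (skel C) v. \<omega> (e, True)) * u v)"
    using one_form_vertex[OF assms] by simp
  also have "\<dots> = (\<Sum>v\<in>?V. \<Sum>e\<in>{e \<in> edges C. tail (skel C) e = v}. \<omega> (e, True) * u (tail (skel C) e))"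
    by (auto simp: out_arcs_def sum_distrib_right intro!: sum.cong)
  also have "\<dots> = (\<Sum>e\<in>edges C. \<omega> (e, True) * u (tail (skel C) e))"
    using finite_edges finite_verts tail_in_verts by (intro sum.group) auto
  finally show ?thesis by (simp add: right_diff_distrib sum_subtractf)
qed

text \<open>Fix a vertex \<open>v0\<close> and let \<open>u v\<close> be the pairing of
  \<open>d\<close> with an integral chain from \<open>v0\<close> to \<open>v\<close>. Orthogonality
  to integral cycles makes this choice consistent along every edge.\<close>

lemma ex_potential:
  fixes d :: "'e \<Rightarrow> real"
  assumes "\<And>c. c \<in> H1 C \<Longrightarrow> (\<Sum>e\<in>edges C. of_int (c e) * d e) = 0"
  shows "\<exists>u. \<forall>e\<in>edges C. u (head (skel C) e) - u (tail (skel C) e) = d e"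
proof -
  obtain v0 where v0: "v0 \<in> verts (skel C)" using edges_nonempty tail_in_verts by blast
  have "\<forall>v\<in>verts (skel C). \<exists>c. c \<in> chains \<and>
      (\<forall>v'. boundary c v' = (if v' = v then 1 else 0) - (if v' = v0 then 1 else 0))"
    using ex_path_vertices[OF v0] path_chain unfolding base_def by fastforce
  then obtain c where "\<forall>v\<in>verts (skel C). c v \<in> chains \<and>
      (\<forall>v'. boundary (c v) v' = (if v' = v then 1 else 0) - (if v' = v0 then 1 else 0))"
    unfolding bchoice_iff by blast
  then have c: "\<And>v. v \<in> verts (skel C) \<Longrightarrow> c v \<in> chains"
    "\<And>v v'. v \<in> verts (skel C) \<Longrightarrow>
      boundary (c v) v' = (if v' = v then 1 else 0) - (if v' = v0 then 1 else 0)"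
    by auto
  define u where "u v = (\<Sum>e\<in>edges C. of_int (c v e) * d e)" for v
  have "u (head (skel C) e) - u (tail (skel C) e) = d e" if e: "e \<in> edges C" for e
  proof -
    \<comment> \<open>Out to the tail, along \<open>e\<close>, and back from the head: an integral
      cycle, on which \<open>d\<close> vanishes by assumption.\<close>
    let ?z = "\<lambda>e'. (c (tail (skel C) e) e' + (if e' = e then 1 else 0)) - c (head (skel C) e) e'"
    note th = tail_in_verts[OF e] head_in_verts[OF e]
    have "?z \<in> H1 C"
      unfolding H1_iff boundary_add boundary_diff boundary_single[OF e] c(2)[OF th(1)] c(2)[OF th(2)]
      using c(1)[OF th(1)] c(1)[OF th(2)] single_chain[OF e] by (auto intro!: chains_diff chains_add)
    from assms[OF this] have "u (tail (skel C) e) + (\<Sum>e'\<in>edges C. (if e' = e then 1 else 0) * d e')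
        - u (head (skel C) e) = 0"
      unfolding u_def sum.distrib[symmetric] sum_subtractf[symmetric]
      by (auto simp: algebra_simps intro!: sum.cong elim!: trans[rotated])
    moreover have "(\<Sum>e'\<in>edges C. (if e' = e then 1 else 0) * d e') = d e"
      using e finite_edges by (simp add: if_distrib[of "\<lambda>x. x * _"] cong: if_cong)
    ultimately show ?thesis by simp
  qed
  then show ?thesis by blast
qed

lemma plfun_endpoint:
  assumes "\<And>q. q \<in> Q \<Longrightarrow> a \<le> q \<and> q \<le> b"
  shows "plfun Q w \<alpha> k b - plfun Q w \<alpha> k a =
    of_int k * (b - a) - (\<Sum>q\<in>Q. of_int (w q) * (q - a))"
proof -
  have "max 0 (q - b) = 0" if "q \<in> Q" for q
    using assms[OF that] by simp
  then have "(\<Sum>q\<in>Q. of_int (w q) * max 0 (q - b)) = (0 :: real)"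
    by (intro sum.neutral) simp
  moreover have "(\<Sum>q\<in>Q. of_int (w q) * max 0 (q - a)) = (\<Sum>q\<in>Q. of_int (w q) * (q - a))"
    using assms by (intro sum.cong) (auto simp: max_def)
  ultimately show ?thesis by (simp add: plfun_def algebra_simps)
qed

text \<open>On the open edge subtract a hinge function \<open>h\<close> with the same orders. The
  difference has order 0 everywhere, so it is a single affine function with integer slope, which is
  absorbed into the parameters.\<close>

lemma rational_function_on_edge:
  assumes F: "rational_on C (points C) F" "\<And>p. p \<in> points C \<Longrightarrow> ord_at C F p = Poly_Mapping.lookup E p"
    and e: "e \<in> edges C"
  shows "\<exists>\<alpha> k. \<forall>x. EdgePt e x \<in> points C \<longrightarrow> F (EdgePt e x) =
    plfun {x. EdgePt e x \<in> Poly_Mapping.keys E} (\<lambda>x. Poly_Mapping.lookup E (EdgePt e x)) \<alpha> k x"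
proof -
  define Q where "Q e = {x. EdgePt e x \<in> Poly_Mapping.keys E}" for e
  define w where "w e x = Poly_Mapping.lookup E (EdgePt e x)" for e x
  have finQ: "finite (Q e)" for e unfolding Q_def by (rule finite_edge_support)
  define U :: "('v, 'e) point set" where "U = {EdgePt e x | x. EdgePt e x \<in> points C}"
  define h :: "('v, 'e) point \<Rightarrow> real" where "h = pl_function (\<lambda>_. 0) Q w (\<lambda>_. 0) (\<lambda>_. 0)"
  have U: "open_in_curve C U"
    using germ_in_edge by (fastforce simp: open_in_curve_def U_def)
  have h: "rational_on C U h"
    unfolding h_def using U finQ by (intro rational_on_pl_function) (auto simp: U_def)
  have FU: "rational_on C U F"
    using F(1) open_in_curve_subset[OF U] by (rule rational_on_subset)
  have "ord_at C (\<lambda>p. F p - h p) p = 0" if p: "p \<in> U" for p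
  proof -
    obtain x where x: "p = EdgePt e x" "EdgePt e x \<in> points C" using p by (auto simp: U_def)
    have "ord_at C h p = (if x \<in> Q e then w e x else 0)"
      unfolding h_def x(1) by (rule ord_at_pl_function_EdgePt[OF x(2) finQ])
    then have "ord_at C h p = Poly_Mapping.lookup E p"
      using x by (auto simp: Q_def w_def in_keys_iff)
    then show ?thesis using ord_at_diff[OF U FU h p] F(2)[of p] x by simp
  qed
  moreover have "is_interval (edge_part C U e)"
    unfolding is_interval_1
  proof (intro ballI allI impI)
    fix a b x assume ab: "a \<in> edge_part C U e" "b \<in> edge_part C U e" and x: "a \<le> x \<and> x \<le> b"
    have "lo C e < ereal x" "ereal x < hi C e"
      using less_le_trans[of "lo C e" "ereal a" "ereal x"] le_less_trans[of "ereal x" "ereal b" "hi C e"] ab x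
      by (auto simp: edge_part_def EdgePt_in_points)
    then show "x \<in> edge_part C U e" using e by (auto simp: edge_part_def U_def EdgePt_in_points)
  qed
  ultimately have "int_linear_on (edge_part C U e) (\<lambda>x. F (EdgePt e x) - h (EdgePt e x))"
    by (intro rational_on_int_linear_on[OF U rational_on_diff[OF FU h]]) (auto simp: edge_part_def)
  then obtain m :: int and c where
    "\<And>x. x \<in> edge_part C U e \<Longrightarrow> F (EdgePt e x) - h (EdgePt e x) = of_int m * x + c"
    by (auto simp: int_linear_on_def)
  then have "F (EdgePt e x) = plfun (Q e) (w e) c m x" if "EdgePt e x \<in> points C" for x
    using that by (fastforce simp: edge_part_def U_def h_def plfun_def)
  then show ?thesis unfolding Q_def w_def by blast
qed

lemma finite_ends_finite_points:
  assumes "e \<in> edges C"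
  shows "lo C e \<noteq> - \<infinity> \<Longrightarrow> Vertex (tail (skel C) e) \<in> finite_points C"
    "hi C e \<noteq> \<infinity> \<Longrightarrow> Vertex (head (skel C) e) \<in> finite_points C"
  using lo_MInf_iff[OF assms] hi_PInf_iff[OF assms] tail_in_verts[OF assms] head_in_verts[OF assms]
  by (auto simp: finite_points_def Vertex_in_points)

text \<open>At a finite end, continuity of \<open>F\<close> and of the explicit formula give two
  limits along the same germ. Infinite ends impose no such condition.\<close>

lemma rational_function_boundary_values:
  assumes F: "rational_on C (points C) F" and e: "e \<in> edges C"
    and pl: "\<And>x. EdgePt e x \<in> points C \<Longrightarrow> F (EdgePt e x) = plfun Q w \<alpha> k x"
  shows "lo C e = ereal a \<Longrightarrow> F (Vertex (tail (skel C) e)) = plfun Q w \<alpha> k a"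
    "hi C e = ereal b \<Longrightarrow> F (Vertex (head (skel C) e)) = plfun Q w \<alpha> k b"
proof -
  have lim: "(plfun Q w \<alpha> k \<longlongrightarrow> F p) (germ C p (e, s))"
    if p: "p \<in> finite_points C" "(e, s) \<in> tangents C p" for p s
  proof -
    have pp: "p \<in> points C" using p(1) by (simp add: finite_points_def)
    have "((\<lambda>x. F (EdgePt e x)) \<longlongrightarrow> F p) (germ C p (e, s))"
      using rational_on_tendsto[OF open_points F, of p "(e, s)"] p pp by auto
    then show ?thesis
      by (rule Lim_transform_eventually)
        (use eventually_mono[OF germ_in_edge[OF pp p(2)]] pl in auto)
  qed
  show "F (Vertex (tail (skel C) e)) = plfun Q w \<alpha> k a" if a: "lo C e = ereal a"
  proof -
    have "(plfun Q w \<alpha> k \<longlongrightarrow> F (Vertex (tail (skel C) e))) (at_right a)"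
      using lim[of "Vertex (tail (skel C) e)" True] finite_ends_finite_points[OF e] e a
      by (simp add: filtercomap_ereal_at)
    then show ?thesis using plfun_tendsto by (rule tendsto_unique[OF trivial_limit_at_right_real])
  qed
  show "F (Vertex (head (skel C) e)) = plfun Q w \<alpha> k b" if b: "hi C e = ereal b"
  proof -
    have "(plfun Q w \<alpha> k \<longlongrightarrow> F (Vertex (head (skel C) e))) (at_left b)"
      using lim[of "Vertex (head (skel C) e)" False] finite_ends_finite_points[OF e] e b
      by (simp add: filtercomap_ereal_at)
    then show ?thesis using plfun_tendsto by (rule tendsto_unique[OF trivial_limit_at_left_real])
  qed
qed

text \<open>The chain \<open>n\<close> records the slope of the rational function at the head of each edge, up to sign;
  it determines the slopes on the whole edge, and pairing with 1-forms tests whether they integrate to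
  a continuous function.\<close>

lemma rational_function_imp_chain:
  assumes E: "Poly_Mapping.keys E \<subseteq> points C"
    and F: "rational_on C (points C) F" "\<And>p. p \<in> points C \<Longrightarrow> ord_at C F p = Poly_Mapping.lookup E p"
  shows "\<exists>n\<in>chains. (\<forall>v\<in>verts (skel C). boundary n v = base_degree E v) \<and>
    (\<forall>\<omega>\<in>one_forms C. chain_integral n \<omega> + divisor_sum (offset \<omega>) E = 0)"
proof -
  define Q where "Q e = {x. EdgePt e x \<in> Poly_Mapping.keys E}" for e
  define w where "w e x = Poly_Mapping.lookup E (EdgePt e x)" for e x
  have finQ: "finite (Q e)" for e unfolding Q_def by (rule finite_edge_support)
  have Q: "lo C e < ereal q \<and> ereal q < hi C e" if "q \<in> Q e" for e q
    using that E by (auto simp: Q_def EdgePt_in_points)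
  have "\<forall>e\<in>edges C. \<exists>\<alpha>k. \<forall>x. EdgePt e x \<in> points C \<longrightarrow>
      F (EdgePt e x) = plfun (Q e) (w e) (fst \<alpha>k) (snd \<alpha>k) x"
    using rational_function_on_edge[OF F] unfolding Q_def w_def by fastforce
  then obtain \<alpha>k where "\<forall>e\<in>edges C. \<forall>x. EdgePt e x \<in> points C \<longrightarrow>
      F (EdgePt e x) = plfun (Q e) (w e) (fst (\<alpha>k e)) (snd (\<alpha>k e)) x"
    unfolding bchoice_iff by blast
  then obtain \<alpha> k where pl: "\<And>e x. EdgePt e x \<in> points C \<Longrightarrow>
      F (EdgePt e x) = plfun (Q e) (w e) (\<alpha> e) (k e) x"
    using that[of "\<lambda>e. fst (\<alpha>k e)" "\<lambda>e. snd (\<alpha>k e)"] by (auto simp: EdgePt_in_points)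
  define u where "u v = F (Vertex v)" for v
  \<comment> \<open>\<open>G\<close> equals \<open>F\<close> on the curve but is given by an
    explicit formula, so its orders at vertices can be computed from the edge data.\<close>
  define G where "G = pl_function u Q w \<alpha> k"
  have GF: "G p = F p" if "p \<in> points C" for p
    using that pl by (cases p) (auto simp: G_def u_def)
  have ordG: "ord_at C G p = Poly_Mapping.lookup E p" if p: "p \<in> points C" for p
  proof -
    have "has_slope G p \<xi> (slope C F p \<xi>)" if "\<xi> \<in> tangents C p" for \<xi>
      by (rule has_slope_cong[OF _ has_slope_slope[OF open_points F(1) p that]])
        (use eventually_mono[OF germ_in_edge[OF p that]] GF in auto)
    then have "ord_at C G p = ord_at C F p"
      using ord_at_eqI[OF p] by (simp add: ord_at_def)
    then show ?thesis using F(2)[OF p] by simp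
  qed
  let ?S = "\<lambda>e. \<Sum>x\<in>Q e. w e x"
  \<comment> \<open>All hinges vanish near the head, so \<open>k e\<close> is the slope in the arc
    direction there. The value 0 off the curve makes \<open>n\<close> a chain.\<close>
  define n where "n e = (if e \<in> edges C then - k e else 0)" for e
  have "boundary n v = base_degree E v" if v: "v \<in> verts (skel C)" for v
  proof -
    have "Poly_Mapping.lookup E (Vertex v) =
        (\<Sum>e\<in>out_arcs (skel C) v. k e - ?S e) - (\<Sum>e\<in>in_arcs (skel C) v. k e)"
      using ordG[of "Vertex v"] ord_at_pl_function_Vertex[OF v, of Q u w \<alpha> k] finQ Q v
      by (simp add: Vertex_in_points G_def)
    moreover have "boundary n v = (\<Sum>e\<in>out_arcs (skel C) v. k e) - (\<Sum>e\<in>in_arcs (skel C) v. k e)"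
      unfolding boundary_def n_def by (simp add: sum_negf)
    ultimately show ?thesis
      unfolding base_degree_edges[OF E v] by (simp add: sum_subtractf Q_def w_def)
  qed
  moreover have "chain_integral n \<omega> + divisor_sum (offset \<omega>) E = 0" if \<omega>: "\<omega> \<in> one_forms C" for \<omega>
  proof -
    have *: "of_int (n e) * (\<omega> (e, True) * edge_length e) +
        \<omega> (e, True) * (\<Sum>x\<in>Q e. of_int (w e x) * (x - real_of_ereal (lo C e))) =
        - (\<omega> (e, True) * (u (head (skel C) e) - u (tail (skel C) e)))" if e: "e \<in> edges C" for e
    proof (cases "lo C e = - \<infinity> \<or> hi C e = \<infinity>")
      case True
      then show ?thesis using one_form_leaf[OF \<omega> e] by simp
    next
      case False
      obtain a b where ab: "lo C e = ereal a" "hi C e = ereal b" "a < b" "edge_length e = b - a"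
        by (rule finite_edge_ends[OF e False])
      have "a \<le> q \<and> q \<le> b" if "q \<in> Q e" for q using Q[OF that] ab by simp
      moreover have "u (tail (skel C) e) = plfun (Q e) (w e) (\<alpha> e) (k e) a"
        unfolding u_def by (rule rational_function_boundary_values(1)[OF F(1) e _ ab(1)]) (rule pl)
      moreover have "u (head (skel C) e) = plfun (Q e) (w e) (\<alpha> e) (k e) b"
        unfolding u_def by (rule rational_function_boundary_values(2)[OF F(1) e _ ab(2)]) (rule pl)
      ultimately have "u (head (skel C) e) - u (tail (skel C) e) =
          of_int (k e) * (b - a) - (\<Sum>q\<in>Q e. of_int (w e q) * (q - a))"
        by (simp add: plfun_endpoint)
      note diff = this
      show ?thesis unfolding diff ab(1,4) using e by (simp add: n_def algebra_simps)
    qed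
    have "chain_integral n \<omega> + divisor_sum (offset \<omega>) E =
        (\<Sum>e\<in>edges C. - (\<omega> (e, True) * (u (head (skel C) e) - u (tail (skel C) e))))"
      unfolding chain_integral_def divisor_sum_offset_edges[OF E] sum.distrib[symmetric]
      using * by (intro sum.cong refl) (simp add: Q_def w_def)
    then show ?thesis using one_form_coboundary[OF \<omega>, of u] by (simp add: sum_negf)
  qed
  moreover have "n \<in> chains" by (simp add: chains_def n_def)
  ultimately show ?thesis by blast
qed

text \<open>Slopes are read off from \<open>n\<close> and \<open>E\<close>, vertex values from a
  potential. The pairing with 1-forms is what makes the increments close up around cycles.\<close>

lemma chain_imp_rational_function:
  assumes E: "Poly_Mapping.keys E \<subseteq> points C"
    and n: "n \<in> chains" "\<And>v. v \<in> verts (skel C) \<Longrightarrow> boundary n v = base_degree E v"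
      "\<And>\<omega>. \<omega> \<in> one_forms C \<Longrightarrow> chain_integral n \<omega> + divisor_sum (offset \<omega>) E = 0"
  shows "\<exists>F. rational_on C (points C) F \<and> (\<forall>p\<in>points C. ord_at C F p = Poly_Mapping.lookup E p)"
proof -
  define Q where "Q e = {x. EdgePt e x \<in> Poly_Mapping.keys E}" for e
  define w where "w e x = Poly_Mapping.lookup E (EdgePt e x)" for e x
  have finQ: "finite (Q e)" for e unfolding Q_def by (rule finite_edge_support)
  have Q: "lo C e < ereal q \<and> ereal q < hi C e" if "q \<in> Q e" for e q
    using that E by (auto simp: Q_def EdgePt_in_points)
  \<comment> \<open>The increment along the edge forced by slope \<open>- n e\<close> at the head
    and the bends of \<open>E\<close>, as in \<open>plfun_endpoint\<close>; on leaves it is always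
    paired with 0.\<close>
  define d where "d e = - (of_int (n e) * edge_length e +
      (\<Sum>x\<in>Q e. of_int (w e x) * (x - real_of_ereal (lo C e))))" for e
  have orth: "(\<Sum>e\<in>edges C. of_int (c e) * d e) = 0" if c: "c \<in> H1 C" for c
  proof -
    \<comment> \<open>The cycle condition at a vertex is the condition on 1-forms, so the
      coefficients of an integral cycle are those of a test form.\<close>
    define \<omega> where "\<omega> = (\<lambda>(e, b). if b then real_of_int (c e) else - of_int (c e))"
    have \<omega>: "\<omega> \<in> one_forms C"
      unfolding \<omega>_def
    proof (rule one_formI)
      show "real_of_int (c e) = 0" if "e \<notin> edges C" for e using c that by (simp add: H1_def)
      show "(\<Sum>e\<in>in_arcs (skel C) v. real_of_int (c e)) = (\<Sum>e\<in>out_arcs (skel C) v. real_of_int (c e))"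
        if "v \<in> verts (skel C)" for v
        using c that unfolding of_int_sum[symmetric] by (simp add: H1_def)
    qed
    have "(\<Sum>e\<in>edges C. of_int (c e) * d e) = - (chain_integral n \<omega> + divisor_sum (offset \<omega>) E)"
      unfolding chain_integral_def divisor_sum_offset_edges[OF E] sum.distrib[symmetric] sum_negf[symmetric]
      by (intro sum.cong refl) (simp add: \<omega>_def d_def Q_def w_def algebra_simps)
    then show ?thesis using n(3)[OF \<omega>] by simp
  qed
  obtain u where u: "\<And>e. e \<in> edges C \<Longrightarrow> u (head (skel C) e) - u (tail (skel C) e) = d e"
    using ex_potential[OF orth] by blast
  define k where "k e = - n e" for e
  \<comment> \<open>The constant is fixed at the tail if that end is finite, otherwise at the head.
    If both ends are infinite there is nothing to match and any constant will do.\<close>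
  define \<alpha> where "\<alpha> e = (if lo C e = - \<infinity>
      then u (head (skel C) e) - plfun (Q e) (w e) 0 (k e) (real_of_ereal (hi C e))
      else u (tail (skel C) e) - plfun (Q e) (w e) 0 (k e) (real_of_ereal (lo C e)))" for e
  have plus: "plfun R z a m x = a + plfun R z 0 m x" for R z a m x
    by (simp add: plfun_def)
  have at_tail: "plfun (Q e) (w e) (\<alpha> e) (k e) a = u (tail (skel C) e)" if "lo C e = ereal a" for e a
    using that by (subst plus) (simp add: \<alpha>_def)
  have at_head: "plfun (Q e) (w e) (\<alpha> e) (k e) b = u (head (skel C) e)"
    if e: "e \<in> edges C" and b: "hi C e = ereal b" for e b
  proof (cases "lo C e = - \<infinity>")
    case True
    then show ?thesis using b by (subst plus) (simp add: \<alpha>_def)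
  next
    case False
    then have "\<not> (lo C e = - \<infinity> \<or> hi C e = \<infinity>)" using b by simp
    then obtain a b' where ab: "lo C e = ereal a" "hi C e = ereal b'" "a < b'" "edge_length e = b' - a"
      by (rule finite_edge_ends[OF e])
    have "a \<le> q \<and> q \<le> b" if "q \<in> Q e" for q using Q[OF that] ab b by simp
    \<comment> \<open>With both ends finite the constant is already spent at the tail; the head
      value fits because the potential has increment \<open>d e\<close>.\<close>
    from plfun_endpoint[of "Q e", OF this, of "w e" "\<alpha> e" "k e"] show ?thesis
      using at_tail[OF ab(1)] u[OF e] ab b by (simp add: d_def k_def algebra_simps)
  qed
  define G where "G = pl_function u Q w \<alpha> k"
  have "rational_on C (points C) G"
    unfolding G_def
  proof (rule rational_on_pl_function[OF open_points finQ])
    fix v e b assume v: "Vertex v \<in> points C \<inter> finite_points C" and eb: "(e, b) \<in> tangents C (Vertex v)"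
    obtain r where r: "b \<Longrightarrow> lo C e = ereal r" "\<not> b \<Longrightarrow> hi C e = ereal r"
      by (rule finite_vertex_coord[of v "(e, b)"]) (use v eb in auto)
    have "u v = plfun (Q e) (w e) (\<alpha> e) (k e) r"
      using eb at_tail[of e r] at_head[of e r] r by (cases b) auto
    then show "(plfun (Q e) (w e) (\<alpha> e) (k e) \<longlongrightarrow> u v) (germ C (Vertex v) (e, b))"
      using r by (cases b) (auto simp: filtercomap_ereal_at intro: plfun_tendsto)
  qed
  moreover have "ord_at C G p = Poly_Mapping.lookup E p" if p: "p \<in> points C" for p
  proof (cases p)
    case (Vertex v)
    then have v: "v \<in> verts (skel C)" using p by (simp add: Vertex_in_points)
    have "ord_at C G p = (\<Sum>e\<in>out_arcs (skel C) v. k e - (\<Sum>x\<in>Q e. w e x)) - (\<Sum>e\<in>in_arcs (skel C) v. k e)"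
      unfolding G_def Vertex by (rule ord_at_pl_function_Vertex[OF v finQ Q])
    also have "\<dots> = boundary n v - (\<Sum>e\<in>out_arcs (skel C) v. \<Sum>x\<in>Q e. w e x)"
      by (simp add: boundary_def k_def sum_subtractf sum_negf)
    also have "\<dots> = Poly_Mapping.lookup E p"
      unfolding n(2)[OF v] base_degree_edges[OF E v] by (simp add: Q_def w_def Vertex)
    finally show ?thesis .
  next
    case (EdgePt e x)
    have "ord_at C G p = (if x \<in> Q e then w e x else 0)"
      unfolding G_def EdgePt by (rule ord_at_pl_function_EdgePt[OF p[unfolded EdgePt] finQ])
    then show ?thesis using EdgePt by (auto simp: Q_def w_def in_keys_iff)
  qed
  ultimately show ?thesis by blast
qed

lemma divisor_sum_minus: "divisor_sum \<phi> (D - D') = divisor_sum \<phi> D - divisor_sum \<phi> D'"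
  using divisor_sum_add[of \<phi> "D - D'" D'] by simp

theorem line_bundle_eq_iff_abel_jacobi_eq:
  assumes p0: "p0 \<in> points C" and D: "D \<in> Div C d" "D' \<in> Div C d"
  shows "line_bundle C D = line_bundle C D' \<longleftrightarrow> abel_jacobi C p0 D = abel_jacobi C p0 D'"
proof -
  have K: "Poly_Mapping.keys D \<subseteq> points C" "Poly_Mapping.keys D' \<subseteq> points C"
    using D by (auto simp: Div_def)
  have E: "Poly_Mapping.keys (D - D') \<subseteq> points C"
    using keys_diff[of D D'] K by auto
  have "line_bundle C D = line_bundle C D' \<longleftrightarrow> (\<exists>F. rational_on C (points C) F \<and>
      (\<forall>p\<in>points C. ord_at C F p = Poly_Mapping.lookup (D - D') p))"
    unfolding line_bundle_eq_iff[OF K] lookup_minus ..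
  also have "\<dots> \<longleftrightarrow> (\<exists>n\<in>chains. (\<forall>v\<in>verts (skel C). boundary n v = base_degree (D - D') v) \<and>
    (\<forall>\<omega>\<in>one_forms C. chain_integral n \<omega> + divisor_sum (offset \<omega>) (D - D') = 0))"
    using rational_function_imp_chain[OF E] chain_imp_rational_function[OF E] by meson
  also have "\<dots> \<longleftrightarrow> abel_jacobi C p0 D = abel_jacobi C p0 D'"
    unfolding abel_jacobi_eq_iff[OF p0 D] by (simp add: divisor_sum_minus base_degree_def add_diff_eq)
  finally show ?thesis .
qed


section \<open>Surjectivity\<close>

text \<open>The segment representing \<open>\<alpha>\<close> may be longer than the edge. Dividing
  by a large integer makes it fit, and the integer becomes a multiplicity, with the sign of
  \<open>\<alpha>\<close>. A vanishing form or coefficient is met by multiplicity 0.\<close>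

lemma ex_multiple_point:
  assumes e: "e \<in> edges C"
  shows "\<exists>(N::int) x. EdgePt e x \<in> points C \<and>
    (\<forall>\<omega>\<in>one_forms C. of_int N * offset \<omega> (EdgePt e x) = \<alpha> * \<omega> (e, True))"
proof (cases "(lo C e = - \<infinity> \<or> hi C e = \<infinity>) \<or> \<alpha> = 0")
  case True
  obtain x where "EdgePt e x \<in> points C" using ex_edge_point[OF e] .
  moreover have "\<alpha> * \<omega> (e, True) = 0" if "\<omega> \<in> one_forms C" for \<omega>
    using True one_form_leaf[OF that e] by auto
  ultimately show ?thesis by (intro exI[of _ 0] exI[of _ x]) simp
next
  case False
  obtain a b where ab: "lo C e = ereal a" "hi C e = ereal b" "a < b" "edge_length e = b - a"
    by (rule finite_edge_ends[OF e]) (use False in auto)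
  \<comment> \<open>This bound places \<open>a + \<bar>\<alpha>\<bar> / m\<close> strictly below
    \<open>b\<close>; since \<open>\<alpha>\<close> is nonzero in this case, it is also strictly
    above \<open>a\<close>.\<close>
  obtain m :: nat where m: "\<bar>\<alpha>\<bar> / (b - a) < real m"
    using reals_Archimedean2 by blast
  have m0: "0 < real m" using m ab(3) by (smt (verit) divide_nonneg_pos)
  define x where "x = a + \<bar>\<alpha>\<bar> / real m"
  have "0 < \<bar>\<alpha>\<bar> / real m" "\<bar>\<alpha>\<bar> / real m < b - a"
    using False m m0 ab(3) by (auto simp: field_simps)
  then have "EdgePt e x \<in> points C" using e ab by (simp add: EdgePt_in_points x_def)
  moreover have "of_int (int m * (if \<alpha> < 0 then - 1 else 1)) * (x - a) = \<alpha>"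
    using m0 by (simp add: x_def)
  then have "of_int (int m * (if \<alpha> < 0 then - 1 else 1)) * offset \<omega> (EdgePt e x) = \<alpha> * \<omega> (e, True)" for \<omega>
    using ab by (simp add: offset_def mult.left_commute mult.commute)
  ultimately show ?thesis by blast
qed

lemma divisor_sum_single: "divisor_sum \<phi> (Poly_Mapping.single p k) = of_int k * \<phi> p"
  by (subst divisor_sum_superset[of "{p}"]) auto

lemma divisor_sum_zero: "divisor_sum \<phi> 0 = 0"
  by (simp add: divisor_sum_def)

lemma divisor_sum_sum: "divisor_sum \<phi> (\<Sum>i\<in>I. D i) = (\<Sum>i\<in>I. divisor_sum \<phi> (D i))"
  by (induction I rule: infinite_finite_induct) (simp_all add: divisor_sum_add divisor_sum_zero)

lemma abel_jacobi_surj: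
  assumes p0: "p0 \<in> points C" and X: "X \<in> Jac C"
  shows "\<exists>D\<in>Div C d. abel_jacobi C p0 D = X"
proof -
  obtain G where G: "G \<in> dual_forms C" "X = mod_periods C `` {G}"
    using X unfolding Jac_def by (rule quotientE)
  \<comment> \<open>By antisymmetry a 1-form is determined by its values in the increasing
    directions.\<close>
  let ?S = "(\<lambda>e. (e, True)) ` edges C"
  have "\<exists>a. \<forall>\<omega>\<in>one_forms C. G \<omega> = (\<Sum>s\<in>?S. a s * \<omega> s)"
  proof (rule linear_functional_coordinates)
    show "\<omega> = (\<lambda>i. 0)" if \<omega>: "\<omega> \<in> one_forms C" and 0: "\<And>s. s \<in> ?S \<Longrightarrow> \<omega> s = 0" for \<omega>
    proof
      fix \<xi> :: "'e \<times> bool"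
      obtain e b where \<xi>: "\<xi> = (e, b)" by (cases \<xi>)
      have "\<omega> (e, False) = - \<omega> (e, True)" "e \<notin> edges C \<Longrightarrow> \<omega> (e, b) = 0"
        using one_form_opposite[OF \<omega>] \<omega> by (auto simp: one_forms_def)
      then show "\<omega> \<xi> = 0" using 0[of "(e, True)"] \<xi> by (cases "e \<in> edges C"; cases b) auto
    qed
  qed (use finite_edges G(1) in \<open>auto simp: dual_forms_def intro: one_forms_add one_forms_scale\<close>)
  then obtain a where "\<And>\<omega>. \<omega> \<in> one_forms C \<Longrightarrow> G \<omega> = (\<Sum>s\<in>?S. a s * \<omega> s)" by blast
  then have a: "G \<omega> = (\<Sum>e\<in>edges C. a (e, True) * \<omega> (e, True))" if "\<omega> \<in> one_forms C" for \<omega>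
    using that by (simp add: sum.reindex inj_on_def)
  have "\<forall>e\<in>edges C. \<exists>Nx. EdgePt e (snd Nx) \<in> points C \<and>
      (\<forall>\<omega>\<in>one_forms C. of_int (fst Nx) * offset \<omega> (EdgePt e (snd Nx)) = a (e, True) * \<omega> (e, True))"
    using ex_multiple_point by fastforce
  then obtain Nx where "\<forall>e\<in>edges C. EdgePt e (snd (Nx e)) \<in> points C \<and>
      (\<forall>\<omega>\<in>one_forms C. of_int (fst (Nx e)) * offset \<omega> (EdgePt e (snd (Nx e))) = a (e, True) * \<omega> (e, True))"
    unfolding bchoice_iff by blast
  then obtain N :: "'e \<Rightarrow> int" and x where N: "\<And>e. e \<in> edges C \<Longrightarrow> EdgePt e (x e) \<in> points C"
    "\<And>e \<omega>. e \<in> edges C \<Longrightarrow> \<omega> \<in> one_forms C \<Longrightarrow>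
      of_int (N e) * offset \<omega> (EdgePt e (x e)) = a (e, True) * \<omega> (e, True)"
    using that[of "\<lambda>e. snd (Nx e)" "\<lambda>e. fst (Nx e)"] by blast
  let ?P = "\<lambda>e. Poly_Mapping.single (EdgePt e (x e)) (N e) + Poly_Mapping.single (Vertex (tail (skel C) e)) (- N e)"
  \<comment> \<open>The first term supplies the degree. Each pair has degree 0 and, since vertices
    have offset 0, contributes exactly the term of its edge to the functional
    \<open>G\<close>.\<close>
  define D where "D = Poly_Mapping.single p0 d + (\<Sum>e\<in>edges C. ?P e)"
  have sum: "divisor_sum \<phi> D = of_int d * \<phi> p0 +
      (\<Sum>e\<in>edges C. of_int (N e) * \<phi> (EdgePt e (x e)) - of_int (N e) * \<phi> (Vertex (tail (skel C) e)))"
    for \<phi> :: "('v, 'e) point \<Rightarrow> 'a::comm_ring_1"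
    by (simp add: D_def divisor_sum_add divisor_sum_sum divisor_sum_single)
  have "Poly_Mapping.keys (?P e) \<subseteq> points C" if "e \<in> edges C" for e
    using Poly_Mapping.keys_add[of "Poly_Mapping.single (EdgePt e (x e)) (N e)"
        "Poly_Mapping.single (Vertex (tail (skel C) e)) (- N e)"] N(1)[OF that] tail_in_verts[OF that]
    by (auto simp: Vertex_in_points split: if_splits)
  then have "Poly_Mapping.keys (\<Sum>e\<in>edges C. ?P e) \<subseteq> points C"
    using Poly_Mapping.keys_sum[of ?P "edges C"] by blast
  then have keys: "Poly_Mapping.keys D \<subseteq> points C"
    using Poly_Mapping.keys_add[of "Poly_Mapping.single p0 d" "\<Sum>e\<in>edges C. ?P e"] p0
    unfolding D_def by (auto split: if_splits)
  have deg: "degree D = d"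
    unfolding degree_eq_divisor_sum by (simp add: sum)
  have D: "D \<in> Div C d" using keys deg by (simp add: Div_def)
  \<comment> \<open>An interior point and the tail of its edge have the same base, so the pairs
    cancel here. This makes the chain \<open>c\<close> below a cycle, whatever paths were
    chosen.\<close>
  have bd: "base_degree D v = d * (if v = base p0 then 1 else 0)" for v
    unfolding base_degree_def by (simp add: sum base_def)
  obtain c where c: "c \<in> chains"
    "\<And>v. boundary c v = base_degree D v - d * (if v = base p0 then 1 else 0)"
    "\<And>\<omega>. \<omega> \<in> one_forms C \<Longrightarrow> abel_jacobi_functional p0 D \<omega> =
      chain_integral c \<omega> + divisor_sum (offset \<omega>) D - of_int d * offset \<omega> p0"
    using abel_jacobi_functional_chain[OF p0 keys] deg by auto
  have "c \<in> H1 C" using c(1,2) bd by (simp add: H1_iff)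
  moreover have "abel_jacobi_functional p0 D \<omega> - G \<omega> = chain_integral c \<omega>" if \<omega>: "\<omega> \<in> one_forms C" for \<omega>
  proof -
    have "divisor_sum (offset \<omega>) D = of_int d * offset \<omega> p0 + G \<omega>"
      unfolding a[OF \<omega>] sum using N(2)[OF _ \<omega>] by (simp add: offset_def[of _ "Vertex _"])
    then show ?thesis using c(3)[OF \<omega>] by simp
  qed
  ultimately have "(abel_jacobi_functional p0 D, G) \<in> mod_periods C"
    using abel_jacobi_functional_dual G(1) by (auto simp: mod_periods_iff)
  then have "abel_jacobi C p0 D = X"
    unfolding abel_jacobi_eq G(2) by (rule equiv_class_eq[OF equiv_mod_periods])
  with D show ?thesis by blast
qed

end

theorem theorem6p2:
  fixes C :: "('v, 'e) metric_graph" and g :: nat and p0 :: "('v, 'e) point" and d :: int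
  assumes "tropical_curve C" and "genus C = g" and "p0 \<in> points C"
  shows "line_bundle C \<in> Div C d \<rightarrow> Pic_deg C d \<and>
         (\<exists>\<phi>. (\<forall>D\<in>Div C d. \<phi> (line_bundle C D) = abel_jacobi C p0 D) \<and>
              bij_betw \<phi> (Pic_deg C d) (Jac C))"
proof
  interpret compact_tropical_curve C by unfold_locales (rule assms(1))
  have Pic: "Pic_deg C d = line_bundle C ` Div C d"
    using line_bundle_in_Pic by (auto simp: Pic_deg_def Div_def)
  then show "line_bundle C \<in> Div C d \<rightarrow> Pic_deg C d" by auto
  note iff = line_bundle_eq_iff_abel_jacobi_eq[OF assms(3)]
  \<comment> \<open>One direction of \<open>iff\<close> makes the value independent of the chosen
    divisor, the other gives injectivity.\<close>
  define \<phi> where "\<phi> L = abel_jacobi C p0 (SOME D. D \<in> Div C d \<and> line_bundle C D = L)" for L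
  have \<phi>: "\<phi> (line_bundle C D) = abel_jacobi C p0 D" if D: "D \<in> Div C d" for D
  proof -
    have "\<exists>D'. D' \<in> Div C d \<and> line_bundle C D' = line_bundle C D" using D by blast
    from someI_ex[OF this] show ?thesis unfolding \<phi>_def using iff[OF _ D] by blast
  qed
  have "inj_on \<phi> (Pic_deg C d)"
    unfolding Pic using \<phi> iff by (auto simp: inj_on_def)
  moreover have "\<phi> ` Pic_deg C d = Jac C"
    unfolding Pic image_image using \<phi> abel_jacobi_in_Jac abel_jacobi_surj[OF assms(3)] by force
  ultimately have "bij_betw \<phi> (Pic_deg C d) (Jac C)" by (simp add: bij_betw_def)
  then show "\<exists>\<phi>. (\<forall>D\<in>Div C d. \<phi> (line_bundle C D) = abel_jacobi C p0 D) \<and>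
      bij_betw \<phi> (Pic_deg C d) (Jac C)"
    by (intro exI[of _ \<phi>] conjI ballI) (rule \<phi>)
qed

end
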